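(* Let $(M,g)$ be a compact oriented two-dimensional Riemannian manifold, possibly with smooth boundary $\partial M$. Let $u$ be an Arnold stable stationary solution of the incompressible Euler equation on $M$, and let $Y$ be a divergence-free vector field on $M$ which is tangent to $\partial M$. Suppose that there exist stream functions of $u$ and of $Y$. Then $$MC_{u,Y}\le 0 .$$
   Context: All functions and vector fields are smooth. Let $\mu$ be the Riemannian volume form of $(M,g)$ and $\nabla$ the Levi-Civita connection. The Hodge star $\star$ acts on vector fields as rotation by $\frac{\pi}{2}$ in the tangent planes, so $\star^2=-1$ on vector fields. Put $\Delta:=\operatorname{div}\circ\operatorname{grad}$ (Laplace-Beltrami operator). If $\partial M=\emptyset$, all conditions on the boundary are void. Stationary solution: a vector field $u$ on $M$ is a stationary solution of the incompressible Euler equation if there is a function $p$ on $M$ with $\nabla_u u=-\operatorname{grad}p$ and $\operatorname{div}u=0$ on $M$, and $u$ is tangent to $\partial M$ (i.e. $g(u,\nu)=0$ on $\partial M$, with $\nu$ the unit normal). Stream function: a stream function of a divergence-free vector field $V$ tangent to $\partial M$ is a function $\psi$ on $M$ with $\star\operatorname{grad}\psi=V$. First eigenvalue: $\lambda_1$ is the first eigenvalue of $-\Delta$, on functions of zero mean if $\partial M=\emptyset$ and on functions vanishing on $\partial M$ (Dirichlet condition) if $\partial M\neq\emptyset$. That is, $\lambda_1$ is the largest constant such that $\int_M f\,\Delta f\,\mu\le-\lambda_1\int_M f^2\mu$ for all functions $f$ on $M$ with $\int_M f\mu=0$ (if $\partial M=\emptyset$), respectively $f|_{\partial M}=0$ (if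 $\partial M\ne\emptyset$). Arnold stability: let $u$ be a stationary solution having a stream function $\psi$, and set $\omega:=\Delta\psi$. Then $\operatorname{grad}\omega$ and $\operatorname{grad}\psi$ are collinear, and one writes $\omega=F(\psi)$ for a possibly multivalued function $F$ on $\mathbb{R}$; $F'(\psi)$ is the ratio $\operatorname{grad}\omega/\operatorname{grad}\psi$. The solution $u$ is called Arnold stable if either $-\lambda_1<F'(\psi)<0$ or $0<F'(\psi)<\infty$. Precisely: there is a function $c:M\to\mathbb{R}$ (this is $F'(\psi)$; no regularity of $c$ is required) with $\operatorname{grad}\omega=c\,\operatorname{grad}\psi$ on $M$, such that either $-\lambda_1<c(x)<0$ for all $x\in M$, or $0<c(x)<\infty$ for all $x\in M$. Misiołek curvature: for vector fields $V,W$ on $M$ put $\langle V,W\rangle:=\int_M g(V,W)\mu$ and $|V|^2:=\langle V,V\rangle$. For a stationary solution $u$ and a divergence-free vector field $Y$ tangent to $\partial M$, $$MC_{u,Y}:=-|[u,Y]|^2-\langle[[u,Y],Y],u\rangle,$$ where $[\cdot,\cdot]$ is the Lie bracket of vector fields. *)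

theory Defs
  imports "HOL-Analysis.Analysis"
begin

primrec Ck :: "nat \<Rightarrow> 'a::real_normed_vector set \<Rightarrow> ('a \<Rightarrow> 'b::real_normed_vector) \<Rightarrow> bool" where
  "Ck 0 S f \<longleftrightarrow> continuous_on S f"
| "Ck (Suc k) S f \<longleftrightarrow> (\<forall>x\<in>S. f differentiable (at x)) \<and>
     (\<forall>v. Ck k S (\<lambda>x. frechet_derivative f (at x) v))"

text \<open>On a set that need not be open (here: a relatively open subset of a half plane), smooth
  means locally extendable to a smooth map on an open set.\<close>

definition smooth_on :: "'a::real_normed_vector set \<Rightarrow> ('a \<Rightarrow> 'b::real_normed_vector) \<Rightarrow> bool" where
  "smooth_on A f \<longleftrightarrow> (\<forall>x\<in>A. \<exists>W F. open W \<and> x \<in> W \<and> (\<forall>k. Ck k W F) \<and> (\<forall>y\<in>W \<inter> A. F y = f y))"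

definition half_plane :: "(real^2) set" where
  "half_plane = {x. 0 \<le> x $ 2}"

datatype 'a chart = Chart (cdom: "'a set") (coord: "'a \<Rightarrow> real^2")

definition img :: "'a chart \<Rightarrow> (real^2) set" where
  "img c = coord c ` cdom c"

definition chart_inv :: "'a chart \<Rightarrow> real^2 \<Rightarrow> 'a" where
  "chart_inv c = inv_into (cdom c) (coord c)"

text \<open>Differential of \<open>f\<close> at \<open>p\<close> in the chart \<open>c\<close>. It is taken within the image of the chart, so that
  it is one-sided at boundary points.\<close>

definition dchart :: "'a chart \<Rightarrow> ('a \<Rightarrow> 'b::real_normed_vector) \<Rightarrow> 'a \<Rightarrow> real^2 \<Rightarrow> 'b" where
  "dchart c f p = frechet_derivative (f \<circ> chart_inv c) (at (coord c p) within img c)"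

definition partial :: "'a chart \<Rightarrow> 2 \<Rightarrow> ('a \<Rightarrow> real) \<Rightarrow> 'a \<Rightarrow> real" where
  "partial c i f p = dchart c f p (axis i 1)"

text \<open>Jacobian matrix at \<open>p\<close> of the change of coordinates from \<open>c\<close> to \<open>c'\<close>.\<close>

definition jacobian :: "'a chart \<Rightarrow> 'a chart \<Rightarrow> 'a \<Rightarrow> real^2^2" where
  "jacobian c c' p = matrix (dchart c (coord c') p)"

text \<open>Tensor fields are given by their components in every chart of the atlas, subject to the
  transformation law; \<open>gmat M c p\<close> is the Gram matrix of the Riemannian metric at \<open>p\<close> in
  the coordinate basis of the chart \<open>c\<close>.\<close>

record 'a surface =
  top_of :: "'a topology"
  atlas :: "'a chart set"
  gmat :: "'a chart \<Rightarrow> 'a \<Rightarrow> real^2^2"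

type_synonym 'a vfield = "'a chart \<Rightarrow> 'a \<Rightarrow> real^2"

abbreviation points :: "('a, 'z) surface_scheme \<Rightarrow> 'a set" where
  "points M \<equiv> topspace (top_of M)"

text \<open>Second countability follows from compactness. The empty surface is allowed.\<close>

definition compact_oriented_surface :: "('a, 'z) surface_scheme \<Rightarrow> bool" where
  "compact_oriented_surface M \<longleftrightarrow>
     compact_space (top_of M) \<and> Hausdorff_space (top_of M) \<and>
     (\<Union>c\<in>atlas M. cdom c) = points M \<and>
     (\<forall>c\<in>atlas M. openin (top_of M) (cdom c) \<and>
        openin (top_of_set half_plane) (img c) \<and>
        homeomorphic_map (subtopology (top_of M) (cdom c)) (top_of_set (img c)) (coord c)) \<and>
     (\<forall>c\<in>atlas M. \<forall>c'\<in>atlas M.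
        smooth_on (coord c ` (cdom c \<inter> cdom c')) (coord c' \<circ> chart_inv c) \<and>
        (\<forall>p\<in>cdom c \<inter> cdom c'. 0 < det (jacobian c c' p)))"

definition riemannian_metric :: "('a, 'z) surface_scheme \<Rightarrow> bool" where
  "riemannian_metric M \<longleftrightarrow>
     (\<forall>c\<in>atlas M. smooth_on (img c) (gmat M c \<circ> chart_inv c) \<and>
        (\<forall>p\<in>cdom c. transpose (gmat M c p) = gmat M c p \<and>
           (\<forall>v. v \<noteq> 0 \<longrightarrow> 0 < v \<bullet> (gmat M c p *v v)))) \<and>
     (\<forall>c\<in>atlas M. \<forall>c'\<in>atlas M. \<forall>p\<in>cdom c \<inter> cdom c'.
        gmat M c p = transpose (jacobian c c' p) ** gmat M c' p ** jacobian c c' p)"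

definition compact_oriented_riemannian_surface :: "('a, 'z) surface_scheme \<Rightarrow> bool" where
  "compact_oriented_riemannian_surface M \<longleftrightarrow> compact_oriented_surface M \<and> riemannian_metric M"

definition boundary :: "('a, 'z) surface_scheme \<Rightarrow> 'a set" where
  "boundary M = {p. \<exists>c\<in>atlas M. p \<in> cdom c \<and> coord c p $ 2 = 0}"

definition smooth_fun :: "('a, 'z) surface_scheme \<Rightarrow> ('a \<Rightarrow> real) \<Rightarrow> bool" where
  "smooth_fun M f \<longleftrightarrow> (\<forall>c\<in>atlas M. smooth_on (img c) (f \<circ> chart_inv c))"

definition vector_field :: "('a, 'z) surface_scheme \<Rightarrow> 'a vfield \<Rightarrow> bool" where
  "vector_field M V \<longleftrightarrow>
     (\<forall>c\<in>atlas M. smooth_on (img c) (V c \<circ> chart_inv c)) \<and>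
     (\<forall>c\<in>atlas M. \<forall>c'\<in>atlas M. \<forall>p\<in>cdom c \<inter> cdom c'. V c' p = jacobian c c' p *v V c p)"

text \<open>Component families are only meaningful on the domains of the charts of the atlas; this is
  equality of the vector fields they represent.\<close>

definition vf_eq :: "('a, 'z) surface_scheme \<Rightarrow> 'a vfield \<Rightarrow> 'a vfield \<Rightarrow> bool" where
  "vf_eq M V W \<longleftrightarrow> (\<forall>c\<in>atlas M. \<forall>p\<in>cdom c. V c p = W c p)"

text \<open>Scalars built from components are coordinate independent; they are evaluated in some
  chart around the point.\<close>

definition chart_at :: "('a, 'z) surface_scheme \<Rightarrow> 'a \<Rightarrow> 'a chart" where
  "chart_at M p = (SOME c. c \<in> atlas M \<and> p \<in> cdom c)"

definition ip :: "('a, 'z) surface_scheme \<Rightarrow> 'a chart \<Rightarrow> 'a \<Rightarrow> real^2 \<Rightarrow> real^2 \<Rightarrow> real" where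
  "ip M c p v w = v \<bullet> (gmat M c p *v w)"

definition g_fun :: "('a, 'z) surface_scheme \<Rightarrow> 'a vfield \<Rightarrow> 'a vfield \<Rightarrow> 'a \<Rightarrow> real" where
  "g_fun M V W p = (let c = chart_at M p in ip M c p (V c p) (W c p))"

text \<open>Tangent vectors to the boundary are, in a chart, those with vanishing second component.\<close>

definition unit_normal :: "('a, 'z) surface_scheme \<Rightarrow> 'a chart \<Rightarrow> 'a \<Rightarrow> real^2 \<Rightarrow> bool" where
  "unit_normal M c p \<nu> \<longleftrightarrow> ip M c p \<nu> \<nu> = 1 \<and> (\<forall>t. t $ 2 = 0 \<longrightarrow> ip M c p \<nu> t = 0)"

definition tangent_to_boundary :: "('a, 'z) surface_scheme \<Rightarrow> 'a vfield \<Rightarrow> bool" where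
  "tangent_to_boundary M V \<longleftrightarrow>
     (\<forall>c\<in>atlas M. \<forall>p\<in>cdom c \<inter> boundary M. \<forall>\<nu>. unit_normal M c p \<nu> \<longrightarrow> ip M c p (V c p) \<nu> = 0)"

definition vol_density :: "('a, 'z) surface_scheme \<Rightarrow> 'a chart \<Rightarrow> 'a \<Rightarrow> real" where
  "vol_density M c p = sqrt (det (gmat M c p))"

definition partition_of_unity ::
    "('a, 'z) surface_scheme \<Rightarrow> nat \<Rightarrow> (nat \<Rightarrow> 'a chart) \<Rightarrow> (nat \<Rightarrow> 'a \<Rightarrow> real) \<Rightarrow> bool" where
  "partition_of_unity M n c \<rho> \<longleftrightarrow>
     (\<forall>i<n. c i \<in> atlas M \<and> smooth_fun M (\<rho> i) \<and> (\<forall>p\<in>points M. 0 \<le> \<rho> i p) \<and>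
        top_of M closure_of {p \<in> points M. \<rho> i p \<noteq> 0} \<subseteq> cdom (c i)) \<and>
     (\<forall>p\<in>points M. (\<Sum>i<n. \<rho> i p) = 1)"

text \<open>The integral of a smooth function; the value does not depend on the partition of unity.\<close>

definition mint :: "('a, 'z) surface_scheme \<Rightarrow> ('a \<Rightarrow> real) \<Rightarrow> real" where
  "mint M f = (THE I. \<exists>n c \<rho>. partition_of_unity M n c \<rho> \<and>
     I = (\<Sum>i<n. integral (img (c i))
            ((\<lambda>p. \<rho> i p * f p * vol_density M (c i) p) \<circ> chart_inv (c i))))"

definition inner_L2 :: "('a, 'z) surface_scheme \<Rightarrow> 'a vfield \<Rightarrow> 'a vfield \<Rightarrow> real" where
  "inner_L2 M V W = mint M (g_fun M V W)"

definition grad :: "('a, 'z) surface_scheme \<Rightarrow> ('a \<Rightarrow> real) \<Rightarrow> 'a vfield" where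
  "grad M f c p = matrix_inv (gmat M c p) *v (\<chi> i. partial c i f p)"

text \<open>The coordinate form of the requirement that the Lie derivative of the volume form along \<open>V\<close> is
  \<open>div V\<close> times the volume form.\<close>

definition divergence :: "('a, 'z) surface_scheme \<Rightarrow> 'a vfield \<Rightarrow> 'a \<Rightarrow> real" where
  "divergence M V p = (let c = chart_at M p in
     (\<Sum>i\<in>UNIV. partial c i (\<lambda>q. vol_density M c q * V c q $ i) p) / vol_density M c p)"

definition laplacian :: "('a, 'z) surface_scheme \<Rightarrow> ('a \<Rightarrow> real) \<Rightarrow> 'a \<Rightarrow> real" where
  "laplacian M f = divergence M (grad M f)"

definition lie_bracket :: "'a vfield \<Rightarrow> 'a vfield \<Rightarrow> 'a vfield" where
  "lie_bracket V W c p = (\<chi> k. \<Sum>i\<in>UNIV.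
     V c p $ i * partial c i (\<lambda>q. W c q $ k) p - W c p $ i * partial c i (\<lambda>q. V c q $ k) p)"

definition christoffel :: "('a, 'z) surface_scheme \<Rightarrow> 'a chart \<Rightarrow> 'a \<Rightarrow> 2 \<Rightarrow> 2 \<Rightarrow> 2 \<Rightarrow> real" where
  "christoffel M c p k i j = (\<Sum>l\<in>UNIV. matrix_inv (gmat M c p) $ k $ l *
     (partial c i (\<lambda>q. gmat M c q $ j $ l) p + partial c j (\<lambda>q. gmat M c q $ i $ l) p
        - partial c l (\<lambda>q. gmat M c q $ i $ j) p)) / 2"

text \<open>\<open>nabla M V W\<close> is the Levi-Civita derivative of \<open>W\<close> in direction \<open>V\<close>.\<close>

definition nabla :: "('a, 'z) surface_scheme \<Rightarrow> 'a vfield \<Rightarrow> 'a vfield \<Rightarrow> 'a vfield" where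
  "nabla M V W c p = (\<chi> k. \<Sum>i\<in>UNIV. V c p $ i *
     (partial c i (\<lambda>q. W c q $ k) p + (\<Sum>j\<in>UNIV. christoffel M c p k i j * W c p $ j)))"

text \<open>Rotation by a quarter turn with respect to a positive definite Gram matrix \<open>G\<close>, counterclockwise
  for the standard orientation. The lemmas below confirm that it is the rotation.\<close>

definition rot90 :: "real^2^2 \<Rightarrow> real^2 \<Rightarrow> real^2" where
  "rot90 G v = (1 / sqrt (det G)) *\<^sub>R vector [- (G *v v) $ 2, (G *v v) $ 1]"

lemma rot90_orthogonal: "rot90 G v \<bullet> (G *v v) = 0"
  by (simp add: rot90_def inner_vec_def sum_2)

lemma rot90_rotates:
  assumes sym: "transpose G = G" and pos: "\<And>v. v \<noteq> 0 \<Longrightarrow> 0 < v \<bullet> (G *v v)"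
  shows "rot90 G v \<bullet> (G *v rot90 G v) = v \<bullet> (G *v v)"
    and "v \<noteq> 0 \<Longrightarrow> 0 < det (vector [v, rot90 G v] :: real^2^2)"
proof -
  have "transpose G $ 2 $ 1 = G $ 1 $ 2"
    by (simp add: transpose_def)
  hence s: "G $ 2 $ 1 = G $ 1 $ 2"
    by (simp add: sym)
  have Q: "w \<bullet> (G *v w) = G $ 1 $ 1 * (w $ 1)\<^sup>2 + 2 * (G $ 1 $ 2 * w $ 1 * w $ 2) + G $ 2 $ 2 * (w $ 2)\<^sup>2" for w
    by (simp add: matrix_vector_mult_def inner_vec_def sum_2 s power2_eq_square algebra_simps)
  have nz: "w \<noteq> 0" if "w $ 1 \<noteq> 0" for w :: "real^2"
    using that by auto
  have nz2: "w \<noteq> 0" if "w $ 2 \<noteq> 0" for w :: "real^2"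
    using that by auto
  have a: "0 < G $ 1 $ 1"
    using pos[OF nz, of "vector [1, 0]"] by (simp add: Q)
  have "0 < G $ 1 $ 1 * det G"
    using pos[OF nz2, of "vector [- G $ 1 $ 2, G $ 1 $ 1]"] a
    by (simp add: Q det_2 s power2_eq_square algebra_simps)
  hence d: "0 < det G"
    using a by (simp add: zero_less_mult_iff)
  define D where "D = sqrt (det G)"
  have D: "0 < D" "D\<^sup>2 = det G"
    using d by (auto simp: D_def)
  define w :: "real^2" where "w = vector [- (G *v v) $ 2, (G *v v) $ 1]"
  have "w \<bullet> (G *v w) = D\<^sup>2 * (v \<bullet> (G *v v))"
    unfolding D(2) w_def Q
    by (simp add: matrix_vector_mult_def sum_2 det_2 s power2_eq_square algebra_simps)
  moreover have r: "rot90 G v = (1 / D) *\<^sub>R w"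
    by (simp add: rot90_def w_def D_def)
  ultimately show "rot90 G v \<bullet> (G *v rot90 G v) = v \<bullet> (G *v v)"
    using D(1) by (simp add: matrix_vector_mult_scaleR power2_eq_square)
  assume "v \<noteq> 0"
  then have "0 < (v \<bullet> (G *v v)) / D"
    using pos D(1) by simp
  also have "(v \<bullet> (G *v v)) / D = det (vector [v, rot90 G v] :: real^2^2)"
    using D(1) by (simp add: r w_def det_2 inner_vec_def sum_2 add_divide_distrib)
  finally show "0 < det (vector [v, rot90 G v] :: real^2^2)" .
qed

definition hodge_star :: "('a, 'z) surface_scheme \<Rightarrow> 'a vfield \<Rightarrow> 'a vfield" where
  "hodge_star M V c p = rot90 (gmat M c p) (V c p)"

definition stationary_solution :: "('a, 'z) surface_scheme \<Rightarrow> 'a vfield \<Rightarrow> bool" where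
  "stationary_solution M u \<longleftrightarrow> vector_field M u \<and>
     (\<exists>P. smooth_fun M P \<and> vf_eq M (nabla M u u) (\<lambda>c p. - grad M P c p)) \<and>
     (\<forall>p\<in>points M. divergence M u p = 0) \<and> tangent_to_boundary M u"

definition stream_function :: "('a, 'z) surface_scheme \<Rightarrow> 'a vfield \<Rightarrow> ('a \<Rightarrow> real) \<Rightarrow> bool" where
  "stream_function M V \<psi> \<longleftrightarrow> smooth_fun M \<psi> \<and> vf_eq M (hodge_star M (grad M \<psi>)) V"

definition first_eigenvalue :: "('a, 'z) surface_scheme \<Rightarrow> real" where
  "first_eigenvalue M = (GREATEST l. \<forall>f. smooth_fun M f \<longrightarrow>
     (if boundary M = {} then mint M f = 0 else \<forall>p\<in>boundary M. f p = 0) \<longrightarrow>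
     mint M (\<lambda>p. f p * laplacian M f p) \<le> - l * mint M (\<lambda>p. (f p)\<^sup>2))"

text \<open>The vector field \<open>grad \<psi>\<close>, hence the vorticity, does not depend on the choice of the stream
  function.\<close>

definition arnold_stable :: "('a, 'z) surface_scheme \<Rightarrow> 'a vfield \<Rightarrow> bool" where
  "arnold_stable M u \<longleftrightarrow> stationary_solution M u \<and>
     (\<exists>\<psi> F'. stream_function M u \<psi> \<and>
        vf_eq M (grad M (laplacian M \<psi>)) (\<lambda>c p. F' p *\<^sub>R grad M \<psi> c p) \<and>
        ((\<forall>p\<in>points M. - first_eigenvalue M < F' p \<and> F' p < (0::real)) \<or>
         (\<forall>p\<in>points M. 0 < F' p)))"

definition misiolek_curvature :: "('a, 'z) surface_scheme \<Rightarrow> 'a vfield \<Rightarrow> 'a vfield \<Rightarrow> real" where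
  "misiolek_curvature M u Y =
     - inner_L2 M (lie_bracket u Y) (lie_bracket u Y)
     - inner_L2 M (lie_bracket (lie_bracket u Y) Y) u"

end

theory Submission
  imports Defs
begin

text \<open>
  Write \<open>X\<^sub>f = \<star>grad f\<close>, so that \<open>u = X\<^sub>\<psi>\<close> and \<open>Y = X\<^sub>\<phi>\<close>, and put \<open>h = d\<phi>(u)\<close>. Since
  \<open>[X\<^sub>a, X\<^sub>b] = X\<^sub>c\<close> with \<open>c = db(X\<^sub>a)\<close>, we get \<open>[u, Y] = X\<^sub>h\<close>, and \<open>[[u, Y], Y] = X\<^sub>k\<close> with
  \<open>k = d\<phi>(X\<^sub>h) = - dh(Y)\<close>. Tangency of \<open>u\<close> and \<open>Y\<close> makes \<open>h\<close> and \<open>k\<close> vanish on the boundary, hence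
  integration by parts gives, with \<open>\<omega> = \<Delta>\<psi>\<close> and \<open>d\<omega> = F' d\<psi>\<close>,
  \<open>MC = \<integral> h \<Delta>h + \<integral> k \<omega> = \<integral> h \<Delta>h + \<integral> h d\<omega>(Y) = \<integral> h \<Delta>h - \<integral> F' h\<^sup>2\<close>.
  Here \<open>\<integral> h \<Delta>h = - |grad h|\<^sup>2 \<le> 0\<close>, which settles \<open>F' > 0\<close>; and \<open>\<integral> h \<Delta>h \<le> - \<lambda>\<^sub>1 \<integral> h\<^sup>2\<close>, because \<open>h\<close> is
  admissible for \<open>\<lambda>\<^sub>1\<close>, settles \<open>- \<lambda>\<^sub>1 < F' < 0\<close>.
\<close>


subsection \<open>Calculus of smooth functions\<close>

text \<open>The function h is the Poisson bracket of \<psi> and \<phi> for the area form. Behind the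
  identities stand three facts on Hamiltonian fields: they are divergence free, they turn Poisson
  brackets into Lie brackets, and the bracket is antisymmetric. The last one gives d\<omega>(Y) = F'
  d\<psi>(Y) = - F' d\<phi>(u) = - F' h. On a closed surface h has mean zero because h = div(\<phi>
  u); otherwise tangency of Y makes the derivative of \<phi> along the boundary vanish. No
  regularity of F' is assumed, so F' h^2 occurs only as the smooth function - h d\<omega>(Y), which
  is compared pointwise with constant multiples of h^2. Most of the work secures the calculus.
  Scalars are read in a chart picked by \<open>SOME\<close>, so each must be shown independent of
  the chart; the integral is a \<open>THE\<close> over partitions of unity, so their existence and
  the independence of the choice are needed; charts take values in a half plane, so derivatives at
  the boundary are one-sided and are handled through smooth extensions.\<close>

lemma has_derivative_cong_open:
  assumes "open W" "x \<in> W" "\<And>y. y \<in> W \<Longrightarrow> f y = g y"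
  shows "(f has_derivative D) (at x) \<longleftrightarrow> (g has_derivative D) (at x)"
  using assms has_derivative_transform_within_open[of f D x UNIV W g]
    has_derivative_transform_within_open[of g D x UNIV W f] by auto

lemma frechet_derivative_cong_open:
  assumes "open W" "x \<in> W" "\<And>y. y \<in> W \<Longrightarrow> f y = g y"
  shows "frechet_derivative f (at x) = frechet_derivative g (at x)"
  unfolding frechet_derivative_def using has_derivative_cong_open[OF assms] by simp

lemma Ck_cong:
  assumes "open W" "\<And>x. x \<in> W \<Longrightarrow> f x = g x"
  shows "Ck k W f \<longleftrightarrow> Ck k W g"
  using assms(2)
proof (induction k arbitrary: f g)
  case 0
  then show ?case by (simp cong: continuous_on_cong)
next
  case (Suc k)
  have "Ck k W (\<lambda>x. frechet_derivative f (at x) v) \<longleftrightarrow> Ck k W (\<lambda>x. frechet_derivative g (at x) v)" for v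
    by (rule Suc.IH) (simp add: frechet_derivative_cong_open[OF assms(1) _ Suc.prems])
  moreover have "f differentiable (at x) \<longleftrightarrow> g differentiable (at x)" if "x \<in> W" for x
    unfolding differentiable_def using has_derivative_cong_open[OF assms(1) that Suc.prems] by simp
  ultimately show ?case by simp
qed

text \<open>\<open>Ck\<close> differentiates in one fixed direction at a time, so the codomain stays
  the same at every order. This rule puts an explicit derivative in place of
  \<open>frechet_derivative\<close>; most closure properties below are inductions on the order that
  use it.\<close>

lemma Ck_SucI:
  assumes "open W" "\<And>x. x \<in> W \<Longrightarrow> (f has_derivative f' x) (at x)" "\<And>v. Ck k W (\<lambda>x. f' x v)"
  shows "Ck (Suc k) W f"
proof -
  have "Ck k W (\<lambda>x. frechet_derivative f (at x) v) \<longleftrightarrow> Ck k W (\<lambda>x. f' x v)" for v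
    by (rule Ck_cong[OF assms(1)]) (simp add: frechet_derivative_at[OF assms(2), symmetric])
  then show ?thesis
    using assms(2,3) by (auto simp: differentiable_def)
qed

lemma Ck_SucD:
  assumes "Ck (Suc k) W f" "x \<in> W"
  shows "(f has_derivative frechet_derivative f (at x)) (at x)"
  using assms frechet_derivative_works by auto

lemma Ck_Suc_frechet: "Ck (Suc k) W f \<Longrightarrow> Ck k W (\<lambda>x. frechet_derivative f (at x) v)"
  by simp

lemma Ck_lower: "Ck (Suc k) W f \<Longrightarrow> Ck k W f"
proof (induction k arbitrary: f)
  case 0
  then show ?case
    by (auto intro!: continuous_at_imp_continuous_on differentiable_imp_continuous_within)
qed auto

lemma Ck_subset: "Ck k W f \<Longrightarrow> V \<subseteq> W \<Longrightarrow> Ck k V f"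
  by (induction k arbitrary: f) (auto intro: continuous_on_subset)

lemma Ck_const: "Ck k W (\<lambda>x. c)"
  by (induction k arbitrary: c) auto

lemma Ck_bounded_linear:
  assumes "bounded_linear L" "open W" "Ck k W f"
  shows "Ck k W (\<lambda>x. L (f x))"
  using assms(3)
proof (induction k arbitrary: f)
  case 0
  then show ?case using assms(1) by (auto intro: bounded_linear.continuous_on)
next
  case (Suc k)
  show ?case
    by (rule Ck_SucI[OF assms(2) bounded_linear.has_derivative[OF assms(1) Ck_SucD[OF Suc.prems]]])
      (use Suc in auto)
qed

lemma Ck_linear:
  assumes "bounded_linear L" "open W"
  shows "Ck k W L"
proof (cases k)
  case 0
  then show ?thesis using bounded_linear.continuous_on[OF assms(1) continuous_on_id] by simp
next
  case (Suc j)
  then show ?thesis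
    using Ck_SucI[OF assms(2), of L "\<lambda>x. L"] bounded_linear_imp_has_derivative[OF assms(1)] Ck_const
    by blast
qed

lemma Ck_add:
  assumes "open W" "Ck k W f" "Ck k W g"
  shows "Ck k W (\<lambda>x. f x + g x)"
  using assms(2,3)
proof (induction k arbitrary: f g)
  case 0
  then show ?case by (auto intro: continuous_on_add)
next
  case (Suc k)
  show ?case
    by (rule Ck_SucI[OF assms(1) has_derivative_add[OF Ck_SucD[OF Suc.prems(1)] Ck_SucD[OF Suc.prems(2)]]])
      (use Suc in auto)
qed

lemma Ck_scaleR:
  fixes s :: "'a::real_normed_vector \<Rightarrow> real"
  assumes "open W" "Ck k W s" "Ck k W f"
  shows "Ck k W (\<lambda>x. s x *\<^sub>R f x)"
  using assms(2,3)
proof (induction k arbitrary: s f)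
  case 0
  then show ?case by (auto intro: continuous_on_scaleR)
next
  case (Suc k)
  show ?case
    by (rule Ck_SucI[OF assms(1) has_derivative_scaleR[OF Ck_SucD[OF Suc.prems(1)] Ck_SucD[OF Suc.prems(2)]]])
      (use Suc.prems Ck_lower[OF Suc.prems(1)] Ck_lower[OF Suc.prems(2)] in
        \<open>auto intro!: Ck_add[OF assms(1)] Suc.IH\<close>)
qed

lemma Ck_mult:
  fixes f g :: "'a::real_normed_vector \<Rightarrow> real"
  shows "open W \<Longrightarrow> Ck k W f \<Longrightarrow> Ck k W g \<Longrightarrow> Ck k W (\<lambda>x. f x * g x)"
  using Ck_scaleR[of W k f g] by simp

lemma Ck_minus: "open W \<Longrightarrow> Ck k W f \<Longrightarrow> Ck k W (\<lambda>x. - f x)"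
  by (rule Ck_bounded_linear[of uminus]) (auto intro: bounded_linear_minus bounded_linear_ident)

lemma Ck_sum:
  assumes "open W" "\<And>i. i \<in> I \<Longrightarrow> Ck k W (f i)"
  shows "Ck k W (\<lambda>x. \<Sum>i\<in>I. f i x)"
  using assms(2) by (induction I rule: infinite_finite_induct) (auto intro: Ck_const Ck_add[OF assms(1)])

text \<open>The derivative of 1/f is a product of f' and two copies of 1/f, so order k of these
  factors gives order k + 1. The square root below works the same way.\<close>

lemma Ck_inverse:
  fixes f :: "'a::real_normed_vector \<Rightarrow> real"
  assumes "open W" "Ck k W f" "\<And>x. x \<in> W \<Longrightarrow> f x \<noteq> 0"
  shows "Ck k W (\<lambda>x. inverse (f x))"
  using assms(2)
proof (induction k)
  case 0
  then show ?case using assms(3) by (auto intro: continuous_on_inverse)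
next
  case (Suc k)
  have 1: "Ck k W (\<lambda>x. inverse (f x))" using Suc Ck_lower by blast
  have 2: "Ck k W (\<lambda>x. - (inverse (f x) * frechet_derivative f (at x) v * inverse (f x)))" for v
    by (intro Ck_minus Ck_mult 1 assms(1)) (use Suc.prems in auto)
  show ?case
    by (rule Ck_SucI[OF assms(1) Deriv.has_derivative_inverse[OF assms(3) Ck_SucD[OF Suc.prems]] 2]) auto
qed

lemma Ck_sqrt:
  fixes f :: "'a::real_normed_vector \<Rightarrow> real"
  assumes "open W" "Ck k W f" "\<And>x. x \<in> W \<Longrightarrow> 0 < f x"
  shows "Ck k W (\<lambda>x. sqrt (f x))"
  using assms(2)
proof (induction k)
  case 0
  then show ?case by (auto intro: continuous_on_real_sqrt)
next
  case (Suc k)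
  have 1: "Ck k W (\<lambda>x. inverse (sqrt (f x)))"
    by (rule Ck_inverse[OF assms(1) Suc.IH[OF Ck_lower[OF Suc.prems]]]) (use assms(3) in force)
  have 2: "Ck k W (\<lambda>x. frechet_derivative f (at x) v * (inverse (sqrt (f x)) * (1/2)))" for v
    by (intro Ck_mult 1 assms(1) Ck_const) (use Suc.prems in auto)
  have 3: "((\<lambda>x. sqrt (f x)) has_derivative (\<lambda>v. frechet_derivative f (at x) v * (inverse (sqrt (f x)) * (1/2)))) (at x)"
    if "x \<in> W" for x
    by (rule has_derivative_eq_rhs, rule derivative_intros, rule assms(3)[OF that],
        rule Ck_SucD[OF Suc.prems that]) (simp add: field_simps)
  show ?case
    by (rule Ck_SucI[OF assms(1) 3 2])
qed

text \<open>In the chain rule the outer derivative is taken in the direction g'(x) v, which moves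
  with x, whereas \<open>Ck\<close> controls fixed directions only. Expanding that direction in
  \<open>Basis\<close> leaves sums of products of functions of order k.\<close>

lemma Ck_compose:
  fixes f :: "'b::euclidean_space \<Rightarrow> 'c::real_normed_vector" and g :: "'a::real_normed_vector \<Rightarrow> 'b"
  assumes "open W" "open V" "Ck k V f" "Ck k W g" "g ` W \<subseteq> V"
  shows "Ck k W (\<lambda>x. f (g x))"
  using assms(3,4)
proof (induction k arbitrary: f)
  case 0
  then show ?case using assms(5) by (auto intro: continuous_on_compose2)
next
  case (Suc k)
  let ?f' = "\<lambda>y. frechet_derivative f (at y)" and ?g' = "\<lambda>x. frechet_derivative g (at x)"
  have gx: "g x \<in> V" if "x \<in> W" for x using that assms(5) by auto
  have lin: "?f' (g x) w = (\<Sum>b\<in>Basis. (w \<bullet> b) *\<^sub>R ?f' (g x) b)" if "x \<in> W" for x w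
  proof -
    have "linear (?f' (g x))"
      using Ck_SucD[OF Suc.prems(1) gx[OF that]] has_derivative_linear by blast
    then show ?thesis
      using linear_sum[of "?f' (g x)" "\<lambda>b. (w \<bullet> b) *\<^sub>R b" Basis] linear_scale[of "?f' (g x)"]
      by (simp only: euclidean_representation)
  qed
  have der: "((\<lambda>x. f (g x)) has_derivative (\<lambda>v. \<Sum>b\<in>Basis. (?g' x v \<bullet> b) *\<^sub>R ?f' (g x) b)) (at x)"
    if "x \<in> W" for x
    by (rule has_derivative_eq_rhs[OF has_derivative_compose[OF Ck_SucD[OF Suc.prems(2) that]
        Ck_SucD[OF Suc.prems(1) gx[OF that]]]])
      (rule ext, rule lin[OF that])
  show ?case
  proof (rule Ck_SucI[OF assms(1) der])
    fix v
    have "Ck k W (\<lambda>x. ?g' x v \<bullet> b)" for b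
      by (rule Ck_bounded_linear[OF bounded_linear_inner_left assms(1)]) (use Suc.prems in auto)
    moreover have "Ck k W (\<lambda>x. ?f' (g x) b)" for b
      by (rule Suc.IH[OF Ck_Suc_frechet[OF Suc.prems(1)] Ck_lower[OF Suc.prems(2)]])
    ultimately show "Ck k W (\<lambda>x. \<Sum>b\<in>Basis. (?g' x v \<bullet> b) *\<^sub>R ?f' (g x) b)"
      by (intro Ck_sum assms(1) Ck_scaleR)
  qed auto
qed

section \<open>A smooth bump function on the plane\<close>

definition flat :: "real poly \<Rightarrow> real \<Rightarrow> real" where
  "flat p t = (if 0 < t then poly p (1 / t) * exp (- 1 / t) else 0)"

lemma poly_exp_tendsto_0: "((\<lambda>s. poly p s * exp (- s)) \<longlongrightarrow> 0) (at_top :: real filter)"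
proof -
  have "((\<lambda>s. \<Sum>i\<le>degree p. coeff p i * (s ^ i / exp s)) \<longlongrightarrow> (\<Sum>i\<le>degree p. coeff p i * 0)) at_top"
    by (intro tendsto_intros tendsto_power_div_exp_0)
  moreover have "(\<lambda>s. \<Sum>i\<le>degree p. coeff p i * (s ^ i / exp s)) = (\<lambda>s. poly p s * exp (- s))"
    by (simp add: poly_altdef sum_distrib_right exp_minus divide_inverse mult.assoc)
  ultimately show ?thesis by simp
qed

lemma flat_tendsto_0: "(flat p \<longlongrightarrow> 0) (at 0)"
proof -
  have "((\<lambda>t. poly p (inverse t) * exp (- inverse t)) \<longlongrightarrow> 0) (at_right 0)"
    using filterlim_compose[OF poly_exp_tendsto_0[of p] filterlim_inverse_at_top_right] by (simp add: o_def)
  then have "(flat p \<longlongrightarrow> 0) (at_right 0)"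
    by (rule Lim_transform_eventually) (simp add: eventually_at_right_less flat_def inverse_eq_divide
        eventually_at_filter)
  moreover have "(flat p \<longlongrightarrow> 0) (at_left 0)"
    by (rule Lim_transform_eventually[OF tendsto_const]) (simp add: flat_def eventually_at_filter)
  ultimately show ?thesis by (simp add: filterlim_split_at)
qed

text \<open>With s = 1/t, the factor ds/dt = - s^2 turns the derivative of p(s) exp(- s) into s^2 (p
  - p')(s) exp(- s). The family is thus closed under differentiation, which is why \<open>p\<close>
  is kept general: one induction makes all members smooth.\<close>

lemma flat_has_derivative:
  "(flat p has_real_derivative flat ([:0, 0, 1:] * (p - pderiv p)) t) (at t)"
proof -
  consider "t < 0" | "t = 0" | "0 < t" by linarith
  then show ?thesis
  proof cases
    case 1
    have "((\<lambda>t. 0) has_real_derivative 0) (at t)" by simp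
    then have "(flat p has_real_derivative 0) (at t)"
      by (rule has_field_derivative_transform_within_open[where S="{..<0}"]) (use 1 in \<open>auto simp: flat_def\<close>)
    then show ?thesis using 1 by (simp add: flat_def)
  next
    case 2
    \<comment> \<open>At 0 the difference quotient only adds a factor 1/h, so it is again a member
      of the family and tends to 0. The equation holds at h = 0 as well, since division by 0 yields
      0.\<close>
    have "(\<lambda>h. (flat p (0 + h) - flat p 0) / h) = flat ([:0, 1:] * p)"
      by (auto simp: flat_def fun_eq_iff)
    then show ?thesis
      using flat_tendsto_0[of "[:0, 1:] * p"] 2 by (simp add: DERIV_def flat_def)
  next
    case 3
    have "((\<lambda>t. poly p (1 / t) * exp (- 1 / t)) has_real_derivative
       poly p (1 / t) * (exp (- 1 / t) * (1 / t\<^sup>2)) + poly (pderiv p) (1 / t) * (- 1 / t\<^sup>2) * exp (- 1 / t)) (at t)"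
      using 3 by (auto intro!: derivative_eq_intros simp: power2_eq_square)
    then have "(flat p has_real_derivative
       poly p (1 / t) * (exp (- 1 / t) * (1 / t\<^sup>2)) + poly (pderiv p) (1 / t) * (- 1 / t\<^sup>2) * exp (- 1 / t)) (at t)"
      by (rule has_field_derivative_transform_within_open[where S="{0<..}"]) (use 3 in \<open>auto simp: flat_def\<close>)
    moreover have "poly p (1 / t) * (exp (- 1 / t) * (1 / t\<^sup>2)) + poly (pderiv p) (1 / t) * (- 1 / t\<^sup>2) * exp (- 1 / t)
       = flat ([:0, 0, 1:] * (p - pderiv p)) t"
      using 3 by (simp add: flat_def field_simps power2_eq_square)
    ultimately show ?thesis by simp
  qed
qed

lemma Ck_flat: "Ck k UNIV (flat p)"
proof (induction k arbitrary: p)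
  case 0
  show ?case using flat_has_derivative DERIV_continuous_on by (metis Ck.simps(1) has_field_derivative_at_within)
next
  case (Suc k)
  show ?case
    by (rule Ck_SucI[OF open_UNIV flat_has_derivative[unfolded has_field_derivative_def]])
      (intro Ck_mult Suc Ck_const open_UNIV)
qed

text \<open>Squaring the distance makes the argument of \<open>flat\<close> polynomial in the
  coordinates, so smoothness is not lost at the centre \<open>a\<close>.\<close>

definition bump :: "real^2 \<Rightarrow> real \<Rightarrow> real^2 \<Rightarrow> real" where
  "bump a r x = flat 1 (r\<^sup>2 - (dist x a)\<^sup>2)"

lemma bump_nonneg: "0 \<le> bump a r x"
  by (simp add: bump_def flat_def)

lemma bump_pos_iff: "0 < r \<Longrightarrow> bump a r x \<noteq> 0 \<longleftrightarrow> dist x a < r"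
proof -
  assume "0 < r"
  then have "(dist x a)\<^sup>2 < r\<^sup>2 \<longleftrightarrow> dist x a < r"
    using power2_less_imp_less[of "dist x a" r] power_strict_mono[of "dist x a" r 2] by auto
  then show ?thesis by (simp add: bump_def flat_def)
qed

lemma Ck_bump: "Ck k UNIV (bump a r)"
proof -
  have "(\<lambda>x. r\<^sup>2 - (dist x a)\<^sup>2) = (\<lambda>x. r\<^sup>2 + - (\<Sum>i\<in>UNIV. (x $ i + - a $ i) * (x $ i + - a $ i)))"
    by (simp add: dist_norm power2_norm_eq_inner inner_vec_def)
  moreover have "Ck k UNIV (\<lambda>x::real^2. r\<^sup>2 + - (\<Sum>i\<in>UNIV. (x $ i + - a $ i) * (x $ i + - a $ i)))"
    by (intro Ck_add Ck_minus Ck_sum Ck_mult Ck_const open_UNIV Ck_linear bounded_linear_vec_nth)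
  ultimately have "Ck k UNIV (\<lambda>x. r\<^sup>2 - (dist x a)\<^sup>2)" by simp
  then show ?thesis
    unfolding bump_def by (intro Ck_compose[OF open_UNIV open_UNIV Ck_flat]) auto
qed

text \<open>Both mixed derivatives are limits of the same second difference Q(d) / d^2 over the
  parallelogram spanned by d v and d w. Two mean value theorems express Q(d) by one iterated
  derivative or by the other, depending on the order of the directions, and continuity at
  \<open>x\<close> identifies the limits.\<close>

lemma Clairaut:
  fixes f :: "'a::real_normed_vector \<Rightarrow> real"
  assumes "open W" "x \<in> W" "Ck 2 W f"
  shows "frechet_derivative (\<lambda>y. frechet_derivative f (at y) v) (at x) w =
         frechet_derivative (\<lambda>y. frechet_derivative f (at y) w) (at x) v"
proof -
  define D where "D = (\<lambda>v y. frechet_derivative f (at y) v)"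
  define DD where "DD = (\<lambda>v w y. frechet_derivative (D v) (at y) w)"
  have C1: "Ck (Suc 0) W (D v)" for v
    using assms(3) by (auto simp: D_def numeral_2_eq_2)
  have df: "(f has_derivative (\<lambda>v. D v y)) (at y)" if "y \<in> W" for y
    using Ck_SucD[of "Suc 0" W f y] assms(3) that by (simp add: D_def numeral_2_eq_2)
  have dD: "(D v has_derivative (\<lambda>w. DD v w y)) (at y)" if "y \<in> W" for y v
    using Ck_SucD[OF C1 that] by (simp add: DD_def)
  have cont: "continuous_on W (DD v w)" for v w
    using C1[of v] by (simp add: DD_def[abs_def])
  obtain e where e: "0 < e" "ball x e \<subseteq> W"
    using assms(1,2) open_contains_ball by blast
  \<comment> \<open>The summand 1 keeps \<open>r\<close> positive when both directions are zero; all
    points x + s v + t w with s and t in [0, r) stay in the ball.\<close>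
  define r where "r = e / (norm v + norm w + 1)"
  have r: "0 < r" unfolding r_def using e by (simp add: add_nonneg_pos)
  have near: "dist x (x + s *\<^sub>R v + t *\<^sub>R w) \<le> d * (norm v + norm w)" 
    if "0 \<le> s" "0 \<le> t" "s \<le> d" "t \<le> d" for s t d and v w :: 'a
  proof -
    have "norm (s *\<^sub>R v + t *\<^sub>R w) \<le> s * norm v + t * norm w"
      using norm_triangle_ineq[of "s *\<^sub>R v" "t *\<^sub>R w"] that by simp
    also have "\<dots> \<le> d * norm v + d * norm w"
      using that by (intro add_mono mult_right_mono) auto
    finally show ?thesis by (simp add: dist_norm algebra_simps norm_minus_commute)
  qed
  \<comment> \<open>The primed directions will stand for (v, w) and for (w, v); the estimates only
    involve the sum of the norms, which is the same for both orders.\<close>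
  have inW: "x + s *\<^sub>R v' + t *\<^sub>R w' \<in> W" if "0 \<le> s" "0 \<le> t" "s < r" "t < r" "norm v' + norm w' = norm v + norm w" for s t v' w'
  proof -
    have "max s t * (norm v + norm w) \<le> max s t * (norm v + norm w + 1)" using that by (intro mult_left_mono) auto
    also have "\<dots> < r * (norm v + norm w + 1)"
      using that by (intro mult_strict_right_mono) (auto simp: add_nonneg_pos)
    also have "\<dots> = e" unfolding r_def using add_nonneg_pos[of "norm v + norm w" 1] by (simp add: field_simps) 
    finally have "dist x (x + s *\<^sub>R v' + t *\<^sub>R w') < e"
      using near[of s t "max s t" v' w'] that by simp
    then show ?thesis using e by auto
  qed
  define Q where "Q = (\<lambda>d. f (x + d *\<^sub>R v + d *\<^sub>R w) - f (x + d *\<^sub>R v) - f (x + d *\<^sub>R w) + f x)"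
  have mvt: "\<exists>y. dist x y \<le> d * (norm v' + norm w') \<and> 
     f (x + d *\<^sub>R v' + d *\<^sub>R w') - f (x + d *\<^sub>R v') - f (x + d *\<^sub>R w') + f x = d * d * DD v' w' y"
    if d: "0 < d" "d < r" and vw: "norm v' + norm w' = norm v + norm w" for d v' w'
  proof -
    have "\<exists>s. 0 < s \<and> s < d \<and> (\<lambda>s. f (x + s *\<^sub>R v' + d *\<^sub>R w') - f (x + s *\<^sub>R v')) d - (\<lambda>s. f (x + s *\<^sub>R v' + d *\<^sub>R w') - f (x + s *\<^sub>R v')) 0
       = (d - 0) * (D v' (x + s *\<^sub>R v' + d *\<^sub>R w') - D v' (x + s *\<^sub>R v'))"
    proof (rule MVT2[OF d(1)])
      fix s assume s: "0 \<le> s" "s \<le> d"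
      have W: "x + s *\<^sub>R v' + d *\<^sub>R w' \<in> W" "x + s *\<^sub>R v' \<in> W"
        using inW[of s d v' w'] inW[of s 0 v' w'] s d vw by auto
      have lin: "linear (\<lambda>v. D v y)" if "y \<in> W" for y using df[OF that] has_derivative_linear by blast
      have sc: "D (h *\<^sub>R v') y = h * D v' y" if "y \<in> W" for h y
        using linear_scale[OF lin[OF that], of h v'] by simp
      have "((\<lambda>s. f (x + s *\<^sub>R v' + d *\<^sub>R w') - f (x + s *\<^sub>R v')) has_derivative
         (\<lambda>h. D (h *\<^sub>R v') (x + s *\<^sub>R v' + d *\<^sub>R w') - D (h *\<^sub>R v') (x + s *\<^sub>R v'))) (at s)"
        by (intro has_derivative_diff has_derivative_compose[where g=f, OF _ df] W) (auto intro!: derivative_eq_intros)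
      then show "((\<lambda>s. f (x + s *\<^sub>R v' + d *\<^sub>R w') - f (x + s *\<^sub>R v')) has_real_derivative
         D v' (x + s *\<^sub>R v' + d *\<^sub>R w') - D v' (x + s *\<^sub>R v')) (at s)"
        unfolding has_field_derivative_def
        by (rule has_derivative_eq_rhs) (simp only: fun_eq_iff sc[OF W(1)] sc[OF W(2)] ring_distribs mult.commute simp_thms)
    qed
    then obtain s where s: "0 < s" "s < d" and es:
      "f (x + d *\<^sub>R v' + d *\<^sub>R w') - f (x + d *\<^sub>R v') - (f (x + d *\<^sub>R w') - f x) = 
        d * (D v' (x + s *\<^sub>R v' + d *\<^sub>R w') - D v' (x + s *\<^sub>R v'))" by auto
    have "\<exists>t. 0 < t \<and> t < d \<and> (\<lambda>t. D v' (x + s *\<^sub>R v' + t *\<^sub>R w')) d - (\<lambda>t. D v' (x + s *\<^sub>R v' + t *\<^sub>R w')) 0 = 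
      (d - 0) * DD v' w' (x + s *\<^sub>R v' + t *\<^sub>R w')"
    proof (rule MVT2[OF d(1)])
      fix t assume t: "0 \<le> t" "t \<le> d"
      have W: "x + s *\<^sub>R v' + t *\<^sub>R w' \<in> W"
        using inW[of s t v' w'] s t d vw by auto
      have lin: "linear (\<lambda>w. DD v' w y)" if "y \<in> W" for y using dD[OF that] has_derivative_linear by blast
      have sc: "DD v' (h *\<^sub>R w') y = h * DD v' w' y" if "y \<in> W" for h y
        using linear_scale[OF lin[OF that], of h w'] by simp
      have "((\<lambda>t. D v' (x + s *\<^sub>R v' + t *\<^sub>R w')) has_derivative
         (\<lambda>h. DD v' (h *\<^sub>R w') (x + s *\<^sub>R v' + t *\<^sub>R w'))) (at t)"
        by (rule has_derivative_compose[of "\<lambda>t. x + s *\<^sub>R v' + t *\<^sub>R w'" "\<lambda>h. h *\<^sub>R w'" t UNIV "D v'", OF _ dD[OF W, of v']]) (auto intro!: derivative_eq_intros)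
      then show "((\<lambda>t. D v' (x + s *\<^sub>R v' + t *\<^sub>R w')) has_real_derivative
         DD v' w' (x + s *\<^sub>R v' + t *\<^sub>R w')) (at t)"
        unfolding has_field_derivative_def
        by (rule has_derivative_eq_rhs) (simp only: fun_eq_iff sc[OF W] mult.commute simp_thms)
    qed
    then obtain t where t: "0 < t" "t < d" and et:
      "D v' (x + s *\<^sub>R v' + d *\<^sub>R w') - D v' (x + s *\<^sub>R v') = d * DD v' w' (x + s *\<^sub>R v' + t *\<^sub>R w')" by auto
    show ?thesis
      using near[of s t d v' w'] s t es et by (intro exI[of _ "x + s *\<^sub>R v' + t *\<^sub>R w'"]) auto
  qed
  \<comment> \<open>The offset 2 ensures \<delta> n < r already at n = 0, as \<open>mvt\<close>
    demands.\<close>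
  define \<delta> where "\<delta> n = r / real (n + 2)" for n
  have \<delta>: "0 < \<delta> n" "\<delta> n < r" for n
    using r by (auto simp: \<delta>_def divide_less_eq)
  have \<delta>0: "(\<lambda>n. \<delta> n * c) \<longlonglongrightarrow> 0" for c
  proof -
    have "\<delta> \<longlonglongrightarrow> 0"
      using LIMSEQ_ignore_initial_segment[OF lim_const_over_n[of r], of 2] by (simp add: \<delta>_def[abs_def])
    then show ?thesis by (rule tendsto_mult_left_zero)
  qed
  have "\<exists>y z. dist x y \<le> \<delta> n * (norm v + norm w) \<and> dist x z \<le> \<delta> n * (norm v + norm w) \<and> DD v w y = DD w v z" for n
  proof -
    obtain y where y: "dist x y \<le> \<delta> n * (norm v + norm w)" "Q (\<delta> n) = \<delta> n * \<delta> n * DD v w y"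
      using mvt[OF \<delta>, of v w] by (auto simp: Q_def)
    obtain z where z: "dist x z \<le> \<delta> n * (norm v + norm w)" "Q (\<delta> n) = \<delta> n * \<delta> n * DD w v z"
      using mvt[OF \<delta>, of w v] by (auto simp: Q_def algebra_simps)
    show ?thesis using y z \<delta>(1)[of n] by (intro exI[of _ y] exI[of _ z]) auto
  qed
  then obtain y z where yz: "\<And>n. dist x (y n) \<le> \<delta> n * (norm v + norm w)"
    "\<And>n. dist x (z n) \<le> \<delta> n * (norm v + norm w)" "\<And>n. DD v w (y n) = DD w v (z n)" by metis
  have lim: "(\<lambda>n. DD a b (p n)) \<longlonglongrightarrow> DD a b x" if "\<And>n. dist x (p n) \<le> \<delta> n * (norm v + norm w)" for a b p
  proof (rule isCont_tendsto_compose[of _ "DD a b"])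
    show "isCont (DD a b) x"
      using cont[of a b] assms(1,2) continuous_on_eq_continuous_at by blast
    have "(\<lambda>n. dist (p n) x) \<longlonglongrightarrow> 0"
      by (rule Lim_null_comparison[OF _ \<delta>0[of "norm v + norm w"]]) (use that in \<open>auto simp: dist_commute\<close>)
    then show "p \<longlonglongrightarrow> x" using tendsto_dist_iff by blast
  qed
  have "DD v w x = DD w v x"
    using LIMSEQ_unique[OF lim[OF yz(1), of v w]] lim[OF yz(2), of w v] yz(3) by simp
  then show ?thesis by (simp add: DD_def D_def)
qed

subsection \<open>Calculus on relatively open subsets of the half plane\<close>

abbreviation hopen :: "(real^2) set \<Rightarrow> bool" where
  "hopen A \<equiv> openin (top_of_set half_plane) A"

text \<open>Uniqueness of a derivative within \<open>A\<close> needs points of \<open>A\<close>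
  arbitrarily close in every basis direction. A small positive step serves, because it never lowers
  the second coordinate.\<close>

lemma hopen_room:
  assumes "hopen A" "x \<in> A" "b \<in> Basis" "0 < e"
  shows "\<exists>d. 0 < \<bar>d\<bar> \<and> \<bar>d\<bar> < e \<and> x + d *\<^sub>R b \<in> A"
proof -
  obtain U where U: "open U" "A = half_plane \<inter> U"
    using assms(1) openin_open by metis
  obtain r where r: "0 < r" "ball x r \<subseteq> U"
    using U assms(2) open_contains_ball by blast
  define d where "d = min (e/2) (r/2)"
  have d: "0 < d" "d < e" "d < r" using r assms(4) by (auto simp: d_def)
  obtain i where i: "b = axis i 1" using assms(3) by (auto simp: Basis_vec_def)
  have "x + d *\<^sub>R b \<in> ball x r"
    using d i by (simp add: dist_norm)
  moreover have "x + d *\<^sub>R b \<in> half_plane"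
    using assms(2) U(2) d i by (auto simp: half_plane_def axis_def)
  ultimately show ?thesis using r U d by (intro exI[of _ d]) auto
qed

lemma has_derivative_within_hopen_unique:
  fixes f :: "real^2 \<Rightarrow> 'b::real_normed_vector"
  assumes "hopen A" "x \<in> A" "(f has_derivative D) (at x within A)" "(f has_derivative D') (at x within A)"
  shows "D = D'"
  by (rule frechet_derivative_unique_within[OF assms(3,4)]) (rule hopen_room[OF assms(1,2)])

lemma frechet_within_eq:
  fixes f :: "real^2 \<Rightarrow> 'b::real_normed_vector"
  assumes "hopen A" "x \<in> A" "(f has_derivative D) (at x within A)"
  shows "frechet_derivative f (at x within A) = D"
proof -
  have "f differentiable (at x within A)"
    using assms(3) differentiable_def by blast
  then show ?thesis
    using has_derivative_within_hopen_unique[OF assms(1,2) _ assms(3)] frechet_derivative_works by blast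
qed

text \<open>Near \<open>x\<close> the two sets coincide: \<open>B\<close> is the trace of an open
  set on the half plane, and \<open>A\<close> lies between \<open>B\<close> and the half
  plane.\<close>

lemma at_within_hopen_subset:
  assumes "hopen A" "hopen B" "B \<subseteq> A" "x \<in> B"
  shows "at x within A = at x within B"
proof -
  obtain U where U: "open U" "B = half_plane \<inter> U"
    using assms(2) openin_open by metis
  have "A \<subseteq> half_plane" using openin_imp_subset[OF assms(1)] .
  then show ?thesis
    by (intro at_within_nhd[of x U]) (use U assms in auto)
qed

section \<open>Closure properties of smoothness by local extension\<close>

lemma smooth_onI:
  assumes "\<And>x. x \<in> A \<Longrightarrow> \<exists>W F. open W \<and> x \<in> W \<and> (\<forall>k. Ck k W F) \<and> (\<forall>y\<in>W \<inter> A. F y = f y)"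
  shows "smooth_on A f"
  using assms unfolding smooth_on_def by blast

lemma smooth_onE:
  assumes "smooth_on A f" "x \<in> A"
  obtains W F where "open W" "x \<in> W" "\<And>k. Ck k W F" "\<And>y. y \<in> W \<Longrightarrow> y \<in> A \<Longrightarrow> F y = f y"
proof -
  obtain W F where "open W" "x \<in> W" "\<forall>k. Ck k W F" "\<forall>y\<in>W \<inter> A. F y = f y"
    using assms unfolding smooth_on_def by blast
  then show ?thesis using that[of W F] by blast
qed

lemma smooth_onE2:
  assumes "smooth_on A f" "smooth_on A g" "x \<in> A"
  obtains W F G where "open W" "x \<in> W" "\<And>k. Ck k W F" "\<And>y. y \<in> W \<Longrightarrow> y \<in> A \<Longrightarrow> F y = f y"
    "\<And>k. Ck k W G" "\<And>y. y \<in> W \<Longrightarrow> y \<in> A \<Longrightarrow> G y = g y"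
proof -
  obtain W F where 1: "open W" "x \<in> W" "\<And>k. Ck k W F" "\<And>y. y \<in> W \<Longrightarrow> y \<in> A \<Longrightarrow> F y = f y"
    using smooth_onE[OF assms(1,3)] by metis
  obtain V G where 2: "open V" "x \<in> V" "\<And>k. Ck k V G" "\<And>y. y \<in> V \<Longrightarrow> y \<in> A \<Longrightarrow> G y = g y"
    using smooth_onE[OF assms(2,3)] by metis
  show ?thesis
    by (rule that[of "W \<inter> V" F G]) (use 1 2 in \<open>auto intro: Ck_subset\<close>)
qed

lemma smooth_on_cong:
  assumes "\<And>x. x \<in> A \<Longrightarrow> f x = g x"
  shows "smooth_on A f \<longleftrightarrow> smooth_on A g"
proof -
  have "smooth_on A f'" if "smooth_on A f" "\<And>x. x \<in> A \<Longrightarrow> f x = f' x" for f f' :: "'a \<Rightarrow> 'b"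
    by (rule smooth_onI, rule smooth_onE[OF that(1)], assumption) (use that(2) in fastforce)
  then show ?thesis using assms by metis
qed

lemma smooth_on_subset: "smooth_on A f \<Longrightarrow> B \<subseteq> A \<Longrightarrow> smooth_on B f"
proof (rule smooth_onI)
  assume f: "smooth_on A f" and "B \<subseteq> A"
  fix x assume "x \<in> B"
  with \<open>B \<subseteq> A\<close> have "x \<in> A" by auto
  obtain W F where "open W" "x \<in> W" "\<And>k. Ck k W F" and e: "\<And>y. y \<in> W \<Longrightarrow> y \<in> A \<Longrightarrow> F y = f y"
    using smooth_onE[OF f \<open>x \<in> A\<close>] by metis
  moreover have "\<forall>y\<in>W \<inter> B. F y = f y"
    using e \<open>B \<subseteq> A\<close> by auto
  ultimately show "\<exists>W F. open W \<and> x \<in> W \<and> (\<forall>k. Ck k W F) \<and> (\<forall>y\<in>W \<inter> B. F y = f y)"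
    by auto
qed

lemma smooth_on_local:
  assumes "\<And>x. x \<in> A \<Longrightarrow> \<exists>U. open U \<and> x \<in> U \<and> smooth_on (A \<inter> U) f"
  shows "smooth_on A f"
proof (rule smooth_onI)
  fix x assume x: "x \<in> A"
  then obtain U where U: "open U" "x \<in> U" "smooth_on (A \<inter> U) f" using assms by blast
  obtain W F where "open W" "x \<in> W" "\<And>k. Ck k W F" "\<And>y. y \<in> W \<Longrightarrow> y \<in> A \<inter> U \<Longrightarrow> F y = f y"
    using smooth_onE[OF U(3), of x] x U by auto
  with U show "\<exists>W F. open W \<and> x \<in> W \<and> (\<forall>k. Ck k W F) \<and> (\<forall>y\<in>W \<inter> A. F y = f y)"
    by (intro exI[of _ "W \<inter> U"] exI[of _ F]) (auto intro: Ck_subset)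
qed

lemma Ck_imp_smooth_on: "(\<And>k. Ck k UNIV f) \<Longrightarrow> smooth_on A f"
  by (rule smooth_onI) (intro exI[of _ UNIV] exI[of _ f], auto)

lemma smooth_on_const: "smooth_on A (\<lambda>x. c)"
  by (intro Ck_imp_smooth_on Ck_const)

lemma smooth_on_bounded_linear:
  assumes "bounded_linear L" "smooth_on A f"
  shows "smooth_on A (\<lambda>x. L (f x))"
proof (rule smooth_onI)
  fix x assume "x \<in> A"
  then obtain W F where "open W" "x \<in> W" "\<And>k. Ck k W F" "\<And>y. y \<in> W \<Longrightarrow> y \<in> A \<Longrightarrow> F y = f y"
    using smooth_onE[OF assms(2)] by metis
  then show "\<exists>W F. open W \<and> x \<in> W \<and> (\<forall>k. Ck k W F) \<and> (\<forall>y\<in>W \<inter> A. F y = L (f y))"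
    by (intro exI[of _ W] exI[of _ "\<lambda>x. L (F x)"]) (auto intro: Ck_bounded_linear[OF assms(1)])
qed

lemma smooth_on_nth: "smooth_on A f \<Longrightarrow> smooth_on A (\<lambda>x. f x $ i)"
  by (rule smooth_on_bounded_linear[OF bounded_linear_vec_nth])

lemma smooth_on_minus: "smooth_on A f \<Longrightarrow> smooth_on A (\<lambda>x. - f x)"
  by (rule smooth_on_bounded_linear[of uminus]) (auto intro: bounded_linear_minus bounded_linear_ident)

lemma smooth_on_add:
  assumes "smooth_on A f" "smooth_on A g"
  shows "smooth_on A (\<lambda>x. f x + g x)"
proof (rule smooth_onI)
  fix x assume "x \<in> A"
  then obtain W F G where "open W" "x \<in> W" "\<And>k. Ck k W F" "\<And>y. y \<in> W \<Longrightarrow> y \<in> A \<Longrightarrow> F y = f y"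
    "\<And>k. Ck k W G" "\<And>y. y \<in> W \<Longrightarrow> y \<in> A \<Longrightarrow> G y = g y"
    using smooth_onE2[OF assms] by metis
  then show "\<exists>W F. open W \<and> x \<in> W \<and> (\<forall>k. Ck k W F) \<and> (\<forall>y\<in>W \<inter> A. F y = f y + g y)"
    by (intro exI[of _ W] exI[of _ "\<lambda>x. F x + G x"]) (auto intro: Ck_add)
qed

lemma smooth_on_mult:
  fixes f g :: "'a::real_normed_vector \<Rightarrow> real"
  assumes "smooth_on A f" "smooth_on A g"
  shows "smooth_on A (\<lambda>x. f x * g x)"
proof (rule smooth_onI)
  fix x assume "x \<in> A"
  then obtain W F G where "open W" "x \<in> W" "\<And>k. Ck k W F" "\<And>y. y \<in> W \<Longrightarrow> y \<in> A \<Longrightarrow> F y = f y"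
    "\<And>k. Ck k W G" "\<And>y. y \<in> W \<Longrightarrow> y \<in> A \<Longrightarrow> G y = g y"
    using smooth_onE2[OF assms] by metis
  then show "\<exists>W F. open W \<and> x \<in> W \<and> (\<forall>k. Ck k W F) \<and> (\<forall>y\<in>W \<inter> A. F y = f y * g y)"
    by (intro exI[of _ W] exI[of _ "\<lambda>x. F x * G x"]) (auto intro: Ck_mult)
qed

lemma smooth_on_diff:
  fixes f g :: "'a::real_normed_vector \<Rightarrow> 'b::real_normed_vector"
  assumes "smooth_on A f" "smooth_on A g"
  shows "smooth_on A (\<lambda>x. f x - g x)"
  using smooth_on_add[OF assms(1) smooth_on_minus[OF assms(2)]] by simp

lemma smooth_on_sum:
  "(\<And>i. i \<in> I \<Longrightarrow> smooth_on A (f i)) \<Longrightarrow> smooth_on A (\<lambda>x. \<Sum>i\<in>I. f i x)"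
  by (induction I rule: infinite_finite_induct) (auto intro: smooth_on_const smooth_on_add)

lemma smooth_on_inverse:
  fixes f :: "'a::real_normed_vector \<Rightarrow> real"
  assumes "smooth_on A f" "\<And>x. x \<in> A \<Longrightarrow> f x \<noteq> 0"
  shows "smooth_on A (\<lambda>x. inverse (f x))"
proof (rule smooth_onI)
  fix x assume x: "x \<in> A"
  then obtain W F where W: "open W" "x \<in> W" "\<And>k. Ck k W F" "\<And>y. y \<in> W \<Longrightarrow> y \<in> A \<Longrightarrow> F y = f y"
    using smooth_onE[OF assms(1)] by metis
  \<comment> \<open>Only \<open>f\<close> is known to be nonzero, and only on \<open>A\<close>. The
    extension \<open>F\<close> may vanish elsewhere in \<open>W\<close>, so \<open>W\<close> is
    shrunk to the open set where it does not.\<close>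
  have "open (W \<inter> F -` (- {0}))"
    using W(1) W(3)[of 0] by (intro continuous_open_preimage) auto
  moreover have "Ck k (W \<inter> F -` (- {0})) (\<lambda>x. inverse (F x))" for k
    by (rule Ck_inverse[OF calculation Ck_subset[OF W(3)]]) auto
  ultimately show "\<exists>W F. open W \<and> x \<in> W \<and> (\<forall>k. Ck k W F) \<and> (\<forall>y\<in>W \<inter> A. F y = inverse (f y))"
    using W x assms(2)[OF x]
    by (intro exI[of _ "W \<inter> F -` (- {0})"] exI[of _ "\<lambda>x. inverse (F x)"]) auto
qed

lemma smooth_on_sqrt:
  fixes f :: "'a::real_normed_vector \<Rightarrow> real"
  assumes "smooth_on A f" "\<And>x. x \<in> A \<Longrightarrow> 0 < f x"
  shows "smooth_on A (\<lambda>x. sqrt (f x))"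
proof (rule smooth_onI)
  fix x assume x: "x \<in> A"
  then obtain W F where W: "open W" "x \<in> W" "\<And>k. Ck k W F" "\<And>y. y \<in> W \<Longrightarrow> y \<in> A \<Longrightarrow> F y = f y"
    using smooth_onE[OF assms(1)] by metis
  have "open (W \<inter> F -` {0<..})"
    using W(1) W(3)[of 0] by (intro continuous_open_preimage) auto
  moreover have "Ck k (W \<inter> F -` {0<..}) (\<lambda>x. sqrt (F x))" for k
    by (rule Ck_sqrt[OF calculation Ck_subset[OF W(3)]]) auto
  ultimately show "\<exists>W F. open W \<and> x \<in> W \<and> (\<forall>k. Ck k W F) \<and> (\<forall>y\<in>W \<inter> A. F y = sqrt (f y))"
    using W x assms(2)[OF x]
    by (intro exI[of _ "W \<inter> F -` {0<..}"] exI[of _ "\<lambda>x. sqrt (F x)"]) auto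
qed

lemma smooth_on_compose:
  fixes g :: "'a::real_normed_vector \<Rightarrow> 'b::euclidean_space" and f :: "'b \<Rightarrow> 'c::real_normed_vector"
  assumes "smooth_on B f" "smooth_on A g" "g ` A \<subseteq> B"
  shows "smooth_on A (\<lambda>x. f (g x))"
proof (rule smooth_onI)
  fix x assume x: "x \<in> A"
  then obtain W G where W: "open W" "x \<in> W" "\<And>k. Ck k W G" "\<And>y. y \<in> W \<Longrightarrow> y \<in> A \<Longrightarrow> G y = g y"
    using smooth_onE[OF assms(2)] by metis
  have "g x \<in> B" using x assms(3) by auto
  then obtain V F where V: "open V" "g x \<in> V" "\<And>k. Ck k V F" "\<And>y. y \<in> V \<Longrightarrow> y \<in> B \<Longrightarrow> F y = f y"
    using smooth_onE[OF assms(1)] by metis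
  have o: "open (W \<inter> G -` V)"
    using W(1) W(3)[of 0] V by (intro continuous_open_preimage) auto
  have "Ck k (W \<inter> G -` V) (\<lambda>x. F (G x))" for k
    by (rule Ck_compose[OF o V(1,3) Ck_subset[OF W(3)]]) auto
  with o show "\<exists>W F. open W \<and> x \<in> W \<and> (\<forall>k. Ck k W F) \<and> (\<forall>y\<in>W \<inter> A. F y = f (g y))"
    using W V x assms(3)
    by (intro exI[of _ "W \<inter> G -` V"] exI[of _ "\<lambda>x. F (G x)"]) fastforce
qed

lemma smooth_on_vec:
  fixes f :: "'a::real_normed_vector \<Rightarrow> real^'n"
  assumes "\<And>i. smooth_on A (\<lambda>x. f x $ i)"
  shows "smooth_on A f"
proof -
  have "bounded_linear (\<lambda>r::real. r *\<^sub>R (axis i 1 :: real^'n))" for i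
    by (rule bounded_linear_scaleR_left)
  then have "smooth_on A (\<lambda>x. \<Sum>i\<in>UNIV. f x $ i *\<^sub>R (axis i 1 :: real^'n))"
    by (intro smooth_on_sum smooth_on_bounded_linear[OF _ assms])
  moreover have "(\<lambda>x. \<Sum>i\<in>UNIV. f x $ i *\<^sub>R (axis i 1 :: real^'n)) = f"
    by (simp add: fun_eq_iff vec_eq_iff axis_def if_distrib cong: if_cong)
  ultimately show ?thesis by simp
qed

lemma smooth_on_extension_has_derivative:
  assumes "open W" "\<And>k. Ck k W F" "\<And>y. y \<in> W \<Longrightarrow> y \<in> A \<Longrightarrow> F y = f y" "x \<in> W" "x \<in> A"
  shows "(f has_derivative frechet_derivative F (at x)) (at x within A)"
proof -
  have "(F has_derivative frechet_derivative F (at x)) (at x within A \<inter> W)"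
    using Ck_SucD[OF assms(2)[of "Suc 0"] assms(4)] has_derivative_at_withinI by blast
  then have "(f has_derivative frechet_derivative F (at x)) (at x within A \<inter> W)"
    by (rule has_derivative_transform[rotated -1]) (use assms in auto)
  moreover have "at x within A = at x within (A \<inter> W)"
    by (intro at_within_nhd[of x W]) (use assms in auto)
  ultimately show ?thesis by simp
qed

lemma smooth_on_has_derivative:
  assumes "smooth_on A f" "x \<in> A"
  shows "(f has_derivative frechet_derivative f (at x within A)) (at x within A)"
proof -
  obtain W F where "open W" "x \<in> W" "\<And>k. Ck k W F" "\<And>y. y \<in> W \<Longrightarrow> y \<in> A \<Longrightarrow> F y = f y"
    using smooth_onE[OF assms] by metis
  then have "(f has_derivative frechet_derivative F (at x)) (at x within A)"
    using smooth_on_extension_has_derivative[of W F A f x] assms(2) by blast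
  then have "f differentiable (at x within A)"
    using differentiable_def by blast
  then show ?thesis
    using frechet_derivative_works by blast
qed

lemma smooth_on_imp_continuous_on: "smooth_on A f \<Longrightarrow> continuous_on A f"
  by (rule has_derivative_continuous_on, rule smooth_on_has_derivative)

text \<open>Since derivatives within \<open>A\<close> are unique, every local extension computes
  them, also at boundary points. Hence the derivative of an extension extends the derivative, and
  smoothness is inherited by derivatives.\<close>

lemma smooth_on_extension_frechet:
  fixes f :: "real^2 \<Rightarrow> 'b::real_normed_vector"
  assumes "hopen A" "open W" "\<And>k. Ck k W F" "\<And>y. y \<in> W \<Longrightarrow> y \<in> A \<Longrightarrow> F y = f y" "x \<in> W" "x \<in> A"
  shows "frechet_derivative f (at x within A) = frechet_derivative F (at x)"
  by (rule frechet_within_eq[OF assms(1,6) smooth_on_extension_has_derivative[OF assms(2-6)]])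

lemma smooth_on_frechet:
  fixes f :: "real^2 \<Rightarrow> 'b::real_normed_vector"
  assumes "hopen A" "smooth_on A f"
  shows "smooth_on A (\<lambda>x. frechet_derivative f (at x within A) v)"
proof (rule smooth_onI)
  fix x assume "x \<in> A"
  then obtain W F where W: "open W" "x \<in> W" "\<And>k. Ck k W F" "\<And>y. y \<in> W \<Longrightarrow> y \<in> A \<Longrightarrow> F y = f y"
    using smooth_onE[OF assms(2)] by metis
  have "Ck k W (\<lambda>y. frechet_derivative F (at y) v)" for k
    using W(3)[of "Suc k"] by simp
  then show "\<exists>W F. open W \<and> x \<in> W \<and> (\<forall>k. Ck k W F) \<and> (\<forall>y\<in>W \<inter> A. F y = frechet_derivative f (at y within A) v)"
    using W smooth_on_extension_frechet[OF assms(1) W(1,3,4)]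
    by (intro exI[of _ W] exI[of _ "\<lambda>y. frechet_derivative F (at y) v"]) auto
qed

section \<open>Partial derivatives up to the boundary\<close>

definition pd :: "(real^2) set \<Rightarrow> 2 \<Rightarrow> (real^2 \<Rightarrow> real) \<Rightarrow> real^2 \<Rightarrow> real" where
  "pd A i f x = frechet_derivative f (at x within A) (axis i 1)"

lemma smooth_on_pd: "hopen A \<Longrightarrow> smooth_on A f \<Longrightarrow> smooth_on A (pd A i f)"
  unfolding pd_def[abs_def] by (rule smooth_on_frechet)

lemma pd_eqI: "hopen A \<Longrightarrow> x \<in> A \<Longrightarrow> (f has_derivative D) (at x within A) \<Longrightarrow> pd A i f x = D (axis i 1)"
  unfolding pd_def by (simp add: frechet_within_eq)

lemma pd_cong:
  assumes "\<And>y. y \<in> A \<Longrightarrow> f y = g y" "x \<in> A"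
  shows "pd A i f x = pd A i g x"
proof -
  have "(f has_derivative D) (at x within A) \<longleftrightarrow> (g has_derivative D) (at x within A)" for D
    using has_derivative_transform[of x A g f D] has_derivative_transform[of x A f g D] assms by auto
  then show ?thesis by (simp add: pd_def frechet_derivative_def)
qed

lemma pd_subset:
  assumes "hopen A" "hopen B" "B \<subseteq> A" "x \<in> B"
  shows "pd A i f x = pd B i f x"
  by (simp add: pd_def at_within_hopen_subset[OF assms])

lemma pd_const: "hopen A \<Longrightarrow> x \<in> A \<Longrightarrow> pd A i (\<lambda>x. c) x = 0"
  by (subst pd_eqI[where D="\<lambda>x. 0"]) auto

lemma pd_add:
  assumes "hopen A" "x \<in> A" "smooth_on A f" "smooth_on A g"
  shows "pd A i (\<lambda>x. f x + g x) x = pd A i f x + pd A i g x"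
  by (subst pd_eqI[OF assms(1,2) has_derivative_add[OF smooth_on_has_derivative smooth_on_has_derivative]])
    (use assms in \<open>auto simp: pd_def\<close>)

lemma pd_minus:
  assumes "hopen A" "x \<in> A" "smooth_on A f"
  shows "pd A i (\<lambda>x. - f x) x = - pd A i f x"
  by (subst pd_eqI[OF assms(1,2) has_derivative_minus[OF smooth_on_has_derivative]])
    (use assms in \<open>auto simp: pd_def\<close>)

lemma pd_diff:
  assumes "hopen A" "x \<in> A" "smooth_on A f" "smooth_on A g"
  shows "pd A i (\<lambda>x. f x - g x) x = pd A i f x - pd A i g x"
  by (subst pd_eqI[OF assms(1,2) has_derivative_diff[OF smooth_on_has_derivative smooth_on_has_derivative]])
    (use assms in \<open>auto simp: pd_def\<close>)

lemma pd_mult: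
  assumes "hopen A" "x \<in> A" "smooth_on A f" "smooth_on A g"
  shows "pd A i (\<lambda>x. f x * g x) x = pd A i f x * g x + f x * pd A i g x"
  by (subst pd_eqI[OF assms(1,2) has_derivative_mult[OF smooth_on_has_derivative smooth_on_has_derivative]])
    (use assms in \<open>auto simp: pd_def\<close>)

lemma pd_compose:
  fixes T :: "real^2 \<Rightarrow> real^2"
  assumes "hopen A" "hopen B" "x \<in> A" "smooth_on A T" "T ` A \<subseteq> B" "smooth_on B f"
  shows "pd A i (\<lambda>x. f (T x)) x = (\<Sum>k\<in>UNIV. pd B k f (T x) * pd A i (\<lambda>x. T x $ k) x)"
proof -
  let ?T' = "frechet_derivative T (at x within A)" and ?f' = "frechet_derivative f (at (T x) within B)"
  have T: "(T has_derivative ?T') (at x within A)"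
    using assms smooth_on_has_derivative by blast
  have f: "(f has_derivative ?f') (at (T x) within B)"
    using assms by (intro smooth_on_has_derivative) auto
  have "pd A i (\<lambda>x. f (T x)) x = ?f' (?T' (axis i 1))"
    using pd_eqI[OF assms(1,3) diff_chain_within[OF T has_derivative_subset[OF f assms(5)], unfolded o_def]] .
  also have "?T' (axis i 1) = (\<Sum>k\<in>UNIV. ?T' (axis i 1) $ k *\<^sub>R axis k 1)"
    by (simp add: vec_eq_iff axis_def if_distrib cong: if_cong)
  also have "?f' \<dots> = (\<Sum>k\<in>UNIV. ?T' (axis i 1) $ k * ?f' (axis k 1))"
    using f has_derivative_linear[OF f] by (simp add: linear_sum linear_scale)
  also have "\<dots> = (\<Sum>k\<in>UNIV. pd B k f (T x) * pd A i (\<lambda>x. T x $ k) x)"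
  proof (rule sum.cong[OF refl])
    fix k :: 2
    have "pd A i (\<lambda>x. T x $ k) x = ?T' (axis i 1) $ k"
      by (rule pd_eqI[OF assms(1,3) bounded_linear.has_derivative[OF bounded_linear_vec_nth T]])
    then show "?T' (axis i 1) $ k * ?f' (axis k 1) = pd B k f (T x) * pd A i (\<lambda>x. T x $ k) x"
      by (simp add: pd_def)
  qed
  finally show ?thesis .
qed

text \<open>A local smooth extension has symmetric second derivatives by \<open>Clairaut\<close>,
  and on \<open>A\<close> its iterated derivatives agree with the one-sided ones.\<close>

lemma pd_commute:
  assumes "hopen A" "x \<in> A" "smooth_on A f"
  shows "pd A i (pd A j f) x = pd A j (pd A i f) x"
proof -
  obtain W F where W: "open W" "x \<in> W" "\<And>k. Ck k W F" "\<And>y. y \<in> W \<Longrightarrow> y \<in> A \<Longrightarrow> F y = f y"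
    using smooth_onE[OF assms(3,2)] by blast
  have "pd A i (pd A j f) x = frechet_derivative (\<lambda>y. frechet_derivative F (at y) (axis j 1)) (at x) (axis i 1)" for i j
  proof -
    have c: "Ck k W (\<lambda>y. frechet_derivative F (at y) (axis j 1))" for k
      using W(3)[of "Suc k"] by simp
    have "frechet_derivative F (at y) (axis j 1) = pd A j f y" if "y \<in> W" "y \<in> A" for y
      using smooth_on_extension_frechet[OF assms(1) W(1,3,4) that] by (simp add: pd_def)
    then show ?thesis
      using smooth_on_extension_frechet[OF assms(1) W(1) c _ W(2) assms(2), of "pd A j f"] by (simp add: pd_def)
  qed
  then show ?thesis using Clairaut[OF W(1,2,3)] by simp
qed

subsection \<open>Calculus in charts\<close>

locale riemannian_surface =
  fixes M :: "'a surface"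
  assumes M: "compact_oriented_riemannian_surface M"
begin

text \<open>The open part \<open>U\<close> is carried along so that the overlap of two charts can
  serve as a common domain for both; the change of coordinates is always studied there.\<close>

definition chart_on :: "'a chart \<Rightarrow> 'a set \<Rightarrow> bool" where
  "chart_on c U \<longleftrightarrow> c \<in> atlas M \<and> openin (top_of M) U \<and> U \<subseteq> cdom c"

definition smooth_in :: "'a chart \<Rightarrow> 'a set \<Rightarrow> ('a \<Rightarrow> real) \<Rightarrow> bool" where
  "smooth_in c U f \<longleftrightarrow> smooth_on (coord c ` U) (f \<circ> chart_inv c)"

lemma
  shows compact_M: "compact_space (top_of M)"
    and Hausdorff_M: "Hausdorff_space (top_of M)"
    and atlas_cover: "(\<Union>c\<in>atlas M. cdom c) = points M"
  using M by (auto simp: compact_oriented_riemannian_surface_def compact_oriented_surface_def)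

lemma
  assumes "c \<in> atlas M"
  shows openin_cdom: "openin (top_of M) (cdom c)"
    and hopen_img: "hopen (img c)"
    and homeo_coord: "homeomorphic_map (subtopology (top_of M) (cdom c)) (top_of_set (img c)) (coord c)"
    and smooth_gmat: "smooth_on (img c) (gmat M c \<circ> chart_inv c)"
  using M assms
  unfolding compact_oriented_riemannian_surface_def compact_oriented_surface_def riemannian_metric_def
  by blast+

lemma
  assumes "c \<in> atlas M" "c' \<in> atlas M"
  shows smooth_transition: "smooth_on (coord c ` (cdom c \<inter> cdom c')) (coord c' \<circ> chart_inv c)"
    and det_jacobian_pos: "p \<in> cdom c \<inter> cdom c' \<Longrightarrow> 0 < det (jacobian c c' p)"
  using M assms
  unfolding compact_oriented_riemannian_surface_def compact_oriented_surface_def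
  by blast+

lemma gmat_change:
  assumes "c \<in> atlas M" "c' \<in> atlas M" "p \<in> cdom c \<inter> cdom c'"
  shows "gmat M c p = transpose (jacobian c c' p) ** gmat M c' p ** jacobian c c' p"
proof -
  have "\<forall>c\<in>atlas M. \<forall>c'\<in>atlas M. \<forall>p\<in>cdom c \<inter> cdom c'.
      gmat M c p = transpose (jacobian c c' p) ** gmat M c' p ** jacobian c c' p"
    using M unfolding compact_oriented_riemannian_surface_def riemannian_metric_def by (elim conjE)
  from bspec[OF bspec[OF bspec[OF this assms(1)] assms(2)] assms(3)] show ?thesis .
qed

lemma
  assumes "c \<in> atlas M" "p \<in> cdom c"
  shows gmat_sym: "transpose (gmat M c p) = gmat M c p"
    and gmat_pos: "v \<noteq> 0 \<Longrightarrow> 0 < v \<bullet> (gmat M c p *v v)"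
proof -
  have "\<forall>c\<in>atlas M. smooth_on (img c) (gmat M c \<circ> chart_inv c) \<and>
      (\<forall>p\<in>cdom c. transpose (gmat M c p) = gmat M c p \<and> (\<forall>v. v \<noteq> 0 \<longrightarrow> 0 < v \<bullet> (gmat M c p *v v)))"
    using M unfolding compact_oriented_riemannian_surface_def riemannian_metric_def by (elim conjE)
  note * = bspec[OF conjunct2[OF bspec[OF this assms(1)]] assms(2)]
  from * show "transpose (gmat M c p) = gmat M c p" by (rule conjunct1)
  from * show "v \<noteq> 0 \<Longrightarrow> 0 < v \<bullet> (gmat M c p *v v)" by blast
qed

lemma cdom_subset_points: "c \<in> atlas M \<Longrightarrow> cdom c \<subseteq> points M"
  using openin_cdom openin_subset by blast

lemma chart_on_cdom: "c \<in> atlas M \<Longrightarrow> chart_on c (cdom c)"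
  by (simp add: chart_on_def openin_cdom)

lemma chart_on_overlap: "c \<in> atlas M \<Longrightarrow> c' \<in> atlas M \<Longrightarrow> chart_on c (cdom c \<inter> cdom c')"
  by (auto simp: chart_on_def openin_cdom)

lemma chart_on_overlap': "c \<in> atlas M \<Longrightarrow> c' \<in> atlas M \<Longrightarrow> chart_on c' (cdom c \<inter> cdom c')"
  by (auto simp: chart_on_def openin_cdom)

lemma inj_coord:
  assumes "c \<in> atlas M" shows "inj_on (coord c) (cdom c)"
  using homeomorphic_imp_injective_map[OF homeo_coord[OF assms]] cdom_subset_points[OF assms]
  by (simp add: Int_absorb1)

lemma chart_inv_coord: "c \<in> atlas M \<Longrightarrow> p \<in> cdom c \<Longrightarrow> chart_inv c (coord c p) = p"
  by (simp add: chart_inv_def inj_coord)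

lemma coord_chart_inv: "x \<in> img c \<Longrightarrow> coord c (chart_inv c x) = x"
  by (simp add: chart_inv_def img_def f_inv_into_f)

lemma chart_inv_in_cdom: "x \<in> img c \<Longrightarrow> chart_inv c x \<in> cdom c"
  by (simp add: chart_inv_def img_def inv_into_into)

lemma coord_in_img: "p \<in> cdom c \<Longrightarrow> coord c p \<in> img c"
  by (simp add: img_def)

lemma hopen_coord_image:
  assumes "chart_on c U" shows "hopen (coord c ` U)"
proof -
  have c: "c \<in> atlas M" and U: "openin (top_of M) U" "U \<subseteq> cdom c"
    using assms by (auto simp: chart_on_def)
  have "openin (subtopology (top_of M) (cdom c)) U"
    unfolding openin_subtopology using U by blast
  then have "openin (top_of_set (img c)) (coord c ` U)"
    using homeomorphic_imp_open_map[OF homeo_coord[OF c]] by (simp add: open_map_def)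
  then show ?thesis using hopen_img[OF c] openin_trans by blast
qed

lemma coord_image_subset_img: "U \<subseteq> cdom c \<Longrightarrow> coord c ` U \<subseteq> img c"
  by (auto simp: img_def)

lemma chart_inv_on:
  assumes "chart_on c U" "x \<in> coord c ` U"
  shows "chart_inv c x \<in> U" "coord c (chart_inv c x) = x"
proof -
  obtain p where "p \<in> U" "x = coord c p" using assms(2) by auto
  then show "chart_inv c x \<in> U" "coord c (chart_inv c x) = x"
    using assms(1) chart_inv_coord[of c p] by (auto simp: chart_on_def)
qed

lemma chart_on_inv_coord: "chart_on c U \<Longrightarrow> p \<in> U \<Longrightarrow> chart_inv c (coord c p) = p"
  using chart_inv_coord by (auto simp: chart_on_def)

lemma partial_pd:
  assumes "chart_on c U" "p \<in> U"
  shows "partial c i f p = pd (coord c ` U) i (f \<circ> chart_inv c) (coord c p)"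
  unfolding partial_def dchart_def pd_def
  by (subst at_within_hopen_subset[of "img c" "coord c ` U"])
    (use assms hopen_img hopen_coord_image[OF assms(1)] coord_image_subset_img[of U c] in
      \<open>auto simp: chart_on_def\<close>)

lemma smooth_in_iff: "smooth_in c U f \<longleftrightarrow> smooth_on (coord c ` U) (\<lambda>x. f (chart_inv c x))"
  by (simp add: smooth_in_def o_def)

lemma smooth_in_cong:
  assumes "chart_on c U" "\<And>q. q \<in> U \<Longrightarrow> f q = g q"
  shows "smooth_in c U f \<longleftrightarrow> smooth_in c U g"
  unfolding smooth_in_iff by (rule smooth_on_cong) (use chart_inv_on[OF assms(1)] assms(2) in auto)

lemma smooth_in_subset: "smooth_in c U f \<Longrightarrow> V \<subseteq> U \<Longrightarrow> smooth_in c V f"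
  unfolding smooth_in_def by (erule smooth_on_subset) auto

lemma smooth_in_const: "smooth_in c U (\<lambda>q. k)"
  by (simp add: smooth_in_iff smooth_on_const)

lemma smooth_in_diff: "smooth_in c U f \<Longrightarrow> smooth_in c U g \<Longrightarrow> smooth_in c U (\<lambda>q. f q - g q)"
  and smooth_in_mult: "smooth_in c U f \<Longrightarrow> smooth_in c U g \<Longrightarrow> smooth_in c U (\<lambda>q. f q * g q)"
  and smooth_in_minus: "smooth_in c U f \<Longrightarrow> smooth_in c U (\<lambda>q. - f q)"
  by (simp_all add: smooth_in_iff smooth_on_diff smooth_on_mult smooth_on_minus)

lemma smooth_in_sum: "(\<And>i. i \<in> I \<Longrightarrow> smooth_in c U (f i)) \<Longrightarrow> smooth_in c U (\<lambda>q. \<Sum>i\<in>I. f i q)"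
  unfolding smooth_in_iff by (rule smooth_on_sum)

lemma smooth_in_inverse:
  assumes "chart_on c U" "smooth_in c U f" "\<And>q. q \<in> U \<Longrightarrow> f q \<noteq> 0"
  shows "smooth_in c U (\<lambda>q. inverse (f q))"
  using assms chart_inv_on[OF assms(1)] unfolding smooth_in_iff by (intro smooth_on_inverse) auto

lemma smooth_in_divide:
  assumes "chart_on c U" "smooth_in c U f" "smooth_in c U g" "\<And>q. q \<in> U \<Longrightarrow> g q \<noteq> 0"
  shows "smooth_in c U (\<lambda>q. f q / g q)"
  using smooth_in_mult[OF assms(2) smooth_in_inverse[OF assms(1,3,4)]] by (simp add: divide_inverse)

lemma smooth_in_sqrt:
  assumes "chart_on c U" "smooth_in c U f" "\<And>q. q \<in> U \<Longrightarrow> 0 < f q"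
  shows "smooth_in c U (\<lambda>q. sqrt (f q))"
  using assms chart_inv_on[OF assms(1)] unfolding smooth_in_iff by (intro smooth_on_sqrt) auto

lemma smooth_in_partial:
  assumes "chart_on c U" "smooth_in c U f" shows "smooth_in c U (partial c i f)"
proof -
  have "smooth_on (coord c ` U) (pd (coord c ` U) i (f \<circ> chart_inv c))"
    using assms hopen_coord_image smooth_on_pd unfolding smooth_in_def by blast
  then show ?thesis
    unfolding smooth_in_iff
    by (subst smooth_on_cong[where g="pd (coord c ` U) i (f \<circ> chart_inv c)"])
      (use partial_pd[OF assms(1)] chart_inv_on[OF assms(1)] in auto)
qed

lemma partial_cong:
  assumes "chart_on c U" "p \<in> U" "\<And>q. q \<in> U \<Longrightarrow> f q = g q"
  shows "partial c i f p = partial c i g p"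
  unfolding partial_pd[OF assms(1,2)]
  by (rule pd_cong) (use assms chart_inv_on[OF assms(1)] in auto)

lemma partial_const: "chart_on c U \<Longrightarrow> p \<in> U \<Longrightarrow> partial c i (\<lambda>q. k) p = 0"
  by (simp add: partial_pd o_def pd_const hopen_coord_image)

lemma partial_add:
  "chart_on c U \<Longrightarrow> p \<in> U \<Longrightarrow> smooth_in c U f \<Longrightarrow> smooth_in c U g \<Longrightarrow>
    partial c i (\<lambda>q. f q + g q) p = partial c i f p + partial c i g p"
  by (simp add: partial_pd o_def pd_add hopen_coord_image smooth_in_iff)

lemma partial_diff:
  "chart_on c U \<Longrightarrow> p \<in> U \<Longrightarrow> smooth_in c U f \<Longrightarrow> smooth_in c U g \<Longrightarrow>
    partial c i (\<lambda>q. f q - g q) p = partial c i f p - partial c i g p"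
  by (simp add: partial_pd o_def pd_diff hopen_coord_image smooth_in_iff)

lemma partial_minus:
  "chart_on c U \<Longrightarrow> p \<in> U \<Longrightarrow> smooth_in c U f \<Longrightarrow> partial c i (\<lambda>q. - f q) p = - partial c i f p"
  by (simp add: partial_pd o_def pd_minus hopen_coord_image smooth_in_iff)

lemma partial_mult:
  "chart_on c U \<Longrightarrow> p \<in> U \<Longrightarrow> smooth_in c U f \<Longrightarrow> smooth_in c U g \<Longrightarrow>
    partial c i (\<lambda>q. f q * g q) p = partial c i f p * g p + f p * partial c i g p"
  by (simp add: partial_pd o_def pd_mult hopen_coord_image smooth_in_iff chart_on_inv_coord)

lemma partial_sum:
  assumes "chart_on c U" "p \<in> U" "finite I" "\<And>j. j \<in> I \<Longrightarrow> smooth_in c U (f j)"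
  shows "partial c i (\<lambda>q. \<Sum>j\<in>I. f j q) p = (\<Sum>j\<in>I. partial c i (f j) p)"
  using assms(3,4)
  by (induction I rule: finite_induct)
    (simp_all add: partial_const[OF assms(1,2)] partial_add[OF assms(1,2)] smooth_in_sum)

lemma partial_commute:
  assumes "chart_on c U" "p \<in> U" "smooth_in c U f"
  shows "partial c i (partial c j f) p = partial c j (partial c i f) p"
proof -
  have "partial c i (partial c j f) p = pd (coord c ` U) i (pd (coord c ` U) j (f \<circ> chart_inv c)) (coord c p)" for i j
    unfolding partial_pd[OF assms(1,2), of i]
    by (rule pd_cong) (use assms(2) chart_inv_on[OF assms(1)] partial_pd[OF assms(1)] in auto)
  then show ?thesis
    using pd_commute[OF hopen_coord_image[OF assms(1)], of "coord c p" "f \<circ> chart_inv c"] assms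
    by (auto simp: smooth_in_def)
qed

lemma smooth_fun_iff: "smooth_fun M f \<longleftrightarrow> (\<forall>c\<in>atlas M. smooth_in c (cdom c) f)"
  by (simp add: smooth_fun_def smooth_in_def img_def)

lemma smooth_fun_sm: "smooth_fun M f \<Longrightarrow> chart_on c U \<Longrightarrow> smooth_in c U f"
  unfolding smooth_fun_iff chart_on_def using smooth_in_subset by blast

lemma smooth_in_vec:
  fixes V :: "'a \<Rightarrow> real^'n"
  assumes "chart_on c U" "smooth_on (img c) (V \<circ> chart_inv c)"
  shows "smooth_in c U (\<lambda>q. V q $ k)"
proof -
  have "coord c ` U \<subseteq> img c"
    using assms(1) coord_image_subset_img by (auto simp: chart_on_def)
  from smooth_on_subset[OF smooth_on_nth[OF assms(2)] this] show ?thesis by (simp add: smooth_in_iff)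
qed

lemma smooth_on_img_vec:
  fixes V :: "'a \<Rightarrow> real^'n"
  assumes "\<And>k. smooth_in c (cdom c) (\<lambda>q. V q $ k)"
  shows "smooth_on (img c) (V \<circ> chart_inv c)"
  by (rule smooth_on_vec) (use assms in \<open>simp add: smooth_in_iff img_def\<close>)

lemma smooth_in_gmat:
  assumes "chart_on c U" shows "smooth_in c U (\<lambda>q. gmat M c q $ i $ j)"
proof -
  have "c \<in> atlas M" "coord c ` U \<subseteq> img c"
    using assms coord_image_subset_img by (auto simp: chart_on_def)
  from smooth_on_subset[OF smooth_on_nth[OF smooth_on_nth[OF smooth_gmat[OF this(1)]]] this(2)]
  show ?thesis by (simp add: smooth_in_iff)
qed

lemma smooth_in_transition:
  assumes "chart_on c U" "chart_on c' U"
  shows "smooth_in c U (\<lambda>q. coord c' q $ k)"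
proof -
  have "smooth_on (coord c ` U) (coord c' \<circ> chart_inv c)"
    by (rule smooth_on_subset[OF smooth_transition[of c c']]) (use assms in \<open>auto simp: chart_on_def\<close>)
  then show ?thesis unfolding smooth_in_iff using smooth_on_nth by fastforce
qed

lemma transition_maps:
  assumes "chart_on c U" "chart_on c' U"
  shows "(coord c' \<circ> chart_inv c) ` coord c ` U \<subseteq> coord c' ` U"
    and "x \<in> coord c ` U \<Longrightarrow> chart_inv c' ((coord c' \<circ> chart_inv c) x) = chart_inv c x"
  using chart_inv_on[OF assms(1)] chart_on_inv_coord[OF assms(2)] by auto

lemma smooth_in_change:
  assumes "chart_on c U" "chart_on c' U" "smooth_in c' U f"
  shows "smooth_in c U f"
proof -
  have "smooth_on (coord c ` U) (coord c' \<circ> chart_inv c)"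
    by (rule smooth_on_vec) (use smooth_in_transition[OF assms(1,2)] in \<open>simp add: smooth_in_iff\<close>)
  from smooth_on_compose[OF assms(3)[unfolded smooth_in_def] this transition_maps(1)[OF assms(1,2)]]
  show ?thesis unfolding smooth_in_def
    by (rule iffD1[OF smooth_on_cong, rotated]) (use transition_maps(2)[OF assms(1,2)] in auto)
qed

lemma partial_change:
  assumes "chart_on c U" "chart_on c' U" "smooth_in c' U f" "p \<in> U"
  shows "partial c i f p = (\<Sum>k\<in>UNIV. partial c' k f p * partial c i (\<lambda>q. coord c' q $ k) p)"
proof -
  let ?T = "coord c' \<circ> chart_inv c"
  have T: "smooth_on (coord c ` U) ?T"
    by (rule smooth_on_vec) (use smooth_in_transition[OF assms(1,2)] in \<open>simp add: smooth_in_iff\<close>)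
  have "partial c i f p = pd (coord c ` U) i (\<lambda>x. (f \<circ> chart_inv c') (?T x)) (coord c p)"
    unfolding partial_pd[OF assms(1,4)]
    by (rule pd_cong) (use transition_maps(2)[OF assms(1,2)] assms(4) in auto)
  also have "\<dots> = (\<Sum>k\<in>UNIV. pd (coord c' ` U) k (f \<circ> chart_inv c') (?T (coord c p)) *
      pd (coord c ` U) i (\<lambda>x. ?T x $ k) (coord c p))"
    by (rule pd_compose[OF hopen_coord_image[OF assms(1)] hopen_coord_image[OF assms(2)] _ T
        transition_maps(1)[OF assms(1,2)] assms(3)[unfolded smooth_in_def]]) (use assms(4) in auto)
  also have "\<dots> = (\<Sum>k\<in>UNIV. partial c' k f p * partial c i (\<lambda>q. coord c' q $ k) p)"
    unfolding partial_pd[OF assms(1,4)] partial_pd[OF assms(2,4)]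
    by (simp add: chart_on_inv_coord[OF assms(1,4)] o_def)
  finally show ?thesis .
qed

lemma jacobian_partial:
  assumes "chart_on c U" "chart_on c' U" "p \<in> U"
  shows "jacobian c c' p $ k $ i = partial c i (\<lambda>q. coord c' q $ k) p"
proof -
  let ?T = "coord c' \<circ> chart_inv c" and ?A = "coord c ` U"
  have T: "smooth_on ?A ?T"
    by (rule smooth_on_vec) (use smooth_in_transition[OF assms(1,2)] in \<open>simp add: smooth_in_iff\<close>)
  have p: "coord c p \<in> ?A" using assms(3) by auto
  have at: "at (coord c p) within img c = at (coord c p) within ?A"
    by (rule at_within_hopen_subset[OF hopen_img hopen_coord_image[OF assms(1)] coord_image_subset_img p])
      (use assms(1) in \<open>auto simp: chart_on_def\<close>)
  have "partial c i (\<lambda>q. coord c' q $ k) p = pd ?A i (\<lambda>x. ?T x $ k) (coord c p)"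
    unfolding partial_pd[OF assms(1,3)] by (simp add: o_def)
  also have "\<dots> = frechet_derivative ?T (at (coord c p) within ?A) (axis i 1) $ k"
    by (rule pd_eqI[OF hopen_coord_image[OF assms(1)] p
        bounded_linear.has_derivative[OF bounded_linear_vec_nth smooth_on_has_derivative[OF T p]]])
  finally show ?thesis
    by (simp add: jacobian_def matrix_def dchart_def at)
qed

lemma det_gmat_pos:
  assumes "c \<in> atlas M" "p \<in> cdom c"
  shows "0 < det (gmat M c p)" "0 < gmat M c p $ 1 $ 1"
proof -
  let ?G = "gmat M c p"
  have s: "?G $ 2 $ 1 = ?G $ 1 $ 2"
    using arg_cong[OF gmat_sym[OF assms], of "\<lambda>A. A $ 1 $ 2"] by (simp add: transpose_def)
  have Q: "w \<bullet> (?G *v w) = ?G $ 1 $ 1 * (w $ 1)\<^sup>2 + 2 * (?G $ 1 $ 2 * w $ 1 * w $ 2) + ?G $ 2 $ 2 * (w $ 2)\<^sup>2" for w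
    by (simp add: matrix_vector_mult_def inner_vec_def sum_2 s power2_eq_square algebra_simps)
  have "vector [1, 0] \<noteq> (0 :: real^2)"
    by (metis vector_2(1) zero_index zero_neq_one)
  from gmat_pos[OF assms this] show a: "0 < ?G $ 1 $ 1"
    by (simp add: Q)
  \<comment> \<open>This vector is orthogonal to the first basis vector for the metric; the
    quadratic form takes the value g11 times the determinant on it.\<close>
  have "vector [- ?G $ 1 $ 2, ?G $ 1 $ 1] \<noteq> (0 :: real^2)"
    using a by (metis vector_2(2) zero_index less_irrefl)
  from gmat_pos[OF assms this] have "0 < ?G $ 1 $ 1 * det ?G"
    by (simp add: Q det_2 s power2_eq_square algebra_simps)
  with a show "0 < det ?G" by (simp add: zero_less_mult_iff)
qed

lemma vol_density_pos: "c \<in> atlas M \<Longrightarrow> p \<in> cdom c \<Longrightarrow> 0 < vol_density M c p"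
  by (simp add: vol_density_def det_gmat_pos)

lemma smooth_in_vol_density:
  assumes "chart_on c U" shows "smooth_in c U (vol_density M c)"
  unfolding vol_density_def[abs_def]
proof (rule smooth_in_sqrt[OF assms])
  show "smooth_in c U (\<lambda>q. det (gmat M c q))"
    unfolding det_2 by (intro smooth_in_diff smooth_in_mult smooth_in_gmat assms)
qed (use assms det_gmat_pos in \<open>auto simp: chart_on_def\<close>)

text \<open>The Gram determinants differ by the square of det J. As the atlas is oriented, det J is
  positive, so the square root produces no absolute value.\<close>

lemma vol_density_change:
  assumes "c \<in> atlas M" "c' \<in> atlas M" "p \<in> cdom c \<inter> cdom c'"
  shows "vol_density M c p = det (jacobian c c' p) * vol_density M c' p"
proof -
  have "det (gmat M c p) = (det (jacobian c c' p))\<^sup>2 * det (gmat M c' p)"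
    by (subst gmat_change[OF assms]) (simp add: det_mul power2_eq_square)
  then show ?thesis
    using det_jacobian_pos[OF assms] by (simp add: vol_density_def real_sqrt_mult)
qed

end

subsection \<open>Gradients, divergence and Hamiltonian fields\<close>

lemma matrix_inv_left:
  fixes A :: "'a::semiring_1^'n^'n"
  assumes "invertible A"
  shows "matrix_inv A ** A = mat 1"
  using someI_ex[OF assms[unfolded invertible_def]] by (simp add: matrix_inv_def)

lemma invertible_mult_vector_cancel:
  fixes A :: "real^'n^'n"
  assumes "invertible A" "A *v x = A *v y"
  shows "x = y"
  by (metis assms matrix_inv_left matrix_vector_mul_assoc matrix_vector_mul_lid)

lemma matrix_inv_mult_vector_2:
  fixes G :: "real^2^2"
  assumes "det G \<noteq> 0"
  shows "matrix_inv G *v d = vector [(G $ 2 $ 2 * d $ 1 - G $ 1 $ 2 * d $ 2) / det G,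
      (G $ 1 $ 1 * d $ 2 - G $ 2 $ 1 * d $ 1) / det G]" (is "_ = ?w")
    and "G *v (matrix_inv G *v d) = d"
proof -
  have "G *v ?w = d"
    using assms by (simp add: vec_eq_iff forall_2 matrix_vector_mult_def sum_2 field_simps) (simp add: det_2 algebra_simps)
  moreover have "matrix_inv G ** G = mat 1"
    using assms by (simp add: invertible_det_nz matrix_inv_left)
  ultimately show *: "matrix_inv G *v d = ?w"
    by (metis matrix_vector_mul_assoc matrix_vector_mul_lid)
  then show "G *v (matrix_inv G *v d) = d" using \<open>G *v ?w = d\<close> by simp
qed

context riemannian_surface begin

lemma chart_at:
  assumes "p \<in> points M" shows "chart_at M p \<in> atlas M" "p \<in> cdom (chart_at M p)"
proof -
  have "\<exists>c. c \<in> atlas M \<and> p \<in> cdom c"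
    using assms atlas_cover by blast
  from someI_ex[OF this] show "chart_at M p \<in> atlas M" "p \<in> cdom (chart_at M p)"
    by (auto simp: chart_at_def)
qed

lemma gmat_21: "c \<in> atlas M \<Longrightarrow> p \<in> cdom c \<Longrightarrow> gmat M c p $ 2 $ 1 = gmat M c p $ 1 $ 2"
  using arg_cong[OF gmat_sym, of c p "\<lambda>A. A $ 1 $ 2"] by (simp add: transpose_def)

lemma vol_density_sq: "c \<in> atlas M \<Longrightarrow> p \<in> cdom c \<Longrightarrow> vol_density M c p * vol_density M c p = det (gmat M c p)"
  using det_gmat_pos[of c p] by (simp add: vol_density_def)

lemma vf_sm: "vector_field M V \<Longrightarrow> chart_on c U \<Longrightarrow> smooth_in c U (\<lambda>q. V c q $ k)"
  by (rule smooth_in_vec) (auto simp: vector_field_def chart_on_def)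

lemma vf_change:
  assumes "vector_field M V" "chart_on c U" "chart_on c' U" "p \<in> U"
  shows "V c' p $ k = (\<Sum>i\<in>UNIV. partial c i (\<lambda>q. coord c' q $ k) p * V c p $ i)"
proof -
  have "c \<in> atlas M" "c' \<in> atlas M" "p \<in> cdom c \<inter> cdom c'"
    using assms by (auto simp: chart_on_def)
  then have "V c' p = jacobian c c' p *v V c p"
    using assms(1) unfolding vector_field_def by blast
  then show ?thesis
    by (simp add: matrix_vector_mult_def jacobian_partial[OF assms(2-4)])
qed

lemma vector_fieldI:
  assumes "\<And>c k. c \<in> atlas M \<Longrightarrow> smooth_in c (cdom c) (\<lambda>q. V c q $ k)"
    and "\<And>c c' U p k. chart_on c U \<Longrightarrow> chart_on c' U \<Longrightarrow> p \<in> U \<Longrightarrow>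
      V c' p $ k = (\<Sum>i\<in>UNIV. partial c i (\<lambda>q. coord c' q $ k) p * V c p $ i)"
  shows "vector_field M V"
  unfolding vector_field_def
proof (intro conjI ballI)
  fix c assume "c \<in> atlas M"
  then show "smooth_on (img c) (V c \<circ> chart_inv c)"
    using assms(1) by (intro smooth_on_img_vec)
next
  fix c c' p assume c: "c \<in> atlas M" "c' \<in> atlas M" and p: "p \<in> cdom c \<inter> cdom c'"
  note o = chart_on_overlap[OF c] chart_on_overlap'[OF c]
  show "V c' p = jacobian c c' p *v V c p"
    by (simp add: vec_eq_iff matrix_vector_mult_def jacobian_partial[OF o p] assms(2)[OF o p])
qed

lemma vf_scale:
  assumes "smooth_fun M a" "vector_field M V"
  shows "vector_field M (\<lambda>c p. a p *\<^sub>R V c p)"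
proof (rule vector_fieldI)
  fix c k assume c: "c \<in> atlas M"
  show "smooth_in c (cdom c) (\<lambda>q. (a q *\<^sub>R V c q) $ k)"
    using smooth_in_mult[OF smooth_fun_sm[OF assms(1)] vf_sm[OF assms(2)]] chart_on_cdom[OF c] by simp
next
  fix c c' U p k assume *: "chart_on c U" "chart_on c' U" "p \<in> U"
  show "(a p *\<^sub>R V c' p) $ k = (\<Sum>i\<in>UNIV. partial c i (\<lambda>q. coord c' q $ k) p * (a p *\<^sub>R V c p) $ i)"
    by (simp add: vf_change[OF assms(2) *] sum_distrib_left mult_ac)
qed

section \<open>Directional derivatives and divergence, independently of the chart\<close>

definition der :: "'a vfield \<Rightarrow> ('a \<Rightarrow> real) \<Rightarrow> 'a \<Rightarrow> real" where
  "der V a p = (let c = chart_at M p in \<Sum>i\<in>UNIV. V c p $ i * partial c i a p)"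

text \<open>The formula in \<open>divergence\<close> with the chart as a parameter, so that its
  coordinate independence can be stated.\<close>

definition chart_div :: "'a chart \<Rightarrow> 'a vfield \<Rightarrow> 'a \<Rightarrow> real" where
  "chart_div c V p = (\<Sum>i\<in>UNIV. partial c i (\<lambda>q. vol_density M c q * V c q $ i) p) / vol_density M c p"

lemma der_change:
  assumes "vector_field M V" "chart_on c U" "chart_on c' U" "p \<in> U" "smooth_in c' U a"
  shows "(\<Sum>i\<in>UNIV. V c p $ i * partial c i a p) = (\<Sum>i\<in>UNIV. V c' p $ i * partial c' i a p)"
  by (simp add: vf_change[OF assms(1-4)] partial_change[OF assms(2,3,5,4)] sum_2 algebra_simps)

lemma der_eq:
  assumes "vector_field M V" "smooth_fun M a" "c \<in> atlas M" "p \<in> cdom c"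
  shows "der V a p = (\<Sum>i\<in>UNIV. V c p $ i * partial c i a p)"
proof -
  have "p \<in> points M" using assms cdom_subset_points by blast
  note c' = chart_at[OF this]
  show ?thesis
    unfolding der_def Let_def
    by (rule der_change[OF assms(1) chart_on_overlap[OF c'(1) assms(3)] chart_on_overlap'[OF c'(1) assms(3)]])
      (use c' assms in \<open>auto intro: smooth_fun_sm[OF assms(2)] chart_on_overlap'\<close>)
qed

lemma smooth_der:
  assumes "vector_field M V" "smooth_fun M a"
  shows "smooth_fun M (der V a)"
  unfolding smooth_fun_iff
proof
  fix c assume c: "c \<in> atlas M"
  note o = chart_on_cdom[OF c]
  have "smooth_in c (cdom c) (\<lambda>p. \<Sum>i\<in>UNIV. V c p $ i * partial c i a p)"
    by (intro smooth_in_sum smooth_in_mult smooth_in_partial vf_sm smooth_fun_sm assms o)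
  then show "smooth_in c (cdom c) (der V a)"
    using smooth_in_cong[OF o der_eq[OF assms c]] by simp
qed

text \<open>The derivatives of the cofactors of the Jacobian cancel, because mixed partial derivatives of the
  transition map commute.\<close>

lemma chart_div_change:
  assumes V: "vector_field M V" and c: "chart_on c U" and c': "chart_on c' U" and p: "p \<in> U"
  shows "chart_div c V p = chart_div c' V p"
proof -
  define J where "J k i = partial c i (\<lambda>q. coord c' q $ k)" for k i
  define W where "W k q = vol_density M c' q * V c' q $ k" for k q
  have smW': "smooth_in c' U (W k)" for k
    unfolding W_def[abs_def] by (intro smooth_in_mult smooth_in_vol_density vf_sm V c')
  have smW: "smooth_in c U (W k)" for k by (rule smooth_in_change[OF c c' smW'])
  have smJ: "smooth_in c U (J k i)" for k i unfolding J_def by (intro smooth_in_partial smooth_in_transition c c')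
  have dJ: "partial c i (J k j) p = partial c j (J k i) p" for i j k
    unfolding J_def by (rule partial_commute[OF c p smooth_in_transition[OF c c']])
  have det: "vol_density M c q = (J 1 1 q * J 2 2 q - J 1 2 q * J 2 1 q) * vol_density M c' q"
    "0 < J 1 1 q * J 2 2 q - J 1 2 q * J 2 1 q" if "q \<in> U" for q
  proof -
    have "c \<in> atlas M" "c' \<in> atlas M" "q \<in> cdom c \<inter> cdom c'"
      using c c' that by (auto simp: chart_on_def)
    from vol_density_change[OF this] det_jacobian_pos[OF this]
    show "vol_density M c q = (J 1 1 q * J 2 2 q - J 1 2 q * J 2 1 q) * vol_density M c' q"
      "0 < J 1 1 q * J 2 2 q - J 1 2 q * J 2 1 q"
      by (simp_all add: det_2 J_def jacobian_partial[OF c c' that])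
  qed
  have V': "V c' q $ k = J k 1 q * V c q $ 1 + J k 2 q * V c q $ 2" if "q \<in> U" for k q
    by (simp add: vf_change[OF V c c' that] sum_2 J_def)
  \<comment> \<open>Inverting J by cofactors: the factor det J in the density cancels the
    denominator, so the densitised components in \<open>c\<close> are the adjugate of J applied to
    those in \<open>c'\<close>.\<close>
  have e1: "vol_density M c q * V c q $ 1 = J 2 2 q * W 1 q - J 1 2 q * W 2 q" if "q \<in> U" for q
    by (simp add: W_def V'[OF that] det(1)[OF that] algebra_simps)
  have e2: "vol_density M c q * V c q $ 2 = J 1 1 q * W 2 q - J 2 1 q * W 1 q" if "q \<in> U" for q
    by (simp add: W_def V'[OF that] det(1)[OF that] algebra_simps)
  have d1: "partial c 1 (\<lambda>q. vol_density M c q * V c q $ 1) p =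
      partial c 1 (J 2 2) p * W 1 p + J 2 2 p * partial c 1 (W 1) p
      - (partial c 1 (J 1 2) p * W 2 p + J 1 2 p * partial c 1 (W 2) p)"
    by (subst partial_cong[OF c p e1], assumption)
      (simp add: partial_diff[OF c p] partial_mult[OF c p] smJ smW smooth_in_mult)
  have d2: "partial c 2 (\<lambda>q. vol_density M c q * V c q $ 2) p =
      partial c 2 (J 1 1) p * W 2 p + J 1 1 p * partial c 2 (W 2) p
      - (partial c 2 (J 2 1) p * W 1 p + J 2 1 p * partial c 2 (W 1) p)"
    by (subst partial_cong[OF c p e2], assumption)
      (simp add: partial_diff[OF c p] partial_mult[OF c p] smJ smW smooth_in_mult)
  have dW: "partial c i (W k) p = partial c' 1 (W k) p * J 1 i p + partial c' 2 (W k) p * J 2 i p" for i k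
    by (simp add: partial_change[OF c c' smW' p] sum_2 J_def)
  have "(\<Sum>i\<in>UNIV. partial c i (\<lambda>q. vol_density M c q * V c q $ i) p) =
      (J 1 1 p * J 2 2 p - J 1 2 p * J 2 1 p) * (partial c' 1 (W 1) p + partial c' 2 (W 2) p)"
    unfolding sum_2 d1 d2 dJ[of 2 1 1] dJ[of 2 2 1] dW by (simp add: algebra_simps)
  then show ?thesis
    unfolding chart_div_def using det[OF p] by (simp add: sum_2 W_def[abs_def])
qed

lemma divergence_eq:
  assumes "vector_field M V" "c \<in> atlas M" "p \<in> cdom c"
  shows "divergence M V p = chart_div c V p"
proof -
  have "p \<in> points M" using assms cdom_subset_points by blast
  note c' = chart_at[OF this]
  have "divergence M V p = chart_div (chart_at M p) V p"
    by (simp add: divergence_def chart_div_def Let_def)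
  also have "\<dots> = chart_div c V p"
    by (rule chart_div_change[OF assms(1) chart_on_overlap[OF c'(1) assms(2)] chart_on_overlap'[OF c'(1) assms(2)]])
      (use c' assms in auto)
  finally show ?thesis .
qed

lemma smooth_divergence:
  assumes "vector_field M V" shows "smooth_fun M (divergence M V)"
  unfolding smooth_fun_iff
proof
  fix c assume c: "c \<in> atlas M"
  note o = chart_on_cdom[OF c]
  have "smooth_in c (cdom c) (chart_div c V)"
    unfolding chart_div_def[abs_def]
    by (rule smooth_in_divide[OF o]; (intro smooth_in_sum smooth_in_mult smooth_in_partial vf_sm smooth_in_vol_density assms o)?)
      (use vol_density_pos[OF c] in force)
  then show "smooth_in c (cdom c) (divergence M V)"
    using smooth_in_cong[OF o divergence_eq[OF assms c]] by simp
qed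

lemma divergence_scale:
  assumes "smooth_fun M a" "vector_field M V" "p \<in> points M"
  shows "divergence M (\<lambda>c p. a p *\<^sub>R V c p) p = a p * divergence M V p + der V a p"
proof -
  note c = chart_at[OF assms(3)]
  let ?c = "chart_at M p" let ?D = "vol_density M ?c"
  note o = chart_on_cdom[OF c(1)]
  have sa: "smooth_in ?c (cdom ?c) a" by (rule smooth_fun_sm[OF assms(1) o])
  have sV: "smooth_in ?c (cdom ?c) (\<lambda>q. ?D q * V ?c q $ i)" for i
    by (intro smooth_in_mult vf_sm smooth_in_vol_density o assms)
  have "partial ?c i (\<lambda>q. ?D q * (a q *\<^sub>R V ?c q) $ i) p =
      partial ?c i a p * (?D p * V ?c p $ i) + a p * partial ?c i (\<lambda>q. ?D q * V ?c q $ i) p" for i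
    using partial_mult[OF o c(2) sa sV[of i], of i] by (simp add: mult_ac)
  then show ?thesis
    using vol_density_pos[OF c]
    by (simp add: divergence_def der_def Let_def sum_2 field_simps)
qed

lemma divergence_sum:
  assumes "finite I" "\<And>j. j \<in> I \<Longrightarrow> vector_field M (V j)" "p \<in> points M"
  shows "divergence M (\<lambda>c p. \<Sum>j\<in>I. V j c p) p = (\<Sum>j\<in>I. divergence M (V j) p)"
proof -
  note c = chart_at[OF assms(3)]
  let ?c = "chart_at M p" let ?D = "vol_density M ?c"
  note o = chart_on_cdom[OF c(1)]
  have sV: "smooth_in ?c (cdom ?c) (\<lambda>q. ?D q * V j ?c q $ i)" if "j \<in> I" for i j
    by (intro smooth_in_mult vf_sm smooth_in_vol_density o assms that)
  have "partial ?c i (\<lambda>q. ?D q * (\<Sum>j\<in>I. V j ?c q) $ i) p =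
      (\<Sum>j\<in>I. partial ?c i (\<lambda>q. ?D q * V j ?c q $ i) p)" for i
    unfolding sum_component sum_distrib_left by (rule partial_sum[OF o c(2) assms(1) sV])
  then show ?thesis
    by (simp add: divergence_def Let_def sum_2 sum.distrib sum_divide_distrib add_divide_distrib)
qed

section \<open>Gradients, Hamiltonian fields and the Poisson bracket\<close>

lemma grad_component:
  assumes "c \<in> atlas M" "p \<in> cdom c"
  shows "grad M f c p $ 1 = (gmat M c p $ 2 $ 2 * partial c 1 f p - gmat M c p $ 1 $ 2 * partial c 2 f p) / det (gmat M c p)"
    and "grad M f c p $ 2 = (gmat M c p $ 1 $ 1 * partial c 2 f p - gmat M c p $ 1 $ 2 * partial c 1 f p) / det (gmat M c p)"
  using det_gmat_pos[OF assms] by (simp_all add: grad_def matrix_inv_mult_vector_2 gmat_21[OF assms])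

lemma gmat_grad:
  assumes "c \<in> atlas M" "p \<in> cdom c"
  shows "gmat M c p *v grad M f c p = (\<chi> i. partial c i f p)"
  using matrix_inv_mult_vector_2(2)[of "gmat M c p" "\<chi> i. partial c i f p"] det_gmat_pos[OF assms]
  by (simp add: grad_def)

abbreviation ham :: "('a \<Rightarrow> real) \<Rightarrow> 'a vfield" where
  "ham f \<equiv> hodge_star M (grad M f)"

text \<open>Raising the index of df and then rotating by \<open>rot90\<close>, which lowers it
  again, cancels the metric except for its area density. So \<open>ham f\<close> is the Hamiltonian
  field of \<open>f\<close> for the area form.\<close>

lemma ham_component:
  assumes "c \<in> atlas M" "p \<in> cdom c"
  shows "ham f c p $ 1 = - partial c 2 f p / vol_density M c p"
    and "ham f c p $ 2 = partial c 1 f p / vol_density M c p"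
  by (simp_all add: hodge_star_def rot90_def gmat_grad[OF assms] vol_density_def)

text \<open>The gradient is determined by G grad f = df. The differential changes by the transpose
  of J and the metric by J on both sides; cancelling the invertible matrices leaves the law for
  vectors.\<close>

lemma vf_grad:
  assumes f: "smooth_fun M f" shows "vector_field M (grad M f)"
proof (rule vector_fieldI)
  fix c and k :: 2 assume c: "c \<in> atlas M"
  note o = chart_on_cdom[OF c]
  have "smooth_in c (cdom c) (\<lambda>q. det (gmat M c q))"
    unfolding det_2 by (intro smooth_in_diff smooth_in_mult smooth_in_gmat o)
  then have "smooth_in c (cdom c) (\<lambda>q. (gmat M c q $ i $ j * partial c k f q - gmat M c q $ i' $ j' * partial c k' f q) / det (gmat M c q))"
    for i j k i' j' k'
    by (intro smooth_in_divide smooth_in_diff smooth_in_mult smooth_in_partial smooth_in_gmat smooth_fun_sm[OF f] o)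
      (use det_gmat_pos[OF c] in force)+
  then show "smooth_in c (cdom c) (\<lambda>q. grad M f c q $ k)"
    using exhaust_2[of k] smooth_in_cong[OF o grad_component(1)[OF c]] smooth_in_cong[OF o grad_component(2)[OF c]] by auto
next
  fix c c' U p and k :: 2 assume c: "chart_on c U" and c': "chart_on c' U" and p: "p \<in> U"
  have cc: "c \<in> atlas M" "c' \<in> atlas M" "p \<in> cdom c \<inter> cdom c'"
    using c c' p by (auto simp: chart_on_def)
  let ?J = "jacobian c c' p" and ?G = "gmat M c' p"
  have "transpose ?J *v (?G *v (?J *v grad M f c p)) = (\<chi> i. partial c i f p)"
    using gmat_grad[of c p f] cc by (simp add: gmat_change[OF cc] matrix_vector_mul_assoc matrix_mul_assoc)
  also have "\<dots> = transpose ?J *v (\<chi> i. partial c' i f p)"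
    by (simp add: vec_eq_iff partial_change[OF c c' smooth_fun_sm[OF f c'] p] matrix_vector_mult_def
        transpose_def jacobian_partial[OF c c' p] mult.commute)
  finally have "transpose ?J *v (?G *v (?J *v grad M f c p)) = transpose ?J *v (\<chi> i. partial c' i f p)" .
  moreover have "invertible (transpose ?J)"
    using det_jacobian_pos[OF cc] by (simp add: invertible_det_nz)
  ultimately have "?G *v (?J *v grad M f c p) = (\<chi> i. partial c' i f p)"
    using invertible_mult_vector_cancel by blast
  also have "\<dots> = ?G *v grad M f c' p"
    using gmat_grad[of c' p f] cc by simp
  finally have "?G *v (?J *v grad M f c p) = ?G *v grad M f c' p" .
  moreover have "invertible ?G"
    using det_gmat_pos[of c' p] cc by (simp add: invertible_det_nz)
  ultimately have "?J *v grad M f c p = grad M f c' p"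
    using invertible_mult_vector_cancel by blast
  then show "grad M f c' p $ k = (\<Sum>i\<in>UNIV. partial c i (\<lambda>q. coord c' q $ k) p * grad M f c p $ i)"
    by (simp add: vec_eq_iff matrix_vector_mult_def jacobian_partial[OF c c' p])
qed

text \<open>For 2 by 2 matrices, conjugation by the quarter turn takes the transpose of J to its
  adjugate, that is, det J times the inverse. The change of the area density accounts for exactly
  this factor det J.\<close>

lemma vf_ham:
  assumes f: "smooth_fun M f" shows "vector_field M (ham f)"
proof (rule vector_fieldI)
  fix c and k :: 2 assume c: "c \<in> atlas M"
  note o = chart_on_cdom[OF c]
  have "smooth_in c (cdom c) (\<lambda>q. - partial c k f q / vol_density M c q)" "smooth_in c (cdom c) (\<lambda>q. partial c k f q / vol_density M c q)" for k
    by (intro smooth_in_divide smooth_in_minus smooth_in_partial smooth_fun_sm[OF f] smooth_in_vol_density o; use vol_density_pos[OF c] in force)+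
  then show "smooth_in c (cdom c) (\<lambda>q. ham f c q $ k)"
    using exhaust_2[of k] smooth_in_cong[OF o ham_component(1)[OF c]] smooth_in_cong[OF o ham_component(2)[OF c]] by auto
next
  fix c c' U p and k :: 2 assume c: "chart_on c U" and c': "chart_on c' U" and p: "p \<in> U"
  have cc: "c \<in> atlas M" "c' \<in> atlas M" "p \<in> cdom c \<inter> cdom c'"
    using c c' p by (auto simp: chart_on_def)
  have D: "0 < vol_density M c' p" using vol_density_pos cc by simp
  define J where "J = jacobian c c' p"
  have J: "partial c i (\<lambda>q. coord c' q $ k) p = J $ k $ i" for i k
    by (simp add: J_def jacobian_partial[OF c c' p])
  have det: "0 < J $ 1 $ 1 * J $ 2 $ 2 - J $ 1 $ 2 * J $ 2 $ 1"
    "vol_density M c p = (J $ 1 $ 1 * J $ 2 $ 2 - J $ 1 $ 2 * J $ 2 $ 1) * vol_density M c' p"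
    using det_jacobian_pos[OF cc] vol_density_change[OF cc] by (simp_all add: det_2 J_def)
  have pc: "partial c i f p = partial c' 1 f p * J $ 1 $ i + partial c' 2 f p * J $ 2 $ i" for i
    by (simp add: partial_change[OF c c' smooth_fun_sm[OF f c'] p] sum_2 J)
  have "ham f c' p $ k = J $ k $ 1 * ham f c p $ 1 + J $ k $ 2 * ham f c p $ 2"
    using exhaust_2[of k] cc D det(1)
    by (elim disjE) (simp_all add: ham_component det(2) pc divide_simps, simp_all add: algebra_simps)
  then show "ham f c' p $ k = (\<Sum>i\<in>UNIV. partial c i (\<lambda>q. coord c' q $ k) p * ham f c p $ i)"
    by (simp add: sum_2 J)
qed

text \<open>After multiplication by the density the components are - d_2 f and d_1 f, so the
  divergence is a difference of mixed partial derivatives.\<close>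

lemma divergence_ham:
  assumes f: "smooth_fun M f" and p: "p \<in> points M"
  shows "divergence M (ham f) p = 0"
proof -
  note c = chart_at[OF p]
  let ?c = "chart_at M p" let ?D = "vol_density M ?c"
  note o = chart_on_cdom[OF c(1)]
  have e: "?D q * ham f ?c q $ 1 = - partial ?c 2 f q" "?D q * ham f ?c q $ 2 = partial ?c 1 f q"
    if "q \<in> cdom ?c" for q
    using vol_density_pos[OF c(1) that] by (simp_all add: ham_component[OF c(1) that])
  have s: "smooth_in ?c (cdom ?c) f" by (rule smooth_fun_sm[OF f o])
  have "partial ?c 1 (\<lambda>q. ?D q * ham f ?c q $ 1) p = - partial ?c 1 (partial ?c 2 f) p"
    by (subst partial_cong[OF o c(2) e(1)], assumption) (rule partial_minus[OF o c(2) smooth_in_partial[OF o s]])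
  moreover have "partial ?c 2 (\<lambda>q. ?D q * ham f ?c q $ 2) p = partial ?c 2 (partial ?c 1 f) p"
    by (rule partial_cong[OF o c(2) e(2)])
  ultimately show ?thesis
    using partial_commute[OF o c(2) s, of 1 2] by (simp add: divergence_def Let_def sum_2)
qed

text \<open>This is the Poisson bracket of \<open>a\<close> and \<open>b\<close> for the area form,
  from which antisymmetry can be read off.\<close>

lemma der_ham_eq:
  assumes "smooth_fun M a" "smooth_fun M b" "c \<in> atlas M" "p \<in> cdom c"
  shows "der (ham a) b p = (partial c 1 a p * partial c 2 b p - partial c 2 a p * partial c 1 b p) / vol_density M c p"
  by (simp add: der_eq[OF vf_ham[OF assms(1)] assms(2-4)] sum_2 ham_component[OF assms(3,4)] diff_divide_distrib)

lemma der_ham_antisym: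
  assumes "smooth_fun M a" "smooth_fun M b" "p \<in> points M"
  shows "der (ham a) b p = - der (ham b) a p"
  using der_ham_eq[OF assms(1,2) chart_at[OF assms(3)]] der_ham_eq[OF assms(2,1) chart_at[OF assms(3)]]
  by (simp add: minus_divide_left mult.commute)

text \<open>The rotation is an isometry, so the product of the Hamiltonian fields is that of the
  gradients, which is db(grad a).\<close>

lemma g_fun_ham:
  assumes "p \<in> points M"
  shows "g_fun M (ham a) (ham b) p = der (grad M a) b p"
proof -
  note c = chart_at[OF assms]
  let ?c = "chart_at M p"
  have D: "0 < det (gmat M ?c p)" using det_gmat_pos c by blast
  have D2: "vol_density M ?c p * vol_density M ?c p = det (gmat M ?c p)" by (rule vol_density_sq[OF c])
  show ?thesis
    using D vol_density_pos[OF c]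
    by (simp add: g_fun_def Let_def ip_def der_def inner_vec_def matrix_vector_mult_def sum_2 ham_component[OF c]
        grad_component[OF c] gmat_21[OF c] D2[symmetric] divide_simps) (simp add: algebra_simps)
qed

lemma g_fun_nonneg:
  assumes "p \<in> points M" shows "0 \<le> g_fun M V V p"
  using gmat_pos[OF chart_at[OF assms]] by (cases "V (chart_at M p) p = 0") (force simp: g_fun_def Let_def ip_def)+

lemma lie_bracket_cong:
  assumes "vf_eq M V V'" "vf_eq M W W'"
  shows "vf_eq M (lie_bracket V W) (lie_bracket V' W')"
  unfolding vf_eq_def
proof (intro ballI)
  fix c p assume c: "c \<in> atlas M" and p: "p \<in> cdom c"
  have e: "V c q = V' c q" "W c q = W' c q" if "q \<in> cdom c" for q
    using assms c that by (auto simp: vf_eq_def)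
  have "partial c i (\<lambda>q. V c q $ k) p = partial c i (\<lambda>q. V' c q $ k) p"
    "partial c i (\<lambda>q. W c q $ k) p = partial c i (\<lambda>q. W' c q $ k) p" for i k
    by (rule partial_cong[OF chart_on_cdom[OF c] p], simp add: e)+
  then show "lie_bracket V W c p = lie_bracket V' W' c p"
    by (simp add: lie_bracket_def e[OF p])
qed

text \<open>The Lie bracket of Hamiltonian fields is the Hamiltonian field of the Poisson bracket.
  In coordinates this is a polynomial identity in the first and second derivatives, the reciprocal
  density and its derivatives, once mixed partials are identified.\<close>

lemma lie_bracket_ham:
  assumes a: "smooth_fun M a" and b: "smooth_fun M b"
  shows "vf_eq M (lie_bracket (ham a) (ham b)) (ham (der (ham a) b))"
  unfolding vf_eq_def
proof (intro ballI)
  fix c p assume c: "c \<in> atlas M" and p: "p \<in> cdom c"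
  note o = chart_on_cdom[OF c]
  \<comment> \<open>Using the reciprocal density turns all quotients into products, so that the
    product rule is enough.\<close>
  define e where "e q = inverse (vol_density M c q)" for q
  have se: "smooth_in c (cdom c) e"
    unfolding e_def[abs_def] by (rule smooth_in_inverse[OF o smooth_in_vol_density[OF o]]) (use vol_density_pos[OF c] in force)
  have sa: "smooth_in c (cdom c) (partial c i a)" "smooth_in c (cdom c) (partial c i b)" for i
    by (intro smooth_in_partial smooth_fun_sm a b o)+
  have h1: "ham f c q $ 1 = - (partial c 2 f q * e q)" and h2: "ham f c q $ 2 = partial c 1 f q * e q"
    if "q \<in> cdom c" for f q
    by (simp_all add: ham_component[OF c that] e_def divide_inverse)
  have hd: "der (ham a) b q = (partial c 1 a q * partial c 2 b q - partial c 2 a q * partial c 1 b q) * e q"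
    if "q \<in> cdom c" for q
    by (simp add: der_ham_eq[OF a b c that] e_def divide_inverse)
  have p1: "partial c i (\<lambda>q. ham f c q $ 1) p = - (partial c i (partial c 2 f) p * e p + partial c 2 f p * partial c i e p)"
    if "f = a \<or> f = b" for i f
    by (subst partial_cong[OF o p h1], assumption)
      (use sa se that in \<open>auto simp: partial_minus[OF o p] partial_mult[OF o p] smooth_in_mult\<close>)
  have p2: "partial c i (\<lambda>q. ham f c q $ 2) p = partial c i (partial c 1 f) p * e p + partial c 1 f p * partial c i e p"
    if "f = a \<or> f = b" for i f
    by (subst partial_cong[OF o p h2], assumption)
      (use sa se that in \<open>auto simp: partial_mult[OF o p]\<close>)
  have ph: "partial c i (der (ham a) b) p =
     (partial c i (partial c 1 a) p * partial c 2 b p + partial c 1 a p * partial c i (partial c 2 b) p -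
      (partial c i (partial c 2 a) p * partial c 1 b p + partial c 2 a p * partial c i (partial c 1 b) p)) * e p +
     (partial c 1 a p * partial c 2 b p - partial c 2 a p * partial c 1 b p) * partial c i e p" for i
    by (subst partial_cong[OF o p hd], assumption)
      (simp add: partial_mult[OF o p] partial_diff[OF o p] sa se smooth_in_mult smooth_in_diff)
  have com: "partial c 2 (partial c 1 f) p = partial c 1 (partial c 2 f) p" if "f = a \<or> f = b" for f
    using partial_commute[OF o p smooth_fun_sm[OF _ o], of f 2 1] that a b by auto
  show "lie_bracket (ham a) (ham b) c p = ham (der (ham a) b) c p"
    by (simp add: vec_eq_iff forall_2 lie_bracket_def sum_2 h1[OF p] h2[OF p] p1 p2 ph com)
      (simp add: algebra_simps)
qed

text \<open>The hypothesis quantifies over unit normals, so one has to be exhibited. A multiple of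
  the metric dual of the second coordinate is one, and its product with a vector is a positive
  multiple of the second component.\<close>

lemma tangent_component:
  assumes t: "tangent_to_boundary M V" and c: "c \<in> atlas M" "p \<in> cdom c" "coord c p $ 2 = 0"
  shows "V c p $ 2 = 0"
proof -
  let ?G = "gmat M c p"
  have p: "p \<in> cdom c \<inter> boundary M" using c by (auto simp: boundary_def)
  have g: "0 < det ?G" "0 < ?G $ 1 $ 1" using det_gmat_pos[OF c(1,2)] by auto
  \<comment> \<open>The vector (- g12, g11) is sent by the Gram matrix to (0, det), so its squared
    length is g11 times det; \<open>s\<close> normalises it.\<close>
  define s where "s = 1 / sqrt (?G $ 1 $ 1 * det ?G)"
  define \<nu> :: "real^2" where "\<nu> = vector [- s * ?G $ 1 $ 2, s * ?G $ 1 $ 1]"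
  have s: "0 < s" "s * s * (?G $ 1 $ 1 * det ?G) = 1"
    using g by (auto simp: s_def field_simps)
  have n: "?G *v \<nu> = vector [0, s * det ?G]"
    by (simp add: vec_eq_iff forall_2 matrix_vector_mult_def sum_2 \<nu>_def det_2 gmat_21[OF c(1,2)] algebra_simps)
  have sym: "ip M c p v w = ip M c p w v" for v w
    by (simp add: ip_def inner_vec_def matrix_vector_mult_def sum_2 gmat_21[OF c(1,2)] algebra_simps)
  have i: "ip M c p v \<nu> = v $ 2 * (s * det ?G)" for v
    by (simp add: ip_def n inner_vec_def sum_2)
  have "\<nu> $ 2 = s * ?G $ 1 $ 1" by (simp add: \<nu>_def)
  with s(2) have "ip M c p \<nu> \<nu> = 1" by (simp add: i mult_ac)
  moreover have "ip M c p \<nu> t = 0" if "t $ 2 = 0" for t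
    using sym[of \<nu> t] by (simp add: i that)
  ultimately have "unit_normal M c p \<nu>" by (simp add: unit_normal_def)
  with t p c(1) have "ip M c p (V c p) \<nu> = 0"
    unfolding tangent_to_boundary_def by blast
  then show ?thesis using i g s by simp
qed

end

subsection \<open>Integrals over the half plane\<close>

lemma absolutely_integrable_change_of_variables_real_valued:
  fixes f :: "real^'n::{finite,wellorder} \<Rightarrow> real" and g :: "real^'n::_ \<Rightarrow> real^'n::_"
  assumes "S \<in> sets lebesgue" "\<And>x. x \<in> S \<Longrightarrow> (g has_derivative g' x) (at x within S)" "inj_on g S"
    and "f absolutely_integrable_on (g ` S)"
  shows "integral S (\<lambda>x. \<bar>det (matrix (g' x))\<bar> * f (g x)) = integral (g ` S) f"
proof -
  \<comment> \<open>The change of variables theorem used here speaks of cartesian vectors;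
    \<open>vec\<close> moves real values into real^1 and back.\<close>
  let ?F = "\<lambda>x. vec (f x) :: real^1"
  have "?F absolutely_integrable_on (g ` S)"
    using assms(4) by (simp add: absolutely_integrable_on_1_iff)
  then have "integral S (\<lambda>x. \<bar>det (matrix (g' x))\<bar> *\<^sub>R ?F (g x)) = integral (g ` S) ?F"
    using has_absolute_integral_change_of_variables[OF assms(1-3), of ?F "integral (g ` S) ?F"] by simp
  then show ?thesis
    by (simp add: integral_on_1_eq vec_eq_iff)
qed

lemma integral_translate_UNIV:
  fixes f :: "real^'n::{finite,wellorder} \<Rightarrow> real"
  assumes "f absolutely_integrable_on UNIV"
  shows "(\<lambda>x. f (x + a)) absolutely_integrable_on UNIV" "integral UNIV (\<lambda>x. f (x + a)) = integral UNIV f"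
proof -
  have r: "range (\<lambda>x::real^'n::{finite,wellorder}. x + a) = UNIV"
    by (metis add_uminus_conv_diff diff_add_cancel surj_def)
  have d: "((\<lambda>x. x + a) has_derivative (\<lambda>x. x)) (at x within UNIV)" for x :: "real^'n::{finite,wellorder}"
    by (auto intro!: derivative_eq_intros)
  have m: "det (matrix (\<lambda>x::real^'n::{finite,wellorder}. x)) = 1"
  proof -
    have "matrix (\<lambda>x::real^'n::{finite,wellorder}. x) = mat 1"
      by (simp add: matrix_def mat_def axis_def vec_eq_iff)
    then show ?thesis by simp
  qed
  have i: "inj (\<lambda>x::real^'n::{finite,wellorder}. x + a)" by (simp add: inj_on_def)
  let ?F = "\<lambda>x. vec (f x) :: real^1"
  have "(\<lambda>x. \<bar>det (matrix (\<lambda>x::real^'n::{finite,wellorder}. x))\<bar> *\<^sub>R ?F (x + a)) absolutely_integrable_on UNIV \<and>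
      integral UNIV (\<lambda>x. \<bar>det (matrix (\<lambda>x::real^'n::{finite,wellorder}. x))\<bar> *\<^sub>R ?F (x + a)) = integral UNIV ?F"
    using has_absolute_integral_change_of_variables[OF _ d i, of ?F "integral UNIV ?F"] assms
    unfolding r by (simp add: absolutely_integrable_on_1_iff)
  then show "(\<lambda>x. f (x + a)) absolutely_integrable_on UNIV" "integral UNIV (\<lambda>x. f (x + a)) = integral UNIV f"
    by (simp_all add: m absolutely_integrable_on_1_iff integral_on_1_eq vec_eq_iff)
qed

lemma absolutely_integrable_compact:
  fixes f :: "'a::euclidean_space \<Rightarrow> real"
  assumes "compact K" "continuous_on K f"
  shows "f absolutely_integrable_on K"
  unfolding set_integrable_def
  using integrable_completion[of "\<lambda>x. indicator K x *\<^sub>R f x" lborel] borel_integrable_compact[OF assms]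
  by (metis borel_measurable_integrable integrable_completion)

lemma absolutely_integrable_compact_support:
  fixes f :: "'a::euclidean_space \<Rightarrow> real"
  assumes "compact K" "K \<subseteq> A" "continuous_on A f" "\<And>x. x \<in> A \<Longrightarrow> x \<notin> K \<Longrightarrow> f x = 0"
  shows "f absolutely_integrable_on A"
proof -
  have "f absolutely_integrable_on K"
    by (rule absolutely_integrable_compact[OF assms(1) continuous_on_subset[OF assms(3,2)]])
  then have "(\<lambda>x. if x \<in> K then f x else 0) absolutely_integrable_on UNIV"
    by (simp add: absolutely_integrable_restrict_UNIV)
  moreover have "(\<lambda>x. if x \<in> K then f x else 0) = (\<lambda>x. if x \<in> A then f x else 0)"
    using assms(2,4) by (auto simp: fun_eq_iff)
  ultimately show ?thesis by (simp add: absolutely_integrable_restrict_UNIV)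
qed

lemma hopen_half_plane: "hopen half_plane" by (simp add: openin_subtopology_self)

lemma closed_half_plane: "closed half_plane"
  unfolding half_plane_def by (intro closed_Collect_le continuous_intros)

lemma convex_half_plane: "convex half_plane"
  unfolding half_plane_def convex_def by simp

lemma hopen_subset: "hopen A \<Longrightarrow> A \<subseteq> half_plane"
  by (rule openin_imp_subset)

lemma hopen_lebesgue: "hopen A \<Longrightarrow> A \<in> sets lebesgue"
  using closed_half_plane by (auto simp: openin_open intro!: sets.Int)

lemma hopen_diff_closed: "hopen A \<Longrightarrow> closed K \<Longrightarrow> hopen (A - K)"
  by (metis Diff_eq open_Compl openin_Int_open)

lemma frechet_pd:
  assumes "hopen A" "smooth_on A f" "x \<in> A"
  shows "frechet_derivative f (at x within A) v = v $ 1 * pd A 1 f x + v $ 2 * pd A 2 f x"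
proof -
  let ?f' = "frechet_derivative f (at x within A)"
  have l: "linear ?f'"
    using smooth_on_has_derivative[OF assms(2,3)] has_derivative_linear by blast
  have "v = v $ 1 *\<^sub>R axis 1 1 + v $ 2 *\<^sub>R axis 2 1"
    by (simp add: vec_eq_iff forall_2 axis_def)
  then have "?f' v = ?f' (v $ 1 *\<^sub>R axis 1 1 + v $ 2 *\<^sub>R axis 2 1)" by simp
  also have "\<dots> = v $ 1 * ?f' (axis 1 1) + v $ 2 * ?f' (axis 2 1)"
    by (simp only: linear_add[OF l] linear_scale[OF l] real_scaleR_def)
  finally show ?thesis by (simp add: pd_def)
qed

lemma pd_zero_off_support:
  assumes "hopen A" "closed K" "\<And>x. x \<in> A \<Longrightarrow> x \<notin> K \<Longrightarrow> F x = 0" "x \<in> A" "x \<notin> K"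
  shows "pd A i F x = 0"
proof -
  have o: "hopen (A - K)" by (rule hopen_diff_closed[OF assms(1,2)])
  have "pd A i F x = pd (A - K) i F x"
    by (rule pd_subset[OF assms(1) o]) (use assms in auto)
  also have "\<dots> = pd (A - K) i (\<lambda>x. 0) x"
    by (rule pd_cong) (use assms in auto)
  also have "\<dots> = 0" by (rule pd_const[OF o]) (use assms in auto)
  finally show ?thesis .
qed

text \<open>Extending \<open>F\<close> by zero, the partial derivative is a dominated limit of difference quotients, all
  of which have integral zero by translation invariance.\<close>

lemma integral_pd_compact_support:
  assumes A: "hopen A" and K: "compact K" "K \<subseteq> A" and F: "smooth_on A F"
    and F0: "\<And>x. x \<in> A \<Longrightarrow> x \<notin> K \<Longrightarrow> F x = 0"
    and bd: "i = 2 \<Longrightarrow> (\<And>x. x \<in> A \<Longrightarrow> x $ 2 = 0 \<Longrightarrow> F x = 0)"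
  shows "integral A (pd A i F) = 0"
proof -
  have Ah: "A \<subseteq> half_plane" by (rule hopen_subset[OF A])
  have clK: "closed K" by (rule compact_imp_closed[OF K(1)])
  define E where "E x = (if x \<in> A then F x else 0)" for x
  define E' where "E' x = (if x \<in> A then frechet_derivative F (at x within A) else (\<lambda>v. 0))" for x
  have E0: "E x = 0" if "x \<notin> K" for x using F0 that by (auto simp: E_def)
  \<comment> \<open>The zero extension is differentiable on the whole half plane: near points of
    \<open>A\<close> it agrees with \<open>F\<close>, and near all others it vanishes, because
    \<open>K\<close> is closed and lies in \<open>A\<close>.\<close>
  have der: "(E has_derivative E' x) (at x within half_plane)" if x: "x \<in> half_plane" for x
  proof (cases "x \<in> A")
    case True
    have "(E has_derivative frechet_derivative F (at x within A)) (at x within A)"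
      by (rule has_derivative_transform[OF True _ smooth_on_has_derivative[OF F True]]) (simp add: E_def)
    then show ?thesis
      using at_within_hopen_subset[OF hopen_half_plane A Ah True] True by (simp add: E'_def)
  next
    case False
    let ?B = "half_plane - K"
    have xB: "x \<in> ?B" using False K(2) x by auto
    have "((\<lambda>x. 0) has_derivative (\<lambda>v. 0)) (at x within ?B)" by simp
    then have "(E has_derivative (\<lambda>v. 0)) (at x within ?B)"
      by (rule has_derivative_transform[OF xB, rotated]) (auto simp: E0)
    then show ?thesis
      using at_within_hopen_subset[OF hopen_half_plane hopen_diff_closed[OF hopen_half_plane clK] _ xB] False
      by (auto simp: E'_def)
  qed
  have "\<exists>b. \<forall>x\<in>K. \<bar>pd A j F x\<bar> \<le> b" for j
  proof -
    have "continuous_on K (pd A j F)"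
      by (rule continuous_on_subset[OF smooth_on_imp_continuous_on[OF smooth_on_pd[OF A F]] K(2)])
    from compact_imp_bounded[OF compact_continuous_image[OF this K(1)]]
    show ?thesis by (auto simp: bounded_iff)
  qed
  then obtain b where b: "\<And>j x. x \<in> K \<Longrightarrow> \<bar>pd A j F x\<bar> \<le> b j" by metis
  define B where "B = \<bar>b 1\<bar> + \<bar>b 2\<bar>"
  have B0: "0 \<le> B" by (simp add: B_def)
  have pdb: "\<bar>pd A j F x\<bar> \<le> \<bar>b j\<bar>" if "x \<in> A" for j x
    using b[of x j] pd_zero_off_support[OF A clK F0 that, where i=j] by (cases "x \<in> K") auto
  have Eb: "\<bar>E' x v\<bar> \<le> B * norm v" for x v
  proof (cases "x \<in> A")
    case True
    have "\<bar>E' x v\<bar> \<le> \<bar>v $ 1\<bar> * \<bar>pd A 1 F x\<bar> + \<bar>v $ 2\<bar> * \<bar>pd A 2 F x\<bar>"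
      using True abs_triangle_ineq[of "v $ 1 * pd A 1 F x" "v $ 2 * pd A 2 F x"]
      by (simp add: E'_def frechet_pd[OF A F True] abs_mult)
    also have "\<dots> \<le> norm v * \<bar>b 1\<bar> + norm v * \<bar>b 2\<bar>"
      using pdb[OF True] component_le_norm_cart[of v] by (intro add_mono mult_mono) auto
    finally show ?thesis by (simp add: B_def algebra_simps)
  qed (simp add: E'_def B0)
  have lip: "\<bar>E x - E y\<bar> \<le> B * norm (x - y)" if "x \<in> half_plane" "y \<in> half_plane" for x y
  proof -
    have "onorm (E' z) \<le> B" for z
      by (rule onorm_le) (use Eb in simp)
    then have "norm (E x - E y) \<le> B * norm (x - y)"
      using differentiable_bound[OF convex_half_plane der _ that, of B] by blast
    then show ?thesis by simp
  qed
  let ?e = "axis i 1 :: real^2"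
  \<comment> \<open>For i = 1 a translation never crosses the boundary line, where \<open>E\<close>
    may jump; for i = 2 the hypothesis \<open>bd\<close> excludes a jump. So one constant bounds the
    difference quotients everywhere.\<close>
  have step: "\<bar>E (x + t *\<^sub>R ?e) - E x\<bar> \<le> B * t" if t: "0 < t" for x t
  proof (cases "x \<in> half_plane")
    case True
    then have "x + t *\<^sub>R ?e \<in> half_plane" using t by (auto simp: half_plane_def axis_def)
    from lip[OF this True] show ?thesis using t by simp
  next
    case False
    then have Ex: "E x = 0" "x $ 2 < 0" using Ah by (auto simp: E_def half_plane_def)
    show ?thesis
    proof (cases "x + t *\<^sub>R ?e \<in> half_plane")
      case True
      then have i: "i = 2" using False by (auto simp: half_plane_def axis_def split: if_splits)
      \<comment> \<open>Here the vertical segment meets the boundary line. \<open>E\<close> vanishes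
        at \<open>y\<close> and below, so only the part above \<open>y\<close> contributes.\<close>
      define y where "y = x + (- x $ 2) *\<^sub>R ?e"
      have y: "y \<in> half_plane" "y $ 2 = 0" by (auto simp: y_def half_plane_def axis_def i)
      then have "E y = 0" using bd[OF i] by (auto simp: E_def)
      moreover have "x + t *\<^sub>R ?e - y = (t + x $ 2) *\<^sub>R ?e" by (simp add: y_def algebra_simps)
      moreover have "0 \<le> t + x $ 2" using True by (simp add: half_plane_def axis_def i)
      ultimately have "\<bar>E (x + t *\<^sub>R ?e) - E x\<bar> \<le> B * (t + x $ 2)"
        using lip[OF True y(1)] Ex by simp
      also have "\<dots> \<le> B * t" using Ex(2) B0 by (intro mult_left_mono) auto
      finally show ?thesis .
    next
      case F: False
      then have "x + t *\<^sub>R ?e \<notin> A" using Ah by blast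
      then show ?thesis using Ex(1) B0 t by (simp add: E_def)
    qed
  qed
  define t where "t k = 1 / real (Suc k)" for k
  have t: "0 < t k" "t k \<le> 1" for k by (auto simp: t_def)
  have t0: "t \<longlonglongrightarrow> 0"
    unfolding t_def[abs_def] using LIMSEQ_inverse_real_of_nat by (simp add: inverse_eq_divide)
  define f where "f k x = (E (x + t k *\<^sub>R ?e) - E x) / t k" for k x
  define g where "g x = (if x \<in> A then pd A i F x else 0)" for x
  have "F absolutely_integrable_on A"
    by (rule absolutely_integrable_compact_support[OF K smooth_on_imp_continuous_on[OF F] F0])
  then have Eint: "E absolutely_integrable_on UNIV"
    by (simp add: E_def[abs_def] absolutely_integrable_restrict_UNIV)
  have shift: "(\<lambda>x. E (x + a)) integrable_on UNIV" "E integrable_on UNIV" "integral UNIV (\<lambda>x. E (x + a)) = integral UNIV E" for a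
    using integral_translate_UNIV[OF Eint, of a] Eint set_lebesgue_integral_eq_integral(1) by blast+
  have fint: "f k integrable_on UNIV" and f0: "integral UNIV (f k) = 0" for k
    using shift by (simp_all add: f_def[abs_def] divide_inverse integrable_diff integral_diff integrable_on_mult_left)
  obtain R where R: "\<And>x. x \<in> K \<Longrightarrow> norm x \<le> R"
    using compact_imp_bounded[OF K(1)] by (auto simp: bounded_iff)
  \<comment> \<open>The dominating function. The steps \<open>t k\<close> are at most 1, so both
    terms of a quotient vanish outside the ball of radius R + 1.\<close>
  define h where "h x = (if x \<in> cball 0 (R + 1) then B else 0)" for x :: "real^2"
  have hint: "h integrable_on UNIV"
    unfolding h_def[abs_def] integrable_restrict_UNIV
    by (intro set_lebesgue_integral_eq_integral(1) absolutely_integrable_compact) auto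
  have fh: "norm (f k x) \<le> h x" for k x
  proof (cases "x \<in> cball 0 (R + 1)")
    case True
    then show ?thesis using step[OF t(1)[of k], of x] t(1)[of k] by (simp add: f_def h_def field_simps)
  next
    case False
    have "norm x \<le> norm (x + t k *\<^sub>R ?e) + norm (t k *\<^sub>R ?e)"
      using norm_triangle_ineq4[of "x + t k *\<^sub>R ?e" "t k *\<^sub>R ?e"] by simp
    then have "norm x \<le> norm (x + t k *\<^sub>R ?e) + 1" using t[of k] by simp
    then have "x \<notin> K" "x + t k *\<^sub>R ?e \<notin> K" using False R[of x] R[of "x + t k *\<^sub>R ?e"] by auto
    then show ?thesis using False by (simp add: f_def h_def E0)
  qed
  have lim: "(\<lambda>k. f k x) \<longlonglongrightarrow> g x" for x
  proof (cases "x \<in> half_plane")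
    case True
    have gx: "E' x ?e = g x" by (simp add: E'_def g_def pd_def)
    \<comment> \<open>Positive translates stay in the half plane, so the one-sided derivative
      determines the limit along \<open>t\<close> even on the boundary.\<close>
    have h: "x + s *\<^sub>R ?e \<in> half_plane" if "0 \<le> s" for s
      using True that by (auto simp: half_plane_def axis_def)
    have "((\<lambda>s. x + s *\<^sub>R ?e) has_derivative (\<lambda>s. s *\<^sub>R ?e)) (at 0 within {0..})"
      by (auto intro!: derivative_eq_intros)
    moreover have "(E has_derivative E' x) (at (x + 0 *\<^sub>R ?e) within (\<lambda>s. x + s *\<^sub>R ?e) ` {0..})"
      by (rule has_derivative_subset[of _ _ _ half_plane]) (use der[OF True] h in auto)
    ultimately have "((\<lambda>s. E (x + s *\<^sub>R ?e)) has_derivative (\<lambda>s. E' x (s *\<^sub>R ?e))) (at 0 within {0..})"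
      using diff_chain_within by (fastforce simp: o_def)
    moreover have "E' x (s *\<^sub>R ?e) = s * g x" for s
      using linear_scale[OF has_derivative_linear[OF der[OF True]], of s ?e] gx by simp
    ultimately have "((\<lambda>s. E (x + s *\<^sub>R ?e)) has_derivative (\<lambda>s. s * g x)) (at 0 within {0..})"
      by simp
    then have "((\<lambda>s. E (x + s *\<^sub>R ?e)) has_field_derivative g x) (at 0 within {0..})"
      unfolding has_field_derivative_def by (rule has_derivative_eq_rhs) (simp add: fun_eq_iff mult.commute)
    then have l: "((\<lambda>s. (E (x + s *\<^sub>R ?e) - E x) / s) \<longlongrightarrow> g x) (at 0 within {0..})"
      by (simp add: has_field_derivative_iff)
    have "filterlim t (at 0 within {0..}) sequentially"
      using t0 t by (auto simp: filterlim_at less_imp_le less_imp_neq[symmetric])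
    from filterlim_compose[OF l this] show ?thesis by (simp add: f_def)
  next
    case False
    then have x2: "x $ 2 < 0" by (auto simp: half_plane_def)
    \<comment> \<open>Below the boundary line a small enough step stays below it, where
      \<open>E\<close> is zero.\<close>
    have "\<forall>\<^sub>F k in sequentially. t k < - x $ 2"
      using order_tendstoD(2)[OF t0] x2 by simp
    then have "\<forall>\<^sub>F k in sequentially. 0 = f k x"
    proof eventually_elim
      case (elim k)
      then have "x + t k *\<^sub>R ?e \<notin> half_plane" using x2 by (auto simp: half_plane_def axis_def)
      then show ?case using False Ah by (auto simp: f_def E_def)
    qed
    then have "(\<lambda>k. f k x) \<longlonglongrightarrow> 0"
      by (rule Lim_transform_eventually[OF tendsto_const])
    moreover have "g x = 0" using False Ah by (auto simp: g_def)
    ultimately show ?thesis by simp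
  qed
  have "(\<lambda>k. integral UNIV (f k)) \<longlonglongrightarrow> integral UNIV g"
    by (rule dominated_convergence(2)[OF fint hint fh lim])
  then have "integral UNIV g = 0" by (simp add: f0 LIMSEQ_const_iff)
  then show ?thesis
    by (simp add: g_def[abs_def] Henstock_Kurzweil_Integration.integral_restrict_UNIV)
qed

subsection \<open>Partitions of unity and the integral\<close>

context riemannian_surface begin

text \<open>\<open>S\<close> is any closed set containing the support, so that it can be kept when
  \<open>f\<close> is multiplied by another function.\<close>

definition supported :: "('a \<Rightarrow> real) \<Rightarrow> 'a set \<Rightarrow> bool" where
  "supported f S \<longleftrightarrow> closedin (top_of M) S \<and> (\<forall>p\<in>points M. p \<notin> S \<longrightarrow> f p = 0)"

definition chart_int :: "'a chart \<Rightarrow> ('a \<Rightarrow> real) \<Rightarrow> real" where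
  "chart_int c f = integral (img c) ((\<lambda>p. f p * vol_density M c p) \<circ> chart_inv c)"

lemma compact_coord_image:
  assumes c: "c \<in> atlas M" and S: "closedin (top_of M) S" "S \<subseteq> cdom c"
  shows "compact (coord c ` S)"
proof -
  have "compactin (subtopology (top_of M) (cdom c)) S"
    using closedin_compact_space[OF compact_M S(1)] S(2) by (simp add: compactin_subtopology)
  from image_compactin[OF this homeomorphic_imp_continuous_map[OF homeo_coord[OF c]]]
  show ?thesis by (simp add: compactin_subtopology)
qed

text \<open>Together with the Hausdorff property this makes the support of a function transplanted
  from a chart closed in the whole surface.\<close>

lemma compactin_chart_inv_image:
  assumes c: "c \<in> atlas M" and C: "compact C" "C \<subseteq> img c"
  shows "compactin (top_of M) (chart_inv c ` C)"
proof -
  obtain g where g: "homeomorphic_maps (subtopology (top_of M) (cdom c)) (top_of_set (img c)) (coord c) g"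
    using homeo_coord[OF c] homeomorphic_map_maps by metis
  have sp: "topspace (subtopology (top_of M) (cdom c)) = cdom c"
    using cdom_subset_points[OF c] by auto
  have "compactin (top_of_set (img c)) C" using C by (simp add: compactin_subtopology)
  then have "compactin (subtopology (top_of M) (cdom c)) (g ` C)"
    using g image_compactin unfolding homeomorphic_maps_def by blast
  then have "compactin (top_of M) (g ` C)" by (simp add: compactin_subtopology)
  moreover have "g x = chart_inv c x" if "x \<in> C" for x
  proof -
    have x: "x \<in> img c" using that C by auto
    have "g (coord c (chart_inv c x)) = chart_inv c x"
      using g chart_inv_in_cdom[OF x] sp unfolding homeomorphic_maps_def by auto
    then show ?thesis by (simp add: coord_chart_inv[OF x])
  qed
  ultimately show ?thesis by (metis image_cong)
qed

lemma chart_int_integrable: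
  assumes c: "c \<in> atlas M" and f: "smooth_in c (cdom c) f" and S: "supported f S" "S \<subseteq> cdom c"
  shows "((\<lambda>p. f p * vol_density M c p) \<circ> chart_inv c) absolutely_integrable_on img c"
proof (rule absolutely_integrable_compact_support)
  show "compact (coord c ` S)"
    using S by (intro compact_coord_image[OF c]) (auto simp: supported_def)
  show "coord c ` S \<subseteq> img c" by (rule coord_image_subset_img[OF S(2)])
  have "smooth_in c (cdom c) (\<lambda>p. f p * vol_density M c p)"
    by (intro smooth_in_mult f smooth_in_vol_density chart_on_cdom c)
  then show "continuous_on (img c) ((\<lambda>p. f p * vol_density M c p) \<circ> chart_inv c)"
    unfolding smooth_in_def img_def by (rule smooth_on_imp_continuous_on)
  fix x assume x: "x \<in> img c" "x \<notin> coord c ` S"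
  then have "chart_inv c x \<notin> S" using coord_chart_inv by force
  then show "((\<lambda>p. f p * vol_density M c p) \<circ> chart_inv c) x = 0"
    using S(1) chart_inv_in_cdom[OF x(1)] cdom_subset_points[OF c] by (auto simp: supported_def)
qed

lemma chart_int_cong:
  assumes "\<And>p. p \<in> cdom c \<Longrightarrow> f p = g p"
  shows "chart_int c f = chart_int c g"
  unfolding chart_int_def
  by (rule Henstock_Kurzweil_Integration.integral_cong) (simp add: assms chart_inv_in_cdom)

lemma chart_int_sum:
  assumes c: "c \<in> atlas M" and I: "finite I"
    and f: "\<And>i. i \<in> I \<Longrightarrow> smooth_in c (cdom c) (f i)" "\<And>i. i \<in> I \<Longrightarrow> supported (f i) (S i)" "\<And>i. i \<in> I \<Longrightarrow> S i \<subseteq> cdom c"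
  shows "chart_int c (\<lambda>p. \<Sum>i\<in>I. f i p) = (\<Sum>i\<in>I. chart_int c (f i))"
proof -
  have "chart_int c (\<lambda>p. \<Sum>i\<in>I. f i p) =
      integral (img c) (\<lambda>x. \<Sum>i\<in>I. ((\<lambda>p. f i p * vol_density M c p) \<circ> chart_inv c) x)"
    by (simp add: chart_int_def o_def sum_distrib_right)
  also have "\<dots> = (\<Sum>i\<in>I. chart_int c (f i))"
    unfolding chart_int_def
    by (intro Henstock_Kurzweil_Integration.integral_sum I set_lebesgue_integral_eq_integral(1) chart_int_integrable[OF c f])
  finally show ?thesis .
qed

lemma chart_int_cmult: "chart_int c (\<lambda>p. k * f p) = k * chart_int c f"
  by (simp add: chart_int_def o_def mult.assoc)

lemma chart_int_mono:
  assumes c: "c \<in> atlas M" and f: "smooth_in c (cdom c) f" "smooth_in c (cdom c) g" and S: "supported f S" "supported g S" "S \<subseteq> cdom c"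
    and le: "\<And>p. p \<in> cdom c \<Longrightarrow> f p \<le> g p"
  shows "chart_int c f \<le> chart_int c g"
  unfolding chart_int_def
proof (rule integral_le)
  fix x assume "x \<in> img c"
  then show "((\<lambda>p. f p * vol_density M c p) \<circ> chart_inv c) x \<le> ((\<lambda>p. g p * vol_density M c p) \<circ> chart_inv c) x"
    using le[OF chart_inv_in_cdom] vol_density_pos[OF c chart_inv_in_cdom]
    by (simp add: mult_right_mono less_imp_le)
qed (intro set_lebesgue_integral_eq_integral(1) chart_int_integrable c f S | rule S)+

text \<open>On the overlap this is the change of variables formula: the density in \<open>c\<close>
  is the density in \<open>c'\<close> times the positive Jacobian determinant.\<close>

lemma chart_int_change:
  assumes c: "c \<in> atlas M" and c': "c' \<in> atlas M" and f: "smooth_fun M f"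
    and S: "supported f S" "S \<subseteq> cdom c" "S \<subseteq> cdom c'"
  shows "chart_int c f = chart_int c' f"
proof -
  define U where "U = cdom c \<inter> cdom c'"
  have o: "chart_on c U" and o': "chart_on c' U"
    using c c' by (simp_all add: U_def chart_on_overlap chart_on_overlap')
  let ?A = "coord c ` U" let ?A' = "coord c' ` U"
  define h where "h c x = f (chart_inv c x) * vol_density M c (chart_inv c x)" for c x
  let ?T = "coord c' \<circ> chart_inv c"
  let ?T' = "\<lambda>x. frechet_derivative ?T (at x within ?A)"
  \<comment> \<open>\<open>S\<close> lies in both chart domains, so each integral reduces to the
    coordinate image of the overlap.\<close>
  have restr: "chart_int d f = integral (coord d ` U) (h d)" if d: "d \<in> atlas M" "chart_on d U" for d
  proof -
    have "h d x = 0" if "x \<in> img d" "x \<notin> coord d ` U" for x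
    proof -
      have "chart_inv d x \<notin> S"
        using that S coord_chart_inv[OF that(1)] by (force simp: U_def)
      then show ?thesis
        using S(1) chart_inv_in_cdom[OF that(1)] cdom_subset_points[OF d(1)] by (auto simp: supported_def h_def)
    qed
    moreover have "coord d ` U \<subseteq> img d" using d(2) coord_image_subset_img by (auto simp: chart_on_def)
    ultimately have "(\<lambda>x. if x \<in> img d then h d x else 0) = (\<lambda>x. if x \<in> coord d ` U then h d x else 0)"
      by (auto simp: fun_eq_iff)
    from arg_cong[OF this, of "integral UNIV"] have "integral (img d) (h d) = integral (coord d ` U) (h d)"
      by (simp only: Henstock_Kurzweil_Integration.integral_restrict_UNIV)
    then show ?thesis by (simp add: chart_int_def h_def[abs_def] o_def)
  qed
  have T: "smooth_on ?A ?T"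
    by (rule smooth_on_vec) (use smooth_in_transition[OF o o'] in \<open>simp add: smooth_in_iff\<close>)
  have inj: "inj_on ?T ?A"
  proof (rule inj_onI)
    fix x y assume x: "x \<in> ?A" and y: "y \<in> ?A" and e: "?T x = ?T y"
    have "chart_inv c x = chart_inv c y"
      by (rule trans[OF transition_maps(2)[OF o o' x, symmetric] trans[OF arg_cong[OF e, of "chart_inv c'"] transition_maps(2)[OF o o' y]]])
    then show "x = y" using chart_inv_on(2)[OF o x] chart_inv_on(2)[OF o y] by metis
  qed
  have img: "?T ` ?A = ?A'"
    using chart_on_inv_coord[OF o] by (force simp: image_iff)
  have "h c' absolutely_integrable_on ?A'"
  proof (rule absolutely_integrable_compact_support)
    show "compact (coord c' ` S)"
      using S by (intro compact_coord_image[OF c']) (auto simp: supported_def)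
    show "coord c' ` S \<subseteq> ?A'" using S by (auto simp: U_def)
    have "smooth_in c' U (\<lambda>p. f p * vol_density M c' p)"
      by (intro smooth_in_mult smooth_fun_sm[OF f] smooth_in_vol_density o')
    then show "continuous_on ?A' (h c')"
      unfolding smooth_in_iff h_def[abs_def] by (rule smooth_on_imp_continuous_on)
    fix x assume x: "x \<in> ?A'" "x \<notin> coord c' ` S"
    then have "chart_inv c' x \<notin> S" using chart_inv_on(2)[OF o' x(1)] by (metis image_eqI)
    then show "h c' x = 0"
      using S(1) chart_inv_on(1)[OF o' x(1)] cdom_subset_points[OF c'] by (auto simp: supported_def h_def U_def)
  qed
  then have "integral ?A (\<lambda>x. \<bar>det (matrix (?T' x))\<bar> * h c' (?T x)) = integral ?A' (h c')"
    using absolutely_integrable_change_of_variables_real_valued[OF hopen_lebesgue[OF hopen_coord_image[OF o]]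
        smooth_on_has_derivative[OF T] inj, of "h c'"] img by simp
  moreover have "integral ?A (\<lambda>x. \<bar>det (matrix (?T' x))\<bar> * h c' (?T x)) = integral ?A (h c)"
  proof (rule Henstock_Kurzweil_Integration.integral_cong)
    fix x assume x: "x \<in> ?A"
    let ?p = "chart_inv c x"
    have p: "?p \<in> cdom c \<inter> cdom c'" using chart_inv_on(1)[OF o x] by (simp add: U_def)
    have "at (coord c ?p) within img c = at x within ?A"
      using at_within_hopen_subset[OF hopen_img[OF c] hopen_coord_image[OF o] coord_image_subset_img x]
        chart_inv_on(2)[OF o x] by (simp add: U_def)
    then have J: "matrix (?T' x) = jacobian c c' ?p" by (simp add: jacobian_def dchart_def)
    show "\<bar>det (matrix (?T' x))\<bar> * h c' (?T x) = h c x"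
      unfolding J h_def transition_maps(2)[OF o o' x] vol_density_change[OF c c' p]
      using det_jacobian_pos[OF c c' p] by simp
  qed
  ultimately show ?thesis using restr[OF c o] restr[OF c' o'] by simp
qed

section \<open>Bump functions on the surface and existence of partitions of unity\<close>

lemma smooth_in_local:
  assumes c: "c \<in> atlas M" and loc: "\<And>q. q \<in> cdom c \<Longrightarrow> \<exists>U. q \<in> U \<and> chart_on c U \<and> smooth_in c U f"
  shows "smooth_in c (cdom c) f"
  unfolding smooth_in_def
proof (rule smooth_on_local)
  fix x assume "x \<in> coord c ` cdom c"
  then obtain q where q: "q \<in> cdom c" "x = coord c q" by auto
  then obtain U where U: "q \<in> U" "chart_on c U" "smooth_in c U f" using loc by blast
  obtain W where W: "open W" "coord c ` U = half_plane \<inter> W"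
    using hopen_coord_image[OF U(2)] openin_open by metis
  have "coord c ` cdom c \<inter> W \<subseteq> coord c ` U"
    using hopen_subset[OF hopen_img[OF c]] W(2) by (auto simp: img_def)
  then have "smooth_on (coord c ` cdom c \<inter> W) (f \<circ> chart_inv c)"
    using U(3) smooth_on_subset unfolding smooth_in_def by blast
  then show "\<exists>U. open U \<and> x \<in> U \<and> smooth_on (coord c ` cdom c \<inter> U) (f \<circ> chart_inv c)"
    using W q U(1) by blast
qed

text \<open>The part of the closed ball in the half plane is compact, so its preimage is closed in
  the surface. Its complement is open, and there the function is zero; hence extension by zero
  preserves smoothness across the edge of the chart domain.\<close>

lemma smooth_fun_chart_bump:
  assumes c: "c \<in> atlas M" and C: "cball x r \<inter> half_plane \<subseteq> img c" and r: "0 < r"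
  defines "b \<equiv> \<lambda>q. if q \<in> cdom c then bump x r (coord c q) else 0"
  shows "smooth_fun M b"
    and "closedin (top_of M) (chart_inv c ` (cball x r \<inter> half_plane))"
    and "\<And>q. b q \<noteq> 0 \<Longrightarrow> q \<in> chart_inv c ` (cball x r \<inter> half_plane)"
proof -
  let ?K = "chart_inv c ` (cball x r \<inter> half_plane)"
  have "compact (cball x r \<inter> half_plane)"
    by (rule compact_Int_closed[OF compact_cball closed_half_plane])
  then have "compactin (top_of M) ?K"
    by (rule compactin_chart_inv_image[OF c _ C])
  then show cl: "closedin (top_of M) ?K"
    using compactin_imp_closedin[OF Hausdorff_M] by blast
  show nz: "q \<in> ?K" if "b q \<noteq> 0" for q
  proof -
    have q: "q \<in> cdom c" "dist (coord c q) x < r"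
      using that bump_pos_iff[OF r] by (auto simp: b_def split: if_splits)
    then have "coord c q \<in> cball x r \<inter> half_plane"
      using coord_in_img[OF q(1)] hopen_subset[OF hopen_img[OF c]] by (auto simp: dist_commute)
    then show ?thesis using chart_inv_coord[OF c q(1)] by (metis image_eqI)
  qed
  show "smooth_fun M b"
    unfolding smooth_fun_iff
  proof
    fix c' assume c': "c' \<in> atlas M"
    show "smooth_in c' (cdom c') b"
    proof (rule smooth_in_local[OF c'])
      fix q assume q: "q \<in> cdom c'"
      show "\<exists>U. q \<in> U \<and> chart_on c' U \<and> smooth_in c' U b"
      proof (cases "q \<in> cdom c")
        case True
        let ?U = "cdom c \<inter> cdom c'"
        note o = chart_on_overlap[OF c c'] chart_on_overlap'[OF c c']
        have "smooth_on (coord c ` ?U) (bump x r)" by (rule Ck_imp_smooth_on[OF Ck_bump])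
        then have "smooth_in c ?U b"
          unfolding smooth_in_def
          by (rule iffD1[OF smooth_on_cong, rotated]) (use chart_inv_on[OF o(1)] in \<open>auto simp: b_def\<close>)
        then have "smooth_in c' ?U b" by (rule smooth_in_change[OF o(2,1)])
        then show ?thesis using True q o by blast
      next
        case False
        let ?U = "cdom c' - ?K"
        have K: "?K \<subseteq> cdom c" using C chart_inv_in_cdom by blast
        have o: "chart_on c' ?U"
          using openin_diff[OF openin_cdom[OF c'] cl] c' by (auto simp: chart_on_def)
        have "smooth_in c' ?U b"
          using smooth_in_cong[OF o, of b "\<lambda>q. 0"] nz smooth_in_const by blast
        then show ?thesis using False K q o by blast
      qed
    qed
  qed
qed

lemma exists_bump:
  assumes p: "p \<in> points M"
  shows "\<exists>c b U. c \<in> atlas M \<and> smooth_fun M b \<and> (\<forall>q. 0 \<le> b q) \<and> openin (top_of M) U \<and> p \<in> U \<and>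
    (\<forall>q\<in>U. 0 < b q) \<and> top_of M closure_of {q \<in> points M. b q \<noteq> 0} \<subseteq> cdom c"
proof -
  obtain c where c: "c \<in> atlas M" "p \<in> cdom c" using chart_at[OF p] by blast
  let ?x = "coord c p"
  obtain W where W: "open W" "img c = half_plane \<inter> W"
    using hopen_img[OF c(1)] openin_open by metis
  have "?x \<in> W" using coord_in_img[OF c(2)] W by auto
  then obtain r where r: "0 < r" "cball ?x r \<subseteq> W" using W(1) open_contains_cball by blast
  have C: "cball ?x r \<inter> half_plane \<subseteq> img c" using r W by auto
  define b where "b = (\<lambda>q. if q \<in> cdom c then bump ?x r (coord c q) else 0)"
  note B = smooth_fun_chart_bump[OF c(1) C r(1), folded b_def]
  define U where "U = {q \<in> cdom c. dist (coord c q) ?x < r}"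
  have sp: "topspace (subtopology (top_of M) (cdom c)) = cdom c"
    using cdom_subset_points[OF c(1)] by auto
  have "openin (top_of_set (img c)) (img c \<inter> ball ?x r)" by (simp add: openin_open_Int)
  then have "openin (subtopology (top_of M) (cdom c)) {q \<in> topspace (subtopology (top_of M) (cdom c)). coord c q \<in> img c \<inter> ball ?x r}"
    using openin_continuous_map_preimage[OF homeomorphic_imp_continuous_map[OF homeo_coord[OF c(1)]]] by blast
  moreover have "{q \<in> topspace (subtopology (top_of M) (cdom c)). coord c q \<in> img c \<inter> ball ?x r} = U"
    unfolding sp U_def by (auto simp: dist_commute coord_in_img)
  ultimately have "openin (top_of M) U"
    using openin_trans_full[OF _ openin_cdom[OF c(1)]] by simp
  moreover have "p \<in> U" using c r by (simp add: U_def)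
  moreover have "0 < b q" if "q \<in> U" for q
    using that bump_pos_iff[OF r(1), of ?x "coord c q"] bump_nonneg[of ?x r "coord c q"]
    by (auto simp: b_def U_def less_le)
  moreover have "0 \<le> b q" for q by (simp add: b_def bump_nonneg)
  moreover have "top_of M closure_of {q \<in> points M. b q \<noteq> 0} \<subseteq> cdom c"
  proof -
    have "top_of M closure_of {q \<in> points M. b q \<noteq> 0} \<subseteq> chart_inv c ` (cball ?x r \<inter> half_plane)"
      by (rule closure_of_minimal[OF _ B(2)]) (use B(3) in \<open>auto simp: b_def\<close>)
    then show ?thesis using C chart_inv_in_cdom by blast
  qed
  ultimately show ?thesis using c(1) B(1) by blast
qed

text \<open>By compactness finitely many of the sets on which some bump is positive cover the
  surface. The sum of these bumps is then positive everywhere, and dividing by it normalises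
  them.\<close>

lemma exists_partition_of_unity: "\<exists>n c \<rho>. partition_of_unity M n c \<rho>"
proof -
  define Q where "Q p c b U \<longleftrightarrow> c \<in> atlas M \<and> smooth_fun M b \<and> (\<forall>q. 0 \<le> b q) \<and> openin (top_of M) U \<and> p \<in> U \<and>
    (\<forall>q\<in>U. 0 < b q) \<and> top_of M closure_of {q \<in> points M. b q \<noteq> 0} \<subseteq> cdom c" for p c b U
  have "\<forall>p\<in>points M. \<exists>t. Q p (fst t) (fst (snd t)) (snd (snd t))"
  proof
    fix p assume "p \<in> points M"
    from exists_bump[OF this] obtain c b U where "Q p c b U" unfolding Q_def by blast
    then show "\<exists>t. Q p (fst t) (fst (snd t)) (snd (snd t))" by (intro exI[of _ "(c, b, U)"]) simp
  qed
  from bchoice[OF this] obtain t where t: "\<forall>p\<in>points M. Q p (fst (t p)) (fst (snd (t p))) (snd (snd (t p)))" ..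
  define C where "C p = fst (t p)" for p
  define b where "b p = fst (snd (t p))" for p
  define U where "U p = snd (snd (t p))" for p
  have bp: "C p \<in> atlas M \<and> smooth_fun M (b p) \<and> (\<forall>q. 0 \<le> b p q) \<and>
      openin (top_of M) (U p) \<and> p \<in> U p \<and> (\<forall>q\<in>U p. 0 < b p q) \<and>
      top_of M closure_of {q \<in> points M. b p q \<noteq> 0} \<subseteq> cdom (C p)" if "p \<in> points M" for p
    using bspec[OF t that] unfolding Q_def C_def b_def U_def .
  have "compactin (top_of M) (points M)" using compact_M by (simp add: compact_space_def)
  moreover have "\<forall>V\<in>U ` points M. openin (top_of M) V" using bp by auto
  moreover have "points M \<subseteq> \<Union>(U ` points M)" using bp by auto
  ultimately obtain F where F: "finite F" "F \<subseteq> U ` points M" "points M \<subseteq> \<Union>F"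
    unfolding compactin_def by meson
  then obtain P where P: "P \<subseteq> points M" "finite P" "F = U ` P"
    by (metis finite_subset_image)
  obtain h and n :: nat where h: "bij_betw h {..<n} P"
    using ex_bij_betw_nat_finite[OF P(2)] by (auto simp: atLeast0LessThan)
  have hP: "h i \<in> points M" if "i < n" for i
    using h P(1) that by (auto simp: bij_betw_def)
  define s where "s q = (\<Sum>i<n. b (h i) q)" for q
  have spos: "0 < s q" if q: "q \<in> points M" for q
  proof -
    obtain p where p: "p \<in> P" "q \<in> U p" using F(3) P(3) q by auto
    then obtain i where i: "i < n" "p = h i" using h by (auto simp: bij_betw_def)
    have "0 < b (h i) q" using bp[OF hP[OF i(1)]] p i by auto
    moreover have "b (h i) q \<le> s q"
      unfolding s_def by (rule member_le_sum) (use i bp hP in auto)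
    ultimately show ?thesis by simp
  qed
  define \<rho> where "\<rho> i q = b (h i) q * inverse (s q)" for i q
  have "partition_of_unity M n (\<lambda>i. C (h i)) \<rho>"
    unfolding partition_of_unity_def
  proof (intro conjI allI impI ballI)
    fix i assume i: "i < n"
    note b = bp[OF hP[OF i]]
    show "C (h i) \<in> atlas M" using b by simp
    show "smooth_fun M (\<rho> i)"
      unfolding smooth_fun_iff \<rho>_def[abs_def]
    proof
      fix c assume c: "c \<in> atlas M"
      note o = chart_on_cdom[OF c]
      have "smooth_in c (cdom c) s"
        unfolding s_def[abs_def] by (intro smooth_in_sum smooth_fun_sm[OF _ o]) (use bp hP in auto)
      then have "smooth_in c (cdom c) (\<lambda>q. inverse (s q))"
        by (rule smooth_in_inverse[OF o]) (use spos cdom_subset_points[OF c] in force)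
      then show "smooth_in c (cdom c) (\<lambda>q. b (h i) q * inverse (s q))"
        using b by (intro smooth_in_mult) (auto intro: smooth_fun_sm[OF _ o])
    qed
    show "0 \<le> \<rho> i p" if "p \<in> points M" for p
      using b spos[OF that] by (simp add: \<rho>_def)
    have "{p \<in> points M. \<rho> i p \<noteq> 0} \<subseteq> {p \<in> points M. b (h i) p \<noteq> 0}"
      by (auto simp: \<rho>_def)
    then show "top_of M closure_of {p \<in> points M. \<rho> i p \<noteq> 0} \<subseteq> cdom (C (h i))"
      using closure_of_mono b by blast
  next
    fix p assume p: "p \<in> points M"
    have "(\<Sum>i<n. \<rho> i p) = s p * inverse (s p)"
      unfolding \<rho>_def by (simp add: s_def sum_distrib_right)
    then show "(\<Sum>i<n. \<rho> i p) = 1" using spos[OF p] by simp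
  qed
  then show ?thesis by blast
qed

section \<open>Independence of the partition; linearity and monotonicity of the integral\<close>

definition tsupport :: "('a \<Rightarrow> real) \<Rightarrow> 'a set" where
  "tsupport f = top_of M closure_of {p \<in> points M. f p \<noteq> 0}"

lemma supported_tsupport: "supported f (tsupport f)"
  unfolding supported_def tsupport_def
  using closure_of_subset[of "{p \<in> points M. f p \<noteq> 0}" "top_of M"] by auto

lemma supported_mult:
  "supported f S \<Longrightarrow> supported (\<lambda>p. f p * g p) S" "supported f S \<Longrightarrow> supported (\<lambda>p. g p * f p) S"
  by (auto simp: supported_def)

lemma smooth_fun_mult: "smooth_fun M f \<Longrightarrow> smooth_fun M g \<Longrightarrow> smooth_fun M (\<lambda>p. f p * g p)"
  by (simp add: smooth_fun_iff smooth_in_mult)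

definition part_int :: "nat \<Rightarrow> (nat \<Rightarrow> 'a chart) \<Rightarrow> (nat \<Rightarrow> 'a \<Rightarrow> real) \<Rightarrow> ('a \<Rightarrow> real) \<Rightarrow> real" where
  "part_int n c \<rho> f = (\<Sum>i<n. chart_int (c i) (\<lambda>p. \<rho> i p * f p))"

lemma part_unity:
  assumes "partition_of_unity M n c \<rho>"
  shows "i < n \<Longrightarrow> c i \<in> atlas M" "i < n \<Longrightarrow> smooth_fun M (\<rho> i)" "i < n \<Longrightarrow> p \<in> points M \<Longrightarrow> 0 \<le> \<rho> i p"
    "i < n \<Longrightarrow> tsupport (\<rho> i) \<subseteq> cdom (c i)" "p \<in> points M \<Longrightarrow> (\<Sum>i<n. \<rho> i p) = 1"
  using assms by (simp_all add: partition_of_unity_def tsupport_def)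

text \<open>Each piece of \<open>f\<close> is supported in both \<open>c i\<close> and
  \<open>d\<close>, so it can be integrated in \<open>d\<close>, where the pieces add up to
  \<open>f\<close>.\<close>

lemma part_int_supported:
  assumes P: "partition_of_unity M n c \<rho>" and d: "d \<in> atlas M" and f: "smooth_fun M f"
    and S: "supported f S" "S \<subseteq> cdom d"
  shows "part_int n c \<rho> f = chart_int d f"
proof -
  note pu = part_unity[OF P]
  let ?T = "\<lambda>i. tsupport (\<rho> i) \<inter> S"
  have sup: "supported (\<lambda>p. \<rho> i p * f p) (?T i)" for i
    using supported_tsupport[of "\<rho> i"] S(1) by (auto simp: supported_def)
  have "part_int n c \<rho> f = (\<Sum>i<n. chart_int d (\<lambda>p. \<rho> i p * f p))"
    unfolding part_int_def
  proof (rule sum.cong[OF refl])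
    fix i assume "i \<in> {..<n}"
    then have i: "i < n" by simp
    show "chart_int (c i) (\<lambda>p. \<rho> i p * f p) = chart_int d (\<lambda>p. \<rho> i p * f p)"
      by (rule chart_int_change[OF pu(1)[OF i] d smooth_fun_mult[OF pu(2)[OF i] f] sup]) (use pu(4)[OF i] S(2) in auto)
  qed
  also have "\<dots> = chart_int d (\<lambda>p. \<Sum>i<n. \<rho> i p * f p)"
    by (rule chart_int_sum[OF d _ _ sup, symmetric])
      (use S(2) in \<open>auto intro!: smooth_fun_mult smooth_fun_sm[OF _ chart_on_cdom[OF d]] pu(2) f\<close>)
  also have "\<dots> = chart_int d f"
    by (rule chart_int_cong) (use cdom_subset_points[OF d] pu(5) in \<open>auto simp: sum_distrib_right[symmetric]\<close>)
  finally show ?thesis .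
qed

text \<open>Inserting the second partition into each summand of the first gives a double sum over
  the products of the two families; exchanging the sums and collapsing the first partition leaves
  the other integral.\<close>

lemma part_int_independent:
  assumes P: "partition_of_unity M n c \<rho>" and P': "partition_of_unity M n' c' \<sigma>" and f: "smooth_fun M f"
  shows "part_int n c \<rho> f = part_int n' c' \<sigma> f"
proof -
  note pu = part_unity[OF P] and pu' = part_unity[OF P']
  have "part_int n c \<rho> f = (\<Sum>i<n. part_int n' c' \<sigma> (\<lambda>p. \<rho> i p * f p))"
    unfolding part_int_def[of n]
  proof (rule sum.cong[OF refl])
    fix i assume "i \<in> {..<n}"
    then have i: "i < n" by simp
    show "chart_int (c i) (\<lambda>p. \<rho> i p * f p) = part_int n' c' \<sigma> (\<lambda>p. \<rho> i p * f p)"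
      by (rule part_int_supported[OF P' pu(1)[OF i] smooth_fun_mult[OF pu(2)[OF i] f]
          supported_mult(1)[OF supported_tsupport] pu(4)[OF i], symmetric])
  qed
  also have "\<dots> = (\<Sum>j<n'. \<Sum>i<n. chart_int (c' j) (\<lambda>p. \<sigma> j p * (\<rho> i p * f p)))"
    unfolding part_int_def by (rule sum.swap)
  also have "\<dots> = part_int n' c' \<sigma> f"
    unfolding part_int_def[of n']
  proof (rule sum.cong[OF refl])
    fix j assume "j \<in> {..<n'}"
    then have j: "j < n'" by simp
    have "(\<Sum>i<n. chart_int (c' j) (\<lambda>p. \<sigma> j p * (\<rho> i p * f p))) = chart_int (c' j) (\<lambda>p. \<Sum>i<n. \<sigma> j p * (\<rho> i p * f p))"
      by (rule chart_int_sum[OF pu'(1)[OF j] _ _ supported_mult(1)[OF supported_tsupport], symmetric])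
        (use pu'(4)[OF j] in
          \<open>auto intro!: smooth_fun_mult smooth_fun_sm[OF _ chart_on_cdom[OF pu'(1)[OF j]]] pu(2) pu'(2)[OF j] f\<close>)
    also have "\<dots> = chart_int (c' j) (\<lambda>p. \<sigma> j p * f p)"
      by (rule chart_int_cong)
        (use cdom_subset_points[OF pu'(1)[OF j]] pu(5) in
          \<open>auto simp: sum_distrib_left[symmetric] sum_distrib_right[symmetric]\<close>)
    finally show "(\<Sum>i<n. chart_int (c' j) (\<lambda>p. \<sigma> j p * (\<rho> i p * f p))) = chart_int (c' j) (\<lambda>p. \<sigma> j p * f p)" .
  qed
  finally show ?thesis .
qed

text \<open>Existence of a partition and independence of the choice are what make the
  \<open>THE\<close> in \<open>mint\<close> denote a value. Every later evaluation of an integral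
  rests on this and therefore asks for smoothness.\<close>

lemma mint_eq:
  assumes P: "partition_of_unity M n c \<rho>" and f: "smooth_fun M f"
  shows "mint M f = part_int n c \<rho> f"
proof -
  have e: "part_int n c \<rho> f = (\<Sum>i<n. integral (img (c i)) ((\<lambda>p. \<rho> i p * f p * vol_density M (c i) p) \<circ> chart_inv (c i)))"
    for n c \<rho> by (simp add: part_int_def chart_int_def)
  show ?thesis
    unfolding mint_def e[symmetric]
    by (rule the_equality) (use P part_int_independent[OF _ P f] in blast)+
qed

lemma mint_supported:
  assumes "d \<in> atlas M" "smooth_fun M f" "supported f S" "S \<subseteq> cdom d"
  shows "mint M f = chart_int d f"
proof -
  obtain n c \<rho> where P: "partition_of_unity M n c \<rho>" using exists_partition_of_unity by blast
  show ?thesis using mint_eq[OF P assms(2)] part_int_supported[OF P assms] by simp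
qed

lemma mint_sum:
  assumes I: "finite I" and f: "\<And>i. i \<in> I \<Longrightarrow> smooth_fun M (f i)"
  shows "mint M (\<lambda>p. \<Sum>i\<in>I. f i p) = (\<Sum>i\<in>I. mint M (f i))"
proof -
  obtain n c \<rho> where P: "partition_of_unity M n c \<rho>" using exists_partition_of_unity by blast
  note pu = part_unity[OF P]
  have "smooth_fun M (\<lambda>p. \<Sum>i\<in>I. f i p)"
    using f by (simp add: smooth_fun_iff smooth_in_sum)
  then have "mint M (\<lambda>p. \<Sum>i\<in>I. f i p) = (\<Sum>j<n. chart_int (c j) (\<lambda>p. \<Sum>i\<in>I. \<rho> j p * f i p))"
    by (simp add: mint_eq[OF P] part_int_def sum_distrib_left)
  also have "\<dots> = (\<Sum>j<n. \<Sum>i\<in>I. chart_int (c j) (\<lambda>p. \<rho> j p * f i p))"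
  proof (rule sum.cong[OF refl])
    fix j assume "j \<in> {..<n}"
    then have j: "j < n" by simp
    show "chart_int (c j) (\<lambda>p. \<Sum>i\<in>I. \<rho> j p * f i p) = (\<Sum>i\<in>I. chart_int (c j) (\<lambda>p. \<rho> j p * f i p))"
      by (rule chart_int_sum[OF pu(1)[OF j] I _ supported_mult(1)[OF supported_tsupport] pu(4)[OF j]])
        (intro smooth_in_mult smooth_fun_sm pu(2)[OF j] f chart_on_cdom pu(1)[OF j])
  qed
  also have "\<dots> = (\<Sum>i\<in>I. \<Sum>j<n. chart_int (c j) (\<lambda>p. \<rho> j p * f i p))" by (rule sum.swap)
  also have "\<dots> = (\<Sum>i\<in>I. mint M (f i))"
    by (rule sum.cong[OF refl]) (simp add: mint_eq[OF P f] part_int_def)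
  finally show ?thesis .
qed

lemma mint_add:
  assumes "smooth_fun M f" "smooth_fun M g"
  shows "mint M (\<lambda>p. f p + g p) = mint M f + mint M g"
  using mint_sum[of "UNIV :: bool set" "\<lambda>i. if i then f else g"] assms by (simp add: UNIV_bool add.commute)

lemma mint_cmult:
  assumes "smooth_fun M f"
  shows "mint M (\<lambda>p. k * f p) = k * mint M f"
proof -
  obtain n c \<rho> where P: "partition_of_unity M n c \<rho>" using exists_partition_of_unity by blast
  have "smooth_fun M (\<lambda>p. k * f p)"
    using assms by (simp add: smooth_fun_iff smooth_in_mult smooth_in_const)
  then show ?thesis
    by (simp add: mint_eq[OF P] assms part_int_def mult.left_commute[of _ k] chart_int_cmult sum_distrib_left)
qed

lemma mint_mono:
  assumes f: "smooth_fun M f" and g: "smooth_fun M g" and le: "\<And>p. p \<in> points M \<Longrightarrow> f p \<le> g p"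
  shows "mint M f \<le> mint M g"
proof -
  obtain n c \<rho> where P: "partition_of_unity M n c \<rho>" using exists_partition_of_unity by blast
  note pu = part_unity[OF P]
  show ?thesis
    unfolding mint_eq[OF P f] mint_eq[OF P g] part_int_def
  proof (rule sum_mono)
    fix j assume "j \<in> {..<n}"
    then have j: "j < n" by simp
    note c = pu(1)[OF j]
    show "chart_int (c j) (\<lambda>p. \<rho> j p * f p) \<le> chart_int (c j) (\<lambda>p. \<rho> j p * g p)"
    proof (rule chart_int_mono[OF c _ _ supported_mult(1)[OF supported_tsupport] supported_mult(1)[OF supported_tsupport] pu(4)[OF j]])
      fix p assume "p \<in> cdom (c j)"
      then have "p \<in> points M" using cdom_subset_points[OF c] by auto
      then show "\<rho> j p * f p \<le> \<rho> j p * g p" using pu(3)[OF j] le by (intro mult_left_mono)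
    qed (intro smooth_in_mult smooth_fun_sm pu(2)[OF j] f g chart_on_cdom c)+
  qed
qed

lemma mint_nonneg:
  assumes "smooth_fun M f" "\<And>p. p \<in> points M \<Longrightarrow> 0 \<le> f p"
  shows "0 \<le> mint M f"
proof -
  have "smooth_fun M (\<lambda>p. 0)" by (simp add: smooth_fun_iff smooth_in_const)
  from mint_mono[OF this assms] mint_cmult[OF this, of 0] show ?thesis by simp
qed

lemma smooth_fun_cong:
  assumes "\<And>p. p \<in> points M \<Longrightarrow> f p = g p"
  shows "smooth_fun M f \<longleftrightarrow> smooth_fun M g"
  unfolding smooth_fun_iff
  by (intro ball_cong refl smooth_in_cong chart_on_cdom) (use assms cdom_subset_points in auto)

lemma mint_cong:
  assumes "smooth_fun M f" "\<And>p. p \<in> points M \<Longrightarrow> f p = g p"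
  shows "mint M f = mint M g"
  using assms smooth_fun_cong[of f g] by (intro antisym mint_mono) auto

end

subsection \<open>The divergence theorem\<close>

text \<open>The first coordinate direction runs along the boundary line, where steps of both signs
  stay in \<open>A\<close>. Restricted to that line \<open>f\<close> is the zero function of one
  variable.\<close>

lemma pd_1_zero_on_boundary:
  assumes A: "hopen A" and f: "smooth_on A f" and x: "x \<in> A" "x $ 2 = 0"
    and f0: "\<And>y. y \<in> A \<Longrightarrow> y $ 2 = 0 \<Longrightarrow> f y = 0"
  shows "pd A 1 f x = 0"
proof -
  obtain W where W: "open W" "A = half_plane \<inter> W"
    using A openin_open by metis
  obtain r where r: "0 < r" "ball x r \<subseteq> W"
    using W x(1) open_contains_ball by blast
  let ?l = "\<lambda>s. x + s *\<^sub>R axis 1 1" and ?f' = "frechet_derivative f (at x within A)"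
  have l: "?l s \<in> A" "?l s $ 2 = 0" if "s \<in> {-r<..<r}" for s
  proof -
    have "?l s \<in> ball x r" using that by (auto simp: dist_norm abs_less_iff)
    then show "?l s \<in> A" "?l s $ 2 = 0"
      using r(2) x(2) W(2) by (auto simp: half_plane_def axis_def)
  qed
  have "(?l has_derivative (\<lambda>s. s *\<^sub>R axis 1 1)) (at 0 within {-r<..<r})"
    by (auto intro!: derivative_eq_intros)
  moreover have "(f has_derivative ?f') (at (?l 0) within ?l ` {-r<..<r})"
    by (rule has_derivative_subset[of _ _ _ A]) (use smooth_on_has_derivative[OF f x(1)] l(1) in auto)
  ultimately have "((\<lambda>s. f (?l s)) has_derivative (\<lambda>s. ?f' (s *\<^sub>R axis 1 1))) (at 0 within {-r<..<r})"
    using diff_chain_within by (fastforce simp: o_def)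
  then have "((\<lambda>s. 0) has_derivative (\<lambda>s. ?f' (s *\<^sub>R axis 1 1))) (at 0 within {-r<..<r})"
    by (rule has_derivative_transform[rotated -1]) (use r l f0 in auto)
  then have "((\<lambda>s::real. 0::real) has_derivative (\<lambda>s. ?f' (s *\<^sub>R axis 1 1))) (at 0)"
    using r(1) at_within_open[of 0 "{-r<..<r}"] by simp
  then have "(\<lambda>s. ?f' (s *\<^sub>R axis 1 1)) = (\<lambda>s. 0)"
    using has_derivative_unique[OF _ has_derivative_const] by blast
  from fun_cong[OF this, of 1] show ?thesis by (simp add: pd_def)
qed

context riemannian_surface begin

lemma divergence_cong:
  assumes "vf_eq M V W" "p \<in> points M"
  shows "divergence M V p = divergence M W p"
proof -
  note c = chart_at[OF assms(2)]
  have "partial (chart_at M p) i (\<lambda>q. vol_density M (chart_at M p) q * V (chart_at M p) q $ i) p =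
      partial (chart_at M p) i (\<lambda>q. vol_density M (chart_at M p) q * W (chart_at M p) q $ i) p" for i
    by (rule partial_cong[OF chart_on_cdom[OF c(1)] c(2)]) (use assms(1) c(1) in \<open>simp add: vf_eq_def\<close>)
  then show ?thesis by (simp add: divergence_def Let_def)
qed

lemma supported_divergence:
  assumes W: "\<And>c p. c \<in> atlas M \<Longrightarrow> p \<in> cdom c \<Longrightarrow> p \<notin> S \<Longrightarrow> W c p = 0" and S: "closedin (top_of M) S"
  shows "supported (divergence M W) S"
  unfolding supported_def
proof (intro conjI ballI impI S)
  fix p assume p: "p \<in> points M" "p \<notin> S"
  note c = chart_at[OF p(1)]
  let ?c = "chart_at M p"
  have o: "chart_on ?c (cdom ?c - S)"
    using openin_diff[OF openin_cdom[OF c(1)] S] c(1) by (auto simp: chart_on_def)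
  have pU: "p \<in> cdom ?c - S" using c p by auto
  have "partial ?c i (\<lambda>q. vol_density M ?c q * W ?c q $ i) p = partial ?c i (\<lambda>q. 0) p" for i
    by (rule partial_cong[OF o pU]) (use W c in auto)
  then show "divergence M W p = 0"
    by (simp add: divergence_def Let_def partial_const[OF o pU])
qed

text \<open>The area density cancels the denominator of the divergence, leaving two coordinate
  derivatives with compact support. The one in the second direction integrates to zero because the
  normal component vanishes on the boundary.\<close>

lemma divergence_theorem_chart:
  assumes W: "vector_field M W" and d: "d \<in> atlas M"
    and S: "closedin (top_of M) S" "S \<subseteq> cdom d"
    and W0: "\<And>c p. c \<in> atlas M \<Longrightarrow> p \<in> cdom c \<Longrightarrow> p \<notin> S \<Longrightarrow> W c p = 0"
    and bd: "\<And>p. p \<in> cdom d \<Longrightarrow> coord d p $ 2 = 0 \<Longrightarrow> W d p $ 2 = 0"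
  shows "mint M (divergence M W) = 0"
proof -
  let ?A = "img d" let ?K = "coord d ` S"
  define F where "F i x = vol_density M d (chart_inv d x) * W d (chart_inv d x) $ i" for i x
  note o = chart_on_cdom[OF d]
  have A: "hopen ?A" by (rule hopen_img[OF d])
  have K: "compact ?K" "?K \<subseteq> ?A"
    using compact_coord_image[OF d S] coord_image_subset_img[OF S(2)] by auto
  have sF: "smooth_on ?A (F i)" for i
  proof -
    have "smooth_in d (cdom d) (\<lambda>q. vol_density M d q * W d q $ i)"
      by (intro smooth_in_mult smooth_in_vol_density vf_sm W o)
    then show ?thesis by (simp add: smooth_in_iff img_def F_def[abs_def])
  qed
  have F0: "F i x = 0" if "x \<in> ?A" "x \<notin> ?K" for i x
  proof -
    have "chart_inv d x \<notin> S" using that coord_chart_inv by force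
    then show ?thesis using W0[OF d chart_inv_in_cdom[OF that(1)]] by (simp add: F_def)
  qed
  have bF: "F 2 x = 0" if "x \<in> ?A" "x $ 2 = 0" for x
    using bd[OF chart_inv_in_cdom[OF that(1)]] that(2) coord_chart_inv[OF that(1)] by (simp add: F_def)
  have int: "pd ?A i (F i) integrable_on ?A" for i
    by (intro set_lebesgue_integral_eq_integral(1) absolutely_integrable_compact_support[OF K]
        smooth_on_imp_continuous_on smooth_on_pd A sF)
      (rule pd_zero_off_support[OF A compact_imp_closed[OF K(1)] F0])
  have "mint M (divergence M W) = chart_int d (divergence M W)"
    by (rule mint_supported[OF d smooth_divergence[OF W] supported_divergence[OF W0 S(1)] S(2)])
  also have "\<dots> = integral ?A (\<lambda>x. pd ?A 1 (F 1) x + pd ?A 2 (F 2) x)"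
    unfolding chart_int_def
  proof (rule Henstock_Kurzweil_Integration.integral_cong)
    fix x assume x: "x \<in> ?A"
    note p = chart_inv_in_cdom[OF x]
    have "partial d i (\<lambda>q. vol_density M d q * W d q $ i) (chart_inv d x) = pd ?A i (F i) x" for i
      unfolding partial_pd[OF o p] coord_chart_inv[OF x] by (simp add: img_def F_def[abs_def] o_def)
    then show "((\<lambda>p. divergence M W p * vol_density M d p) \<circ> chart_inv d) x = pd ?A 1 (F 1) x + pd ?A 2 (F 2) x"
      using vol_density_pos[OF d p] by (simp add: divergence_eq[OF W d p] chart_div_def sum_2)
  qed
  also have "\<dots> = integral ?A (pd ?A 1 (F 1)) + integral ?A (pd ?A 2 (F 2))"
    by (rule Henstock_Kurzweil_Integration.integral_add[OF int int])
  also have "\<dots> = 0"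
    using integral_pd_compact_support[OF A K sF F0, of 1 1] integral_pd_compact_support[OF A K sF F0, of 2 2] bF by simp
  finally show ?thesis .
qed

text \<open>A partition of unity splits the field into pieces supported in single charts. Scaling by
  its functions keeps the second component zero on the boundary, so no piece has a boundary
  term.\<close>

lemma divergence_theorem:
  assumes V: "vector_field M V"
    and bd: "\<And>c p. c \<in> atlas M \<Longrightarrow> p \<in> cdom c \<Longrightarrow> coord c p $ 2 = 0 \<Longrightarrow> V c p $ 2 = 0"
  shows "mint M (divergence M V) = 0"
proof -
  obtain n c \<rho> where P: "partition_of_unity M n c \<rho>" using exists_partition_of_unity by blast
  note pu = part_unity[OF P]
  let ?W = "\<lambda>i c p. \<rho> i p *\<^sub>R V c p"
  have W: "vector_field M (?W i)" if "i < n" for i by (rule vf_scale[OF pu(2)[OF that] V])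
  have "vf_eq M V (\<lambda>c p. \<Sum>i<n. ?W i c p)"
    unfolding vf_eq_def
  proof (intro ballI)
    fix c p assume "c \<in> atlas M" "p \<in> cdom c"
    then have "p \<in> points M" using cdom_subset_points by blast
    then show "V c p = (\<Sum>i<n. ?W i c p)" by (simp add: scaleR_left.sum[symmetric] pu(5))
  qed
  then have "divergence M V p = (\<Sum>i<n. divergence M (?W i) p)" if "p \<in> points M" for p
    using divergence_cong[OF _ that] divergence_sum[of "{..<n}" ?W p] W that by simp
  then have "mint M (divergence M V) = mint M (\<lambda>p. \<Sum>i<n. divergence M (?W i) p)"
    by (rule mint_cong[OF smooth_divergence[OF V]])
  also have "\<dots> = (\<Sum>i<n. mint M (divergence M (?W i)))"
    by (rule mint_sum) (use W smooth_divergence in auto)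
  also have "\<dots> = 0"
  proof (rule sum.neutral, rule ballI)
    fix i assume "i \<in> {..<n}"
    then have i: "i < n" by simp
    show "mint M (divergence M (?W i)) = 0"
    proof (rule divergence_theorem_chart[OF W[OF i] pu(1)[OF i]])
      show "closedin (top_of M) (tsupport (\<rho> i))" using supported_tsupport[of "\<rho> i"] by (simp add: supported_def)
      show "tsupport (\<rho> i) \<subseteq> cdom (c i)" by (rule pu(4)[OF i])
      show "?W i d p = 0" if "d \<in> atlas M" "p \<in> cdom d" "p \<notin> tsupport (\<rho> i)" for d p
        using supported_tsupport[of "\<rho> i"] that cdom_subset_points[OF that(1)] by (auto simp: supported_def)
      show "?W i (c i) p $ 2 = 0" if "p \<in> cdom (c i)" "coord (c i) p $ 2 = 0" for p
        using bd[OF pu(1)[OF i] that] by simp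
    qed
  qed
  finally show ?thesis .
qed

lemma in_boundary: "c \<in> atlas M \<Longrightarrow> p \<in> cdom c \<Longrightarrow> coord c p $ 2 = 0 \<Longrightarrow> p \<in> boundary M"
  by (auto simp: boundary_def)

lemma boundary_subset_points: "boundary M \<subseteq> points M"
  using cdom_subset_points by (auto simp: boundary_def)

lemma der_mult:
  assumes "smooth_fun M a" "smooth_fun M b" "p \<in> points M"
  shows "der V (\<lambda>p. a p * b p) p = a p * der V b p + b p * der V a p"
proof -
  note c = chart_at[OF assms(3)]
  note o = chart_on_cdom[OF c(1)]
  show ?thesis
    by (simp add: der_def Let_def sum_2 partial_mult[OF o c(2) smooth_fun_sm[OF assms(1) o] smooth_fun_sm[OF assms(2) o]]
        algebra_simps)
qed

text \<open>Integration by parts: the divergence theorem applied to the field \<open>a\<close> times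
  \<open>V\<close>, whose boundary term is removed by the zeros of \<open>a\<close>.\<close>

lemma mint_divergence_scale:
  assumes a: "smooth_fun M a" and V: "vector_field M V" and a0: "\<And>p. p \<in> boundary M \<Longrightarrow> a p = 0"
  shows "mint M (\<lambda>p. a p * divergence M V p) = - mint M (der V a)"
proof -
  have "mint M (divergence M (\<lambda>c p. a p *\<^sub>R V c p)) = 0"
    by (rule divergence_theorem[OF vf_scale[OF a V]]) (use a0 in_boundary in auto)
  moreover have "mint M (divergence M (\<lambda>c p. a p *\<^sub>R V c p)) = mint M (\<lambda>p. a p * divergence M V p + der V a p)"
    by (rule mint_cong[OF smooth_divergence[OF vf_scale[OF a V]] divergence_scale[OF a V]])
  moreover have "\<dots> = mint M (\<lambda>p. a p * divergence M V p) + mint M (der V a)"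
    by (intro mint_add smooth_fun_mult a smooth_divergence smooth_der V)
  ultimately show ?thesis by simp
qed

lemma mint_zero: "(\<And>p. p \<in> points M \<Longrightarrow> f p = 0) \<Longrightarrow> mint M f = 0"
  using mint_cmult[of "\<lambda>p. 0" 0] mint_cong[of "\<lambda>p. 0" f] by (simp add: smooth_fun_iff smooth_in_const)

lemma mint_der_ham:
  assumes "smooth_fun M a" "smooth_fun M b" "\<And>p. p \<in> boundary M \<Longrightarrow> a p = 0"
  shows "mint M (der (ham b) a) = 0"
proof -
  have "mint M (\<lambda>p. a p * divergence M (ham b) p) = 0"
    by (rule mint_zero) (simp add: divergence_ham assms)
  then show ?thesis using mint_divergence_scale[OF assms(1) vf_ham[OF assms(2)] assms(3)] by simp
qed

lemma g_fun_commute: "p \<in> points M \<Longrightarrow> g_fun M V W p = g_fun M W V p"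
  using chart_at[of p] by (simp add: g_fun_def Let_def ip_def inner_vec_def matrix_vector_mult_def sum_2 gmat_21 algebra_simps)

lemma smooth_laplacian: "smooth_fun M a \<Longrightarrow> smooth_fun M (laplacian M a)"
  unfolding laplacian_def by (intro smooth_divergence vf_grad)

text \<open>Green's identity. The boundary condition is imposed on one function only, so that the
  other may be the stream function \<psi>, which is not assumed to vanish on the boundary.\<close>

lemma inner_ham:
  assumes a: "smooth_fun M a" and b: "smooth_fun M b" and a0: "\<And>p. p \<in> boundary M \<Longrightarrow> a p = 0"
  shows "inner_L2 M (ham a) (ham b) = - mint M (\<lambda>p. a p * laplacian M b p)"
proof -
  have "inner_L2 M (ham a) (ham b) = mint M (der (grad M b) a)"
    unfolding inner_L2_def
    by (rule mint_cong[symmetric])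
      (simp_all add: smooth_der vf_grad a b g_fun_ham[symmetric] g_fun_commute)
  then show ?thesis
    using mint_divergence_scale[OF a vf_grad[OF b] a0] by (simp add: laplacian_def)
qed

lemma smooth_g_fun_ham:
  assumes "smooth_fun M a" "smooth_fun M b"
  shows "smooth_fun M (g_fun M (ham a) (ham b))"
  using smooth_der[OF vf_grad[OF assms(1)] assms(2)] smooth_fun_cong[of "g_fun M (ham a) (ham b)"] g_fun_ham by blast

lemma inner_L2_cong:
  assumes "vf_eq M V V'" "vf_eq M W W'" "smooth_fun M (g_fun M V' W')"
  shows "inner_L2 M V W = inner_L2 M V' W'"
  unfolding inner_L2_def
  by (rule mint_cong[OF assms(3), symmetric])
    (use assms(1,2) chart_at in \<open>auto simp: g_fun_def Let_def vf_eq_def\<close>)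

section \<open>The first eigenvalue as a maximal Rayleigh bound\<close>

definition admissible :: "('a \<Rightarrow> real) \<Rightarrow> bool" where
  "admissible f \<longleftrightarrow> smooth_fun M f \<and> (if boundary M = {} then mint M f = 0 else \<forall>p\<in>boundary M. f p = 0)"

lemma inner_ham_nonneg:
  assumes "smooth_fun M a" shows "0 \<le> inner_L2 M (ham a) (ham a)"
  unfolding inner_L2_def by (intro mint_nonneg smooth_g_fun_ham g_fun_nonneg assms)

text \<open>The second alternative covers the surfaces without nonzero admissible functions, where every
  number bounds the Rayleigh quotients and \<open>GREATEST\<close> is unspecified.\<close>

lemma first_eigenvalue_bound:
  assumes f: "admissible f"
  shows "mint M (\<lambda>p. f p * laplacian M f p) \<le> - first_eigenvalue M * mint M (\<lambda>p. (f p)\<^sup>2) \<or>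
    mint M (\<lambda>p. (f p)\<^sup>2) = 0"
proof -
  define q where "q f = mint M (\<lambda>p. f p * laplacian M f p)" for f
  define m where "m f = mint M (\<lambda>p. (f p)\<^sup>2)" for f
  define P where "P l \<longleftrightarrow> (\<forall>f. admissible f \<longrightarrow> q f \<le> - l * m f)" for l
  have l1: "first_eigenvalue M = Greatest P"
    unfolding first_eigenvalue_def P_def admissible_def q_def m_def by (simp add: imp_conjL)
  have m0: "0 \<le> m f" if "admissible f" for f
    unfolding m_def by (rule mint_nonneg) (use that in \<open>auto simp: admissible_def power2_eq_square intro: smooth_fun_mult\<close>)
  have q0: "q f \<le> 0" if "admissible f" for f
  proof -
    have s: "smooth_fun M f" and z: "\<And>p. p \<in> boundary M \<Longrightarrow> f p = 0"
      using that by (auto simp: admissible_def split: if_splits)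
    from inner_ham[OF s s z] inner_ham_nonneg[OF s] show ?thesis by (simp add: q_def)
  qed
  show ?thesis
  proof (cases "m f = 0")
    case False
    then have mf: "0 < m f" using m0[OF f] by simp
    \<comment> \<open>A single admissible function with nonzero square integral bounds all
      candidates by its Rayleigh quotient.\<close>
    have bdd: "l \<le> - q f / m f" if "P l" for l
    proof -
      have "q f \<le> - l * m f" using that f unfolding P_def by blast
      then show ?thesis using mf by (simp add: field_simps)
    qed
    \<comment> \<open>Green's identity makes the quadratic form nonpositive, so 0 is a
      candidate.\<close>
    have ne: "Collect P \<noteq> {}" using q0 by (auto simp: P_def intro!: exI[of _ 0])
    have ba: "bdd_above (Collect P)" using bdd by (auto simp: bdd_above_def)
    define s where "s = Sup (Collect P)"
    \<comment> \<open>Every Rayleigh quotient bounds all candidates from above, hence also their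
      supremum. So the supremum is itself a candidate, and it is the value of
      \<open>GREATEST\<close>.\<close>
    have "P s"
      unfolding P_def
    proof (intro allI impI)
      fix k assume k: "admissible k"
      show "q k \<le> - s * m k"
      proof (cases "m k = 0")
        case True
        then show ?thesis using q0[OF k] by simp
      next
        case False
        then have mk: "0 < m k" using m0[OF k] by simp
        have "l \<le> - q k / m k" if "l \<in> Collect P" for l
        proof -
          have "q k \<le> - l * m k" using that k unfolding P_def by blast
          then show ?thesis using mk by (simp add: field_simps)
        qed
        then have "s \<le> - q k / m k"
          unfolding s_def by (rule cSup_least[OF ne])
        then show ?thesis using mk by (simp add: field_simps)
      qed
    qed
    moreover have "l \<le> s" if "P l" for l
      unfolding s_def by (rule cSup_upper) (use that ba in auto)
    ultimately have "P (Greatest P)"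
      using Greatest_equality[of P s] by simp
    then show ?thesis using f unfolding l1 by (simp add: P_def q_def m_def)
  qed (simp add: m_def)
qed

section \<open>Boundary values of the brackets and the sign of the curvature\<close>

lemma partial_1_zero_on_boundary:
  assumes f: "smooth_fun M f" and f0: "\<And>q. q \<in> boundary M \<Longrightarrow> f q = 0"
    and c: "c \<in> atlas M" "p \<in> cdom c" "coord c p $ 2 = 0"
  shows "partial c 1 f p = 0"
proof -
  note o = chart_on_cdom[OF c(1)]
  have "pd (coord c ` cdom c) 1 (f \<circ> chart_inv c) (coord c p) = 0"
  proof (rule pd_1_zero_on_boundary[OF hopen_coord_image[OF o] _ _ c(3)])
    show "smooth_on (coord c ` cdom c) (f \<circ> chart_inv c)"
      using smooth_fun_sm[OF f o] by (simp add: smooth_in_def)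
    show "coord c p \<in> coord c ` cdom c" using c(2) by simp
    fix y assume "y \<in> coord c ` cdom c" "y $ 2 = 0"
    then show "(f \<circ> chart_inv c) y = 0"
      using chart_inv_on[OF o] f0[OF in_boundary[OF c(1)]] by auto
  qed
  then show ?thesis by (simp add: partial_pd[OF o c(2)])
qed

lemma der_tangent_zero_on_boundary:
  assumes V: "vector_field M V" and t: "\<And>c p. c \<in> atlas M \<Longrightarrow> p \<in> cdom c \<Longrightarrow> coord c p $ 2 = 0 \<Longrightarrow> V c p $ 2 = 0"
    and f: "smooth_fun M f" "\<And>q. q \<in> boundary M \<Longrightarrow> f q = 0" and p: "p \<in> boundary M"
  shows "der V f p = 0"
proof -
  obtain c where c: "c \<in> atlas M" "p \<in> cdom c" "coord c p $ 2 = 0"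
    using p by (auto simp: boundary_def)
  show ?thesis
    by (simp add: der_eq[OF V f(1) c(1,2)] sum_2 t[OF c] partial_1_zero_on_boundary[OF f c])
qed

lemma misiolek_curvature_ham:
  assumes \<psi>: "smooth_fun M \<psi>" and \<phi>: "smooth_fun M \<phi>"
    and u: "vf_eq M (ham \<psi>) u" and Y: "vf_eq M (ham \<phi>) Y"
    and tu: "tangent_to_boundary M u" and tY: "tangent_to_boundary M Y"
  defines "h \<equiv> der (ham \<psi>) \<phi>"
  shows "smooth_fun M h" "\<And>p. p \<in> boundary M \<Longrightarrow> h p = 0" "mint M h = 0 \<or> boundary M \<noteq> {}"
    and "misiolek_curvature M u Y = - inner_L2 M (ham h) (ham h) +
      mint M (\<lambda>p. h p * der (ham \<phi>) (laplacian M \<psi>) p)"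
proof -
  let ?\<omega> = "laplacian M \<psi>"
  define k where "k = der (ham h) \<phi>"
  have vec: "vf_eq M u (ham \<psi>)" "vf_eq M Y (ham \<phi>)" using u Y by (auto simp: vf_eq_def)
  have tang: "ham \<psi> c p $ 2 = 0" "ham \<phi> c p $ 2 = 0" if "c \<in> atlas M" "p \<in> cdom c" "coord c p $ 2 = 0" for c p
    using tangent_component[OF tu that] tangent_component[OF tY that] u Y that by (auto simp: vf_eq_def)
  show h: "smooth_fun M h" unfolding h_def by (rule smooth_der[OF vf_ham[OF \<psi>] \<phi>])
  have k: "smooth_fun M k" unfolding k_def by (rule smooth_der[OF vf_ham[OF h] \<phi>])
  have \<omega>: "smooth_fun M ?\<omega>" by (rule smooth_laplacian[OF \<psi>])
  show h0: "h p = 0" if p: "p \<in> boundary M" for p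
  proof -
    obtain c where c: "c \<in> atlas M" "p \<in> cdom c" "coord c p $ 2 = 0"
      using p by (auto simp: boundary_def)
    \<comment> \<open>Up to the density this derivative is the normal component of Y. As u has no
      normal component either, both terms of d\<phi>(u) vanish.\<close>
    have "partial c 1 \<phi> p = 0"
      using tang(2)[OF c] ham_component(2)[OF c(1,2), of \<phi>] vol_density_pos[OF c(1,2)] by simp
    then show ?thesis
      by (simp add: h_def der_eq[OF vf_ham[OF \<psi>] \<phi> c(1,2)] sum_2 tang(1)[OF c])
  qed
  \<comment> \<open>If the boundary is empty, \<phi> satisfies the boundary condition of
    \<open>mint_der_ham\<close> vacuously. The two alternatives match the case distinction in
    \<open>admissible\<close>.\<close>
  show "mint M h = 0 \<or> boundary M \<noteq> {}"
    unfolding h_def using mint_der_ham[OF \<phi> \<psi>] by blast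
  have kp: "k p = - der (ham \<phi>) h p" if "p \<in> points M" for p
    unfolding k_def by (rule der_ham_antisym[OF h \<phi> that])
  \<comment> \<open>k is minus the derivative of h along Y; on the boundary Y is tangential and h is
    constantly zero.\<close>
  have k0: "k p = 0" if "p \<in> boundary M" for p
  proof -
    have "der (ham \<phi>) h p = 0"
      by (rule der_tangent_zero_on_boundary[OF vf_ham[OF \<phi>] tang(2) h h0 that])
    moreover have "p \<in> points M" using that boundary_subset_points by blast
    ultimately show ?thesis by (simp add: kp)
  qed
  have "vf_eq M (lie_bracket u Y) (lie_bracket (ham \<psi>) (ham \<phi>))" by (rule lie_bracket_cong[OF vec])
  then have b1: "vf_eq M (lie_bracket u Y) (ham h)"
    using lie_bracket_ham[OF \<psi> \<phi>] by (simp add: vf_eq_def h_def)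
  have "vf_eq M (lie_bracket (lie_bracket u Y) Y) (lie_bracket (ham h) (ham \<phi>))"
    by (rule lie_bracket_cong[OF b1 vec(2)])
  then have b2: "vf_eq M (lie_bracket (lie_bracket u Y) Y) (ham k)"
    using lie_bracket_ham[OF h \<phi>] by (simp add: vf_eq_def k_def)
  \<comment> \<open>Y is divergence free and h vanishes on the boundary, so the derivative of h
    \<omega> along Y has integral zero. Leibniz splits it into the two sides, with - k for the
    derivative of h.\<close>
  have "mint M (\<lambda>p. k p * ?\<omega> p) = mint M (\<lambda>p. h p * der (ham \<phi>) ?\<omega> p)"
  proof -
    have d: "smooth_fun M (\<lambda>p. h p * der (ham \<phi>) ?\<omega> p)" "smooth_fun M (\<lambda>p. k p * ?\<omega> p)"
      by (intro smooth_fun_mult h k \<omega> smooth_der vf_ham \<phi>)+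
    have "mint M (der (ham \<phi>) (\<lambda>p. h p * ?\<omega> p)) = 0"
      by (rule mint_der_ham) (simp_all add: smooth_fun_mult h \<omega> \<phi> h0)
    moreover have "mint M (der (ham \<phi>) (\<lambda>p. h p * ?\<omega> p)) =
        mint M (\<lambda>p. h p * der (ham \<phi>) ?\<omega> p + (- 1) * (k p * ?\<omega> p))"
    proof (rule mint_cong)
      show "smooth_fun M (der (ham \<phi>) (\<lambda>p. h p * ?\<omega> p))"
        by (intro smooth_der vf_ham \<phi> smooth_fun_mult h \<omega>)
      fix p assume p: "p \<in> points M"
      show "der (ham \<phi>) (\<lambda>p. h p * ?\<omega> p) p = h p * der (ham \<phi>) ?\<omega> p + (- 1) * (k p * ?\<omega> p)"
        by (simp add: der_mult[OF h \<omega> p] kp[OF p])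
    qed
    moreover have "\<dots> = mint M (\<lambda>p. h p * der (ham \<phi>) ?\<omega> p) + (- 1) * mint M (\<lambda>p. k p * ?\<omega> p)"
      unfolding mint_cmult[OF d(2), symmetric]
      by (rule mint_add[OF d(1)]) (use d(2) in \<open>simp add: smooth_fun_iff smooth_in_minus\<close>)
    ultimately show ?thesis by simp
  qed
  moreover have "inner_L2 M (lie_bracket u Y) (lie_bracket u Y) = inner_L2 M (ham h) (ham h)"
    by (rule inner_L2_cong[OF b1 b1 smooth_g_fun_ham[OF h h]])
  moreover have "inner_L2 M (lie_bracket (lie_bracket u Y) Y) u = inner_L2 M (ham k) (ham \<psi>)"
    by (rule inner_L2_cong[OF b2 vec(1) smooth_g_fun_ham[OF k \<psi>]])
  ultimately show "misiolek_curvature M u Y = - inner_L2 M (ham h) (ham h) +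
      mint M (\<lambda>p. h p * der (ham \<phi>) ?\<omega> p)"
    by (simp add: misiolek_curvature_def inner_ham[OF k \<psi> k0])
qed

lemma misiolek_curvature_nonpos:
  assumes stable: "arnold_stable M u" and tY: "tangent_to_boundary M Y" and Y: "stream_function M Y \<phi>"
  shows "misiolek_curvature M u Y \<le> 0"
proof -
  obtain \<psi> F' where u: "stream_function M u \<psi>"
    and F': "vf_eq M (grad M (laplacian M \<psi>)) (\<lambda>c p. F' p *\<^sub>R grad M \<psi> c p)"
    and range: "(\<forall>p\<in>points M. - first_eigenvalue M < F' p \<and> F' p < (0::real)) \<or> (\<forall>p\<in>points M. 0 < F' p)"
    and tu: "tangent_to_boundary M u"
    using stable unfolding arnold_stable_def stationary_solution_def by blast
  have \<psi>: "smooth_fun M \<psi>" "vf_eq M (ham \<psi>) u" and \<phi>: "smooth_fun M \<phi>" "vf_eq M (ham \<phi>) Y"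
    using u Y by (simp_all add: stream_function_def)
  define h where "h = der (ham \<psi>) \<phi>"
  note MC = misiolek_curvature_ham[OF \<psi>(1) \<phi>(1) \<psi>(2) \<phi>(2) tu tY, folded h_def]
  let ?r = "\<lambda>p. h p * der (ham \<phi>) (laplacian M \<psi>) p"
  \<comment> \<open>This trades the possibly irregular \<open>F'\<close> for the smooth integrand
    \<open>?r\<close>: the product is only evaluated point by point, and integrals are taken of
    \<open>?r\<close> and of multiples of h^2.\<close>
  have r: "?r p = - F' p * (h p)\<^sup>2" if p: "p \<in> points M" for p
  proof -
    note c = chart_at[OF p]
    let ?c = "chart_at M p"
    have "grad M (laplacian M \<psi>) ?c p = F' p *\<^sub>R grad M \<psi> ?c p"
      using F' c by (simp add: vf_eq_def)
    \<comment> \<open>Lowering the index turns proportional gradients into proportional partial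
      derivatives.\<close>
    then have "gmat M ?c p *v grad M (laplacian M \<psi>) ?c p = F' p *\<^sub>R (gmat M ?c p *v grad M \<psi> ?c p)"
      by (simp add: matrix_vector_mult_scaleR)
    then have "partial ?c i (laplacian M \<psi>) p = F' p * partial ?c i \<psi> p" for i
      by (simp add: gmat_grad[OF c] vec_eq_iff)
    then have "der (ham \<phi>) (laplacian M \<psi>) p = F' p * der (ham \<phi>) \<psi> p"
      by (simp add: der_def Let_def sum_distrib_left mult_ac)
    also have "der (ham \<phi>) \<psi> p = - h p"
      unfolding h_def by (rule der_ham_antisym[OF \<phi>(1) \<psi>(1) p])
    finally show ?thesis by (simp add: power2_eq_square)
  qed
  have smr: "smooth_fun M ?r"
    by (intro smooth_fun_mult MC(1) smooth_der vf_ham \<phi>(1) smooth_laplacian \<psi>(1))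
  have smh: "smooth_fun M (\<lambda>p. (h p)\<^sup>2)"
    unfolding power2_eq_square by (intro smooth_fun_mult MC(1))
  note G = inner_ham_nonneg[OF MC(1)]
  from range show ?thesis
  proof
    assume "\<forall>p\<in>points M. 0 < F' p"
    \<comment> \<open>The zero bound is written as a multiple of the integral of h^2 so that
      \<open>mint_cmult\<close> exposes it as the integral of the zero function.\<close>
    then have "mint M ?r \<le> 0 * mint M (\<lambda>p. (h p)\<^sup>2)"
      unfolding mint_cmult[OF smh, symmetric]
      by (intro mint_mono smr) (auto simp: r less_imp_le smooth_fun_iff smooth_in_const)
    with G show ?thesis by (simp add: MC(4))
  next
    let ?l = "first_eigenvalue M"
    assume F: "\<forall>p\<in>points M. - ?l < F' p \<and> F' p < 0"
    have sml: "smooth_fun M (\<lambda>p. ?l * (h p)\<^sup>2)"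
      using smh by (simp add: smooth_fun_iff smooth_in_mult smooth_in_const)
    have "mint M ?r \<le> mint M (\<lambda>p. ?l * (h p)\<^sup>2)"
    proof (rule mint_mono[OF smr sml])
      fix p assume p: "p \<in> points M"
      have "- F' p * (h p)\<^sup>2 \<le> ?l * (h p)\<^sup>2"
        using F p by (intro mult_right_mono) force+
      then show "?r p \<le> ?l * (h p)\<^sup>2" by (simp add: r[OF p])
    qed
    then have R: "mint M ?r \<le> ?l * mint M (\<lambda>p. (h p)\<^sup>2)" by (simp add: mint_cmult[OF smh])
    have "admissible h" using MC(1,2,3) by (auto simp: admissible_def)
    from first_eigenvalue_bound[OF this] show ?thesis
    proof
      assume "mint M (\<lambda>p. h p * laplacian M h p) \<le> - ?l * mint M (\<lambda>p. (h p)\<^sup>2)"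
      moreover have "inner_L2 M (ham h) (ham h) = - mint M (\<lambda>p. h p * laplacian M h p)"
        by (rule inner_ham[OF MC(1,1,2)])
      ultimately show ?thesis using R by (simp add: MC(4))
    next
      \<comment> \<open>In this degenerate case \<open>R\<close> bounds the second term by zero
        whatever value \<open>first_eigenvalue\<close> has.\<close>
      assume "mint M (\<lambda>p. (h p)\<^sup>2) = 0"
      then show ?thesis using R G by (simp add: MC(4))
    qed
  qed
qed

end

theorem theorem1p4:
  fixes M :: "'a surface" and u Y :: "'a vfield"
  assumes "compact_oriented_riemannian_surface M"
    and "arnold_stable M u"
    and "vector_field M Y"
    and "\<forall>p\<in>points M. divergence M Y p = 0"
    and "tangent_to_boundary M Y"
    and "\<exists>\<psi>. stream_function M u \<psi>"
    and "\<exists>\<phi>. stream_function M Y \<phi>"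
  shows "misiolek_curvature M u Y \<le> 0"
proof -
  interpret riemannian_surface M by unfold_locales (rule assms(1))
  from assms(7) obtain \<phi> where "stream_function M Y \<phi>" ..
  then show ?thesis by (rule misiolek_curvature_nonpos[OF assms(2,5)])
qed

end
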